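(* Let $p$ be an odd prime, $q=p^r$ with $r\geq1$, and $n=2t$ with $t\geq5$. The number of equivalence classes of the codes $\mathcal{C}_{h,t,\sigma}\subseteq\mathcal{L}_{n,q}$, where $\sigma$ ranges over all generators of $\mathrm{Gal}(\mathbb{F}_{q^n}/\mathbb{F}_q)$ and $h$ ranges over all elements of $\mathbb{F}_{q^n}$ with $\mathrm{N}_{q^n/q^t}(h)=-1$, is $$\frac{\varphi(t)}{4rtj_t}\sum_{i=0}^{2rt-1}\deg\left(\gcd\left(x^{p^{rt}+1}+1,\;x^{j_t(p^i-1)}-1\right)\right),$$ where $$j_t=\begin{cases}2&\text{if }t\not\equiv2\pmod4,\\ p^{2r}+1&\text{if }t\equiv2\pmod4,\end{cases}$$ and $\varphi$ is Euler's totient function.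
   Context: The gcd's are gcd's of polynomials in $\mathbb{F}_p[x]$ (for $i=0$ the second polynomial is $0$, so the gcd is $x^{p^{rt}+1}+1$). $\mathrm{N}_{q^n/q^t}(h)=h^{q^t+1}=h\,\sigma^t(h)$ is the norm from $\mathbb{F}_{q^n}$ to $\mathbb{F}_{q^t}$. For a generator $\sigma$ of $\mathrm{Gal}(\mathbb{F}_{q^n}/\mathbb{F}_q)$, $\mathcal{L}_{n,q}$ denotes the ring (under addition and composition) of $\sigma$-polynomials $f(x)=\sum_{i=0}^{n-1}f_ix^{\sigma^i}$, $f_i\in\mathbb{F}_{q^n}$, each identified with the $\mathbb{F}_q$-endomorphism $\alpha\mapsto\sum_i f_i\sigma^i(\alpha)$ of $\mathbb{F}_{q^n}$; thus $\mathcal{L}_{n,q}\cong\mathrm{End}_{\mathbb{F}_q}(\mathbb{F}_{q^n})$, independently of $\sigma$. $\langle\cdot\rangle_{\mathbb{F}_{q^n}}$ denotes the span with respect to left multiplication by scalars of $\mathbb{F}_{q^n}$. A rank-metric code is a subset of $\mathcal{L}_{n,q}$. Two rank-metric codes $\mathcal{C}_1,\mathcal{C}_2\subseteq\mathcal{L}_{n,q}$ are equivalent if there exist invertible $f_1,f_2\in\mathcal{L}_{n,q}$ and a field automorphism $\rho\in\mathrm{Aut}(\mathbb{F}_{q^n})$ with $\mathcal{C}_1=\{f_1\circ g^{\rho}\circ f_2: g\in\mathcal{C}_2\}$, where $g^{\rho}(x)=\sum_i\rho(a_i)x^{\sigma^i}$ if $g(x)=\sum_i a_ix^{\sigma^i}$.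 $\mathcal{C}_{h,t,\sigma}=\langle x,\psi_{h,t,\sigma}(x)\rangle_{\mathbb{F}_{q^n}}$, where $\psi_{h,t,\sigma}(x)=x^{\sigma}+x^{\sigma^{t-1}}+h\sigma(h)x^{\sigma^{t+1}}+h\sigma^{-1}(h^{-1})x^{\sigma^{2t-1}}$. *)

theory Defs
  imports Berlekamp_Zassenhaus.Finite_Field "HOL-Number_Theory.Totient"
begin

text \<open>The subfield of order \<open>q\<close>, when \<open>'a\<close> is a field whose order is a power of \<open>q\<close>.\<close>

definition base_field :: "nat \<Rightarrow> 'a::finite_field set" where
  "base_field q = {x. x ^ q = x}"

definition gal :: "nat \<Rightarrow> ('a::finite_field \<Rightarrow> 'a) set" where
  "gal q = {\<sigma>. field_isom \<sigma> \<and> (\<forall>x\<in>base_field q. \<sigma> x = x)}"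

text \<open>The Galois group is finite, so the natural powers of \<open>\<sigma>\<close> exhaust the subgroup it generates.\<close>

definition gal_generator :: "nat \<Rightarrow> ('a::finite_field \<Rightarrow> 'a) \<Rightarrow> bool" where
  "gal_generator q \<sigma> \<longleftrightarrow> \<sigma> \<in> gal q \<and> gal q = {\<sigma> ^^ i | i::nat. True}"

text \<open>
  A \<open>\<sigma>\<close>-polynomial is identified with the endomorphism it induces. Of the coefficient sequence \<open>c\<close>
  only the entries below \<open>n\<close> matter.
\<close>

definition sigma_poly :: "nat \<Rightarrow> ('a::finite_field \<Rightarrow> 'a) \<Rightarrow> (nat \<Rightarrow> 'a) \<Rightarrow> 'a \<Rightarrow> 'a" where
  "sigma_poly n \<sigma> c = (\<lambda>\<alpha>. \<Sum>i<n. c i * (\<sigma> ^^ i) \<alpha>)"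

definition sigma_polys :: "nat \<Rightarrow> ('a::finite_field \<Rightarrow> 'a) \<Rightarrow> ('a \<Rightarrow> 'a) set" where
  "sigma_polys n \<sigma> = range (sigma_poly n \<sigma>)"

definition invertible_sigma_poly :: "nat \<Rightarrow> ('a::finite_field \<Rightarrow> 'a) \<Rightarrow> ('a \<Rightarrow> 'a) \<Rightarrow> bool" where
  "invertible_sigma_poly n \<sigma> f \<longleftrightarrow>
     f \<in> sigma_polys n \<sigma> \<and> (\<exists>g\<in>sigma_polys n \<sigma>. f \<circ> g = id \<and> g \<circ> f = id)"

text \<open>
  Here \<open>\<tau>\<close> is the generator used to write the elements \<open>g\<close> of the ambient ring as polynomials;
  applying \<open>\<rho>\<close> to the coefficients \<open>c\<close> of \<open>g\<close> gives \<open>g\<^sup>\<rho>\<close>. The codes that are compared may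
  have been constructed from other generators of the Galois group.
\<close>

definition code_equiv :: "nat \<Rightarrow> ('a::finite_field \<Rightarrow> 'a) \<Rightarrow> ('a \<Rightarrow> 'a) set \<Rightarrow> ('a \<Rightarrow> 'a) set \<Rightarrow> bool" where
  "code_equiv n \<tau> C1 C2 \<longleftrightarrow>
     C1 \<subseteq> sigma_polys n \<tau> \<and> C2 \<subseteq> sigma_polys n \<tau> \<and>
     (\<exists>f1 f2 \<rho>. invertible_sigma_poly n \<tau> f1 \<and> invertible_sigma_poly n \<tau> f2 \<and> field_isom \<rho> \<and>
        C1 = {f1 \<circ> sigma_poly n \<tau> (\<rho> \<circ> c) \<circ> f2 | c. sigma_poly n \<tau> c \<in> C2})"

text \<open>\<open>inv_into UNIV \<sigma>\<close> is written out because \<open>inv\<close> is also syntax of HOL-Algebra.\<close>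

definition psi :: "'a::finite_field \<Rightarrow> nat \<Rightarrow> ('a \<Rightarrow> 'a) \<Rightarrow> 'a \<Rightarrow> 'a" where
  "psi h t \<sigma> = (\<lambda>x. \<sigma> x + (\<sigma> ^^ (t - 1)) x
      + h * \<sigma> h * (\<sigma> ^^ (t + 1)) x
      + h * inv_into UNIV \<sigma> (inverse h) * (\<sigma> ^^ (2 * t - 1)) x)"

definition code :: "'a::finite_field \<Rightarrow> nat \<Rightarrow> ('a \<Rightarrow> 'a) \<Rightarrow> ('a \<Rightarrow> 'a) set" where
  "code h t \<sigma> = {\<lambda>x. a * x + b * psi h t \<sigma> x | a b. True}"

definition field_norm :: "nat \<Rightarrow> nat \<Rightarrow> 'a::finite_field \<Rightarrow> 'a" where
  "field_norm q t h = h ^ (q ^ t + 1)"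

definition codes :: "nat \<Rightarrow> nat \<Rightarrow> ('a::finite_field \<Rightarrow> 'a) set set" where
  "codes q t = {code h t \<sigma> | h \<sigma>. gal_generator q \<sigma> \<and> field_norm q t h = - 1}"

definition code_classes :: "nat \<Rightarrow> nat \<Rightarrow> ('a::finite_field \<Rightarrow> 'a) \<Rightarrow> ('a \<Rightarrow> 'a) set set set" where
  "code_classes q t \<tau> =
     codes q t // {(C1, C2). C1 \<in> codes q t \<and> C2 \<in> codes q t \<and> code_equiv (2 * t) \<tau> C1 C2}"

definition j_param :: "nat \<Rightarrow> nat \<Rightarrow> nat \<Rightarrow> nat" where
  "j_param p r t = (if t mod 4 = 2 then p ^ (2 * r) + 1 else 2)"

end

theory Submission
  imports Defs
begin

text \<open>
  Write \<open>T\<close> for the involution of the Galois group. If \<open>N(h) = -1\<close>, then \<open>\<psi>\<^sub>h\<^sub>,\<^sub>\<sigma>\<close> splits as \<open>P + M\<close>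
  with \<open>P = (1 + h \<sigma>(h) T) \<sigma>\<close> and \<open>M = (T + h \<sigma>\<inverse>(h)\<inverse>) \<sigma>\<inverse>\<close>, which are semilinear over the fixed
  field \<open>K\<close> of \<open>T\<close> with respect to \<open>\<sigma>\<close> and \<open>\<sigma>\<inverse>\<close>. Independence of characters on \<open>K\<close> allows one to
  compare the parts of a composition degree by degree.

  The left idealiser of a code consists of the scalars, so the left factor of an equivalence is a
  semilinear monomial, and an equivalence amounts to \<open>\<psi>\<^sub>k\<^sub>,\<^sub>\<tau> \<circ> (a x + b \<psi>\<^sub>h\<^sub>,\<^sub>\<sigma>)\<close> lying in the code of
  \<open>(h, \<sigma>)\<close>, up to an automorphism applied to \<open>k\<close>. As \<open>h \<sigma>\<^sup>2(h) \<noteq> 1\<close>, the kernels of \<open>P\<close> and \<open>M\<close> differ,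
  which forces \<open>\<tau>\<close> and \<open>\<sigma>\<^sup>\<plusminus>\<^sup>1\<close> to agree on \<open>K\<close>. Conversely \<open>\<psi>\<^sub>h\<^sub>,\<^sub>\<sigma>\<close> is invertible, with inverse
  essentially \<open>\<psi>\<close> for \<open>1/h\<close> and \<open>\<sigma>\<inverse>\<close>, and for even \<open>t\<close> the codes of \<open>\<sigma>\<close> and \<open>T \<sigma>\<close> are related as
  well; this leaves \<open>\<phi>(t)/2\<close> essentially different \<open>\<sigma>\<close>. For fixed \<open>\<sigma>\<close> the codes of \<open>h\<close> and \<open>k\<close> are
  equivalent iff \<open>\<kappa>(k) = m h\<close> for an automorphism \<open>\<kappa>\<close> and a \<open>j\<^sub>t\<close>-th root of unity \<open>m\<close>. The orbits of
  this relation are counted by Burnside's lemma, where the fixed points are the common roots of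
  the two polynomials.
\<close>

subsection \<open>Polynomials and automorphisms of finite fields\<close>

text \<open>The type-class field is repackaged as a record, so that cyclicity of the multiplicative
  group of a finite field, known for carrier-based rings, applies.\<close>

lemma ff_mult_group_generator: "\<exists>g::'a::finite_field. \<forall>x. x \<noteq> 0 \<longrightarrow> (\<exists>i::nat. x = g ^ i)"
proof -
  define R :: "'a ring" where
    "R = \<lparr>carrier = UNIV, monoid.mult = (*), one = 1, ring.zero = 0, add = (+)\<rparr>"
  have inv_ex: "\<exists>y. x * y = 1" if "x \<noteq> 0" for x :: 'a
    using that right_inverse by blast
  have neg_ex: "\<exists>y. x + y = 0" for x :: 'a
    using add.right_inverse by blast
  interpret R: Ring.field R
    unfolding R_def using inv_ex neg_ex by unfold_locales (auto simp: algebra_simps Units_def)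
  have pow: "x [^]\<^bsub>R\<^esub> i = x ^ i" for x :: 'a and i :: nat
    by (induction i) (simp_all add: R_def)
  have "finite (carrier R)" by (simp add: R_def)
  then obtain g where "carrier (mult_of R) = {g [^]\<^bsub>R\<^esub> i | i::nat. i \<in> UNIV}"
    using R.finite_field_mult_group_has_gen by (auto simp: nat_pow_mult_of)
  moreover have "carrier (mult_of R) = {x. x \<noteq> 0}"
    by (auto simp: R_def)
  ultimately show ?thesis
    unfolding pow by blast
qed

text \<open>A generator \<open>g\<close> of the multiplicative group is a root of the product
  \<open>f\<close> of all \<open>X - g ^ (Q ^ i)\<close> with \<open>i < N\<close>. The
  \<open>Q\<close>-power map permutes these factors cyclically, so the coefficients of
  \<open>f\<close> are fixed by it and hence by \<open>\<rho>\<close>. Thus \<open>\<rho> g\<close>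
  is again a root of \<open>f\<close>, and it determines \<open>\<rho>\<close>.\<close>

lemma automorphism_eq_power:
  fixes \<rho> :: "'a::finite_field \<Rightarrow> 'a"
  assumes "field_isom \<rho>" and Q: "Q = CHAR('a) ^ r" and card: "CARD('a) = Q ^ N" and "N > 0"
    and fixed: "\<And>x. x ^ Q = x \<Longrightarrow> \<rho> x = x"
  shows "\<exists>i<N. \<rho> = (\<lambda>x. x ^ (Q ^ i))"
proof -
  interpret rho: field_isom \<rho> by fact
  have pCHAR: "prime CHAR('a)" by simp
  define F where "F = (\<lambda>x::'a. x ^ Q)"
  have "Q > 0" using Q pCHAR by (simp add: prime_gt_0_nat)
  interpret F: field_hom F
    by unfold_locales
      (use \<open>Q > 0\<close> in \<open>auto simp: F_def power_mult_distrib freshmans_dream'[OF pCHAR Q]\<close>)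
  interpret Fp: map_poly_comm_ring_hom F ..
  obtain g :: 'a where g: "\<And>x. x \<noteq> 0 \<Longrightarrow> \<exists>i::nat. x = g ^ i"
    using ff_mult_group_generator by metis
  define L where "L = (\<lambda>i. [:- (g ^ (Q ^ i)), 1:])"
  define f where "f = (\<Prod>i<N. L i)"
  have FL: "map_poly F (L i) = L (Suc i)" for i
    by (simp add: L_def F.hom_uminus) (simp add: F_def mult.commute flip: power_mult)
  have "map_poly F f = (\<Prod>i<N. L (Suc i))"
    unfolding f_def Fp.hom_prod by (simp add: FL)
  also have "\<dots> = (\<Prod>i\<in>{0<..N}. L i)"
    by (rule prod.reindex_bij_witness[of _ "\<lambda>i. i - 1" Suc]) auto
  also have "\<dots> = (\<Prod>i\<in>{0<..<N}. L i) * L N"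
  proof -
    have "{0<..N} = insert N {0<..<N}" using \<open>N > 0\<close> by auto
    then show ?thesis by (simp add: mult.commute)
  qed
  \<comment> \<open>The cycle of factors closes because \<open>g ^ (Q ^ N) = g\<close>.\<close>
  also have "L N = L 0"
    using finite_field_power_card_eq_same[of g] by (simp add: L_def card)
  also have "(\<Prod>i\<in>{0<..<N}. L i) * L 0 = f"
  proof -
    have "{..<N} = insert 0 {0<..<N}" using \<open>N > 0\<close> by auto
    then show ?thesis by (simp add: f_def mult.commute)
  qed
  finally have "map_poly F f = f" .
  then have "coeff f k ^ Q = coeff f k" for k
    by (metis F_def F.coeff_map_poly_hom)
  then have "map_poly \<rho> f = f"
    by (intro poly_eqI) (simp add: rho.coeff_map_poly_hom fixed)
  then have "poly f (\<rho> g) = \<rho> (poly f g)"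
    by (metis rho.poly_map_poly)
  also have "poly f g = 0"
    using \<open>N > 0\<close> by (auto simp: f_def poly_prod L_def intro!: bexI[of _ 0])
  finally obtain i where i: "i < N" "\<rho> g = g ^ (Q ^ i)"
    by (auto simp: f_def poly_prod L_def)
  have "\<rho> x = x ^ (Q ^ i)" for x
  proof (cases "x = 0")
    case True
    then show ?thesis using \<open>Q > 0\<close> by (simp add: power_0_left)
  next
    case False
    then obtain k where "x = g ^ k" using g by blast
    then show ?thesis
      by (simp add: rho.hom_power i(2) mult.commute flip: power_mult)
  qed
  with i(1) show ?thesis by (intro exI[of _ i] conjI ext)
qed

text \<open>The induction removes \<open>\<chi>\<close> by subtracting \<open>\<chi> w\<close> times the relation at \<open>v\<close> from the relation at
  \<open>v * w\<close>.\<close>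

lemma character_independence:
  fixes \<chi>\<^sub>0 :: "'b::comm_monoid_mult \<Rightarrow> 'a::idom"
  assumes closed: "\<And>x y. x \<in> K \<Longrightarrow> y \<in> K \<Longrightarrow> x * y \<in> K"
    and mult: "\<And>y \<chi> u v. (y, \<chi>) \<in> set L \<union> {(y\<^sub>0, \<chi>\<^sub>0)} \<Longrightarrow> u \<in> K \<Longrightarrow> v \<in> K \<Longrightarrow> \<chi> (u * v) = \<chi> u * \<chi> v"
    and distinct: "\<And>y \<chi>. (y, \<chi>) \<in> set L \<Longrightarrow> \<exists>u\<in>K. \<chi> u \<noteq> \<chi>\<^sub>0 u"
    and rel: "\<And>u. u \<in> K \<Longrightarrow> y\<^sub>0 * \<chi>\<^sub>0 u + (\<Sum>(y, \<chi>)\<leftarrow>L. y * \<chi> u) = 0"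
    and u: "u \<in> K"
  shows "y\<^sub>0 * \<chi>\<^sub>0 u = 0"
  using mult distinct rel
proof (induction "length L" arbitrary: L y\<^sub>0)
  case 0
  then show ?case using u by simp
next
  case (Suc m)
  then obtain z \<chi> L' where L: "L = (z, \<chi>) # L'" and m: "m = length L'"
    by (cases L) auto
  obtain w where w: "w \<in> K" "\<chi> w \<noteq> \<chi>\<^sub>0 w"
    using Suc.prems(2) L by fastforce
  define M where "M = map (\<lambda>(y, \<chi>'). (y * (\<chi>' w - \<chi> w), \<chi>')) L'"
  have "y\<^sub>0 * (\<chi>\<^sub>0 w - \<chi> w) * \<chi>\<^sub>0 u = 0"
  proof (rule Suc.hyps(1)[of M])
    show "m = length M" by (simp add: M_def m)
    show "\<chi>' (a * b) = \<chi>' a * \<chi>' b"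
      if "(y, \<chi>') \<in> set M \<union> {(y\<^sub>0 * (\<chi>\<^sub>0 w - \<chi> w), \<chi>\<^sub>0)}" "a \<in> K" "b \<in> K" for y \<chi>' a b
      using that Suc.prems(1)[of _ \<chi>' a b] by (auto simp: M_def L)
    show "\<exists>a\<in>K. \<chi>' a \<noteq> \<chi>\<^sub>0 a" if "(y, \<chi>') \<in> set M" for y \<chi>'
      using that Suc.prems(2)[of _ \<chi>'] by (auto simp: M_def L)
    show "y\<^sub>0 * (\<chi>\<^sub>0 w - \<chi> w) * \<chi>\<^sub>0 v + (\<Sum>(y, \<chi>)\<leftarrow>M. y * \<chi> v) = 0" if v: "v \<in> K" for v
    proof -
      have 1: "(\<Sum>(y, \<chi>')\<leftarrow>M. y * \<chi>' v)
          = (\<Sum>(y, \<chi>')\<leftarrow>L'. y * \<chi>' (v * w)) - \<chi> w * (\<Sum>(y, \<chi>')\<leftarrow>L'. y * \<chi>' v)"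
        if "\<And>y \<chi>'. (y, \<chi>') \<in> set L' \<Longrightarrow> \<chi>' (v * w) = \<chi>' v * \<chi>' w"
        using that unfolding M_def
      proof (induction L')
        case (Cons a L')
        have "snd a (v * w) = snd a v * snd a w"
          using Cons.prems[of "fst a" "snd a"] by simp
        moreover have "(\<Sum>(y, \<chi>')\<leftarrow>map (\<lambda>(y, \<chi>'). (y * (\<chi>' w - \<chi> w), \<chi>')) L'. y * \<chi>' v)
          = (\<Sum>(y, \<chi>')\<leftarrow>L'. y * \<chi>' (v * w)) - \<chi> w * (\<Sum>(y, \<chi>')\<leftarrow>L'. y * \<chi>' v)"
          using Cons.prems by (intro Cons.IH) auto
        ultimately show ?case
          by (cases a) (simp add: algebra_simps)
      qed simp
      have 2: "(\<Sum>(y, \<chi>')\<leftarrow>M. y * \<chi>' v)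
          = (\<Sum>(y, \<chi>')\<leftarrow>L'. y * \<chi>' (v * w)) - \<chi> w * (\<Sum>(y, \<chi>')\<leftarrow>L'. y * \<chi>' v)"
        by (rule 1) (use Suc.prems(1) v w in \<open>auto simp: L\<close>)
      have mult': "\<chi>\<^sub>0 (v * w) = \<chi>\<^sub>0 v * \<chi>\<^sub>0 w" "\<chi> (v * w) = \<chi> v * \<chi> w"
        using Suc.prems(1) v w by (auto simp: L)
      have neg: "c = - (a + b)" if "a + (b + c) = 0" for a b c :: 'a
        using that minus_unique[of "a + b" c] by (simp add: add.assoc)
      have rel1: "(\<Sum>(y, \<chi>')\<leftarrow>L'. y * \<chi>' (v * w)) = - (y\<^sub>0 * \<chi>\<^sub>0 (v * w) + z * \<chi> (v * w))"
        using Suc.prems(3)[of "v * w"] v w closed by (intro neg) (simp add: L)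
      have rel2: "(\<Sum>(y, \<chi>')\<leftarrow>L'. y * \<chi>' v) = - (y\<^sub>0 * \<chi>\<^sub>0 v + z * \<chi> v)"
        using Suc.prems(3)[of v] v by (intro neg) (simp add: L)
      show ?thesis
        unfolding 2 rel1 rel2 mult' by (simp add: algebra_simps)
    qed
  qed
  with w show ?case by simp
qed

section \<open>Counting roots over finite fields\<close>

lemma degree_diff_eq_left: "degree g < degree f \<Longrightarrow> degree (f - g) = degree (f :: 'a::ab_group_add poly)"
  by (metis degree_add_eq_left degree_minus diff_conv_add_uminus)

lemma degree_monom_diff_1: "m > 0 \<Longrightarrow> degree (monom 1 m - 1 :: 'a::comm_ring_1 poly) = m"
  by (simp add: degree_monom_eq degree_diff_eq_left)

lemma card_power_fixed_le:
  assumes "m > 1"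
  shows "card {x::'a::idom. x ^ m = x} \<le> m"
proof -
  define f where "f = monom 1 m - (monom 1 1 :: 'a poly)"
  have deg: "degree f = m"
    unfolding f_def using assms by (simp add: degree_monom_eq degree_diff_eq_left)
  then have "f \<noteq> 0" using assms by (metis degree_0 not_one_less_zero)
  then have "card {x. poly f x = 0} \<le> m"
    using card_poly_roots_bound deg by metis
  moreover have "{x. poly f x = 0} = {x. x ^ m = x}"
    by (auto simp: f_def poly_monom)
  ultimately show ?thesis by simp
qed

text \<open>The roots of \<open>f\<close> are those of \<open>d\<close> and of its cofactor. Neither
  has more roots than its degree, so a deficit in one cannot be made up by the other.\<close>

lemma card_roots_dvd:
  fixes f d :: "'a::idom poly"
  assumes "f \<noteq> 0" "card {x. poly f x = 0} = degree f" "d dvd f"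
  shows "card {x. poly d x = 0} = degree d"
proof -
  obtain e where e: "f = d * e" using assms(3) by blast
  have nz: "d \<noteq> 0" "e \<noteq> 0" using assms(1) e by auto
  have "{x. poly f x = 0} = {x. poly d x = 0} \<union> {x. poly e x = 0}"
    by (auto simp: e)
  then have "degree f \<le> card {x. poly d x = 0} + card {x. poly e x = 0}"
    using assms(2) card_Un_le by metis
  moreover have "card {x. poly d x = 0} \<le> degree d" "card {x. poly e x = 0} \<le> degree e"
    using nz card_poly_roots_bound by blast+
  moreover have "degree f = degree d + degree e"
    using nz by (simp add: e degree_mult_eq)
  ultimately show ?thesis by simp
qed

lemma finite_field_power_card_minus_1:
  fixes x :: "'a::finite_field"
  shows "x \<noteq> 0 \<Longrightarrow> x ^ (CARD('a) - 1) = 1"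
proof -
  assume x: "x \<noteq> 0"
  have "CARD('a) > 0" by simp
  then have "x ^ CARD('a) = x * x ^ (CARD('a) - 1)"
    by (metis Suc_diff_1 power_Suc)
  then have "x * x ^ (CARD('a) - 1) = x * 1"
    using finite_field_power_card_eq_same[of x] by simp
  then show ?thesis using x by simp
qed

lemma card_gt_1: "CARD('a::finite_field) > 1"
  using card_mono[of UNIV "{0, 1::'a}"] by simp

text \<open>All nonzero field elements are roots of \<open>X ^ (CARD('a) - 1) - 1\<close>, which
  therefore has as many roots as its degree; its divisors inherit this.\<close>

lemma card_roots_dvd_unity:
  fixes d :: "'a::finite_field poly"
  assumes "d dvd monom 1 (CARD('a) - 1) - 1"
  shows "card {x. poly d x = 0} = degree d"
proof (rule card_roots_dvd[OF _ _ assms])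
  have pos: "CARD('a) - 1 > 0"
    using card_gt_1[where ?'a = 'a] by simp
  then have deg: "degree (monom 1 (CARD('a) - 1) - 1 :: 'a poly) = CARD('a) - 1"
    by (rule degree_monom_diff_1)
  then show "monom 1 (CARD('a) - 1) - 1 \<noteq> (0 :: 'a poly)"
    using pos by (metis degree_0 less_irrefl)
  have roots: "{x. poly (monom 1 (CARD('a) - 1) - 1) x = 0} = UNIV - {0::'a}"
    using pos finite_field_power_card_minus_1[where ?'a = 'a] by (auto simp: poly_monom power_0_left)
  then show "card {x. poly (monom 1 (CARD('a) - 1) - 1) x = (0::'a)}
      = degree (monom 1 (CARD('a) - 1) - 1 :: 'a poly)"
    unfolding roots deg by (simp add: card_Diff_subset)
qed

lemma monom_diff_1_dvd: "m dvd M \<Longrightarrow> monom 1 m - 1 dvd (monom 1 M - 1 :: 'a::comm_ring_1 poly)"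
proof -
  assume "m dvd M"
  then obtain k where "M = m * k" by blast
  then have "monom 1 M - 1 = (monom 1 m ^ k - 1 :: 'a poly)"
    by (simp add: monom_power)
  then show ?thesis by (simp only: power_diff_1_eq dvd_triv_left)
qed

lemma card_roots_of_unity:
  assumes "m dvd CARD('a) - 1" "m > 0"
  shows "card {x::'a::finite_field. x ^ m = 1} = m"
  using card_roots_dvd_unity[OF monom_diff_1_dvd[OF assms(1)]] degree_monom_diff_1[OF assms(2), where ?'a = 'a]
  by (simp add: poly_monom)

lemma monom_add_1_dvd:
  assumes "2 * m dvd M"
  shows "monom 1 m + 1 dvd (monom 1 M - 1 :: 'a::comm_ring_1 poly)"
proof -
  have "monom 1 (2 * m) - 1 = (monom 1 m + 1) * (monom 1 m - 1 :: 'a poly)"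
    unfolding mult_2 by (simp add: algebra_simps mult_monom)
  then have "monom 1 m + 1 dvd (monom 1 (2 * m) - 1 :: 'a poly)"
    by simp
  then show ?thesis
    using monom_diff_1_dvd[OF assms] dvd_trans by blast
qed

text \<open>The gcds are taken over the prime field, realised as a separate type; this embedding
  carries them into the large field, where their roots can be counted.\<close>

lemma mod_ring_embedding:
  assumes "CARD('p::prime_card) = CHAR('a::finite_field)"
  shows "inj_comm_ring_hom (\<lambda>x :: 'p mod_ring. of_int (to_int_mod_ring x) :: 'a)"
proof -
  have mod: "of_int (z mod int CARD('p)) = (of_int z :: 'a)" for z
    unfolding assms by (rule of_int_mod_CHAR)
  interpret comm_ring_hom "\<lambda>x :: 'p mod_ring. of_int (to_int_mod_ring x) :: 'a"
    by unfold_locales (simp_all add: to_int_mod_ring_add to_int_mod_ring_mult mod)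
  interpret field_hom "\<lambda>x :: 'p mod_ring. of_int (to_int_mod_ring x) :: 'a" ..
  show ?thesis ..
qed

text \<open>The first polynomial splits into distinct linear factors over the large field, hence so does
  the gcd; its degree is the number of common roots.\<close>

lemma degree_gcd_eq_card_common_roots:
  assumes char: "CARD('p::prime_card) = CHAR('a::finite_field)"
    and dvd: "2 * l dvd CARD('a) - 1" and l: "l > 0"
  shows "degree (gcd (monom 1 l + 1 :: 'p mod_ring poly) (monom 1 m - 1))
    = card {x::'a. x ^ l = - 1 \<and> x ^ m = 1}"
proof -
  define \<iota> where "\<iota> = (\<lambda>x :: 'p mod_ring. of_int (to_int_mod_ring x) :: 'a)"
  interpret \<iota>: inj_comm_ring_hom \<iota>
    unfolding \<iota>_def by (rule mod_ring_embedding[OF char])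
  interpret P: map_poly_inj_comm_ring_hom \<iota> ..
  define f g :: "'p mod_ring poly" where "f = monom 1 l + 1" and "g = monom 1 m - 1"
  define d where "d = gcd f g"
  \<comment> \<open>The Bezout identity survives the embedding and makes every common root of
    \<open>f\<close> and \<open>g\<close> a root of the image of \<open>d\<close>.\<close>
  obtain u v where uv: "u * f + v * g = d"
    unfolding d_def using bezout_coefficients_fst_snd by blast
  have f: "map_poly \<iota> f = monom 1 l + 1" and g: "map_poly \<iota> g = monom 1 m - 1"
    by (simp_all add: f_def g_def P.hom_add P.hom_minus)
  have "d dvd f" "d dvd g" by (simp_all add: d_def)
  then have df: "map_poly \<iota> d dvd map_poly \<iota> f" and dg: "map_poly \<iota> d dvd map_poly \<iota> g"
    by (auto simp: dvd_def P.hom_mult)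
  have "map_poly \<iota> d dvd monom 1 (CARD('a) - 1) - 1"
    using df unfolding f using monom_add_1_dvd[OF dvd] dvd_trans by blast
  then have "degree d = card {x. poly (map_poly \<iota> d) x = 0}"
    using card_roots_dvd_unity by force
  also have "{x. poly (map_poly \<iota> d) x = 0} = {x. x ^ l = - 1 \<and> x ^ m = 1}"
  proof (intro equalityI subsetI CollectI)
    fix x assume "x \<in> {x. poly (map_poly \<iota> d) x = 0}"
    then have "poly (map_poly \<iota> f) x = 0" "poly (map_poly \<iota> g) x = 0"
      using df dg by (auto elim!: dvdE)
    then show "x ^ l = - 1 \<and> x ^ m = 1"
      unfolding f g by (simp add: poly_monom eq_neg_iff_add_eq_0)
  next
    fix x :: 'a assume "x \<in> {x. x ^ l = - 1 \<and> x ^ m = 1}"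
    then have "poly (map_poly \<iota> f) x = 0" "poly (map_poly \<iota> g) x = 0"
      unfolding f g by (simp_all add: poly_monom)
    moreover have "map_poly \<iota> d = map_poly \<iota> u * map_poly \<iota> f + map_poly \<iota> v * map_poly \<iota> g"
      by (simp add: P.hom_add P.hom_mult flip: uv)
    ultimately show "poly (map_poly \<iota> d) x = 0" by simp
  qed
  finally show ?thesis
    unfolding d_def f_def g_def .
qed

text \<open>The images of \<open>0, ..., p - 1\<close> already give \<open>p\<close> solutions of
  \<open>x ^ p = x\<close>, with \<open>p\<close> the characteristic. There are no others, and
  homomorphisms fix these.\<close>

lemma prime_field_fixed:
  fixes \<rho> :: "'a::finite_field \<Rightarrow> 'a"
  assumes "field_isom \<rho>" "x ^ CHAR('a) = x"
  shows "\<rho> x = x"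
proof -
  interpret field_isom \<rho> by fact
  let ?p = "CHAR('a)"
  have prime: "prime ?p" by simp
  have fermat: "(of_nat i :: 'a) ^ ?p = of_nat i" for i
  proof (induction i)
    case 0
    then show ?case using prime_gt_0_nat[OF prime] by (simp add: power_0_left)
  next
    case (Suc i)
    then show ?case by (simp add: freshmans_dream[OF prime])
  qed
  have inj: "inj_on (of_nat :: nat \<Rightarrow> 'a) {..<?p}"
    by (auto simp: inj_on_def of_nat_eq_iff_cong_CHAR cong_def)
  have "{x::'a. x ^ ?p = x} = of_nat ` {..<?p}"
  proof (rule sym, rule card_seteq)
    show "of_nat ` {..<?p} \<subseteq> {x::'a. x ^ ?p = x}"
      using fermat by auto
    have "card {x::'a. x ^ ?p = x} \<le> ?p"
      by (rule card_power_fixed_le[OF prime_gt_1_nat[OF prime]])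
    then show "card {x::'a. x ^ ?p = x} \<le> card (of_nat ` {..<?p} :: 'a set)"
      using inj by (simp add: card_image)
  qed simp
  with assms(2) obtain i :: nat where "x = of_nat i" by blast
  then show ?thesis by (simp add: hom_of_nat)
qed

text \<open>Existence of the exponent is the case of the prime field as base. If the powers for
  \<open>i < k\<close> coincided, every element would satisfy \<open>x ^ (p ^ (k - i)) = x\<close>,
  which has too few solutions.\<close>

lemma automorphisms_eq:
  assumes "CARD('a::finite_field) = CHAR('a) ^ N" "N > 0"
  shows "{\<rho> :: 'a \<Rightarrow> 'a. field_isom \<rho>} = (\<lambda>i x. x ^ (CHAR('a) ^ i)) ` {..<N}"
    and "inj_on (\<lambda>i (x :: 'a). x ^ (CHAR('a) ^ i)) {..<N}"
proof -
  let ?p = "CHAR('a)"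
  have prime: "prime ?p" by simp
  have p1: "?p > 1" using prime prime_gt_1_nat by blast
  have inj: "inj (\<lambda>x::'a. x ^ (?p ^ i))" for i
  proof (rule injI)
    fix x y :: 'a assume eq: "x ^ (?p ^ i) = y ^ (?p ^ i)"
    have "((x - y) + y) ^ (?p ^ i) = (x - y) ^ (?p ^ i) + y ^ (?p ^ i)"
      by (rule freshmans_dream'[OF prime refl])
    then have "(x - y) ^ (?p ^ i) = 0" using eq by simp
    then show "x = y" by simp
  qed
  have isom: "field_isom (\<lambda>x::'a. x ^ (?p ^ i))" for i
  proof -
    have "surj (\<lambda>x::'a. x ^ (?p ^ i))"
      by (rule finite_UNIV_inj_surj[OF finite inj])
    then show ?thesis
      using p1 by unfold_locales
        (simp_all add: power_mult_distrib freshmans_dream'[OF prime refl] power_0_left)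
  qed
  have "\<exists>i<N. \<rho> = (\<lambda>x. x ^ (?p ^ i))" if "field_isom \<rho>" for \<rho> :: "'a \<Rightarrow> 'a"
    by (rule automorphism_eq_power[OF that _ assms prime_field_fixed[OF that], of 1]) simp_all
  then show "{\<rho> :: 'a \<Rightarrow> 'a. field_isom \<rho>} = (\<lambda>i x. x ^ (?p ^ i)) ` {..<N}"
    using isom by (auto simp del: power_eq_0_iff)
  have no: False if ik: "i < k" "k < N" and eq: "(\<lambda>x::'a. x ^ (?p ^ i)) = (\<lambda>x. x ^ (?p ^ k))" for i k
  proof -
    let ?m = "?p ^ (k - i)"
    have fixed: "x ^ ?m = x" for x :: 'a
    proof -
      have "(x ^ ?m) ^ (?p ^ i) = x ^ (?p ^ k)"
        using ik by (simp flip: power_mult power_add)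
      also have "\<dots> = x ^ (?p ^ i)" using fun_cong[OF eq, of x] by simp
      finally show ?thesis by (rule injD[OF inj])
    qed
    have m1: "?m > 1" using one_less_power[OF p1, of "k - i"] ik by simp
    have "CARD('a) \<le> ?m"
      using card_power_fixed_le[OF m1, where ?'a = 'a] fixed by simp
    then have "?p ^ N \<le> ?p ^ (k - i)" by (simp only: assms(1))
    then have "N \<le> k - i" using p1 power_le_imp_le_exp by blast
    then show False using ik by simp
  qed
  show "inj_on (\<lambda>i (x :: 'a). x ^ (?p ^ i)) {..<N}"
  proof (rule inj_onI)
    fix i k assume "i \<in> {..<N}" "k \<in> {..<N}" "(\<lambda>x::'a. x ^ (?p ^ i)) = (\<lambda>x. x ^ (?p ^ k))"
    then show "i = k" using no[of i k] no[of k i] by (cases i k rule: linorder_cases) auto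
  qed
qed

text \<open>The reflection \<open>u \<mapsto> t - u\<close> exchanges the totatives below and above
  \<open>t / 2\<close>; the midpoint itself is not coprime to \<open>t\<close> when
  \<open>t > 2\<close>.\<close>

lemma two_card_coprime_below_half:
  assumes "t > 2"
  shows "2 * card {u::nat. 0 < u \<and> 2 * u < t \<and> coprime u t} = totient t"
proof -
  define R where "R = {u::nat. 0 < u \<and> 2 * u < t \<and> coprime u t}"
  have cop: "coprime (t - u) t \<longleftrightarrow> coprime u t" if "u \<le> t" for u
    using gcd_diff1_nat[of u t] that
    by (metis coprime_iff_gcd_eq_1 diff_diff_cancel diff_le_self gcd.commute gcd_diff2_nat)
  have half: "2 * u \<noteq> t" if "coprime u t" for u
  proof
    assume "2 * u = t"
    then have "u dvd t" by (metis dvd_triv_right)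
    then have "u = 1" using that by (metis coprime_absorb_left nat_dvd_1_iff_1)
    then show False using assms \<open>2 * u = t\<close> by simp
  qed
  have "totatives t = R \<union> (\<lambda>u. t - u) ` R"
  proof (intro equalityI subsetI)
    fix u assume "u \<in> totatives t"
    then have u: "0 < u" "u \<le> t" "coprime u t" by (auto simp: in_totatives_iff)
    moreover have "u \<noteq> t" using u assms by auto
    ultimately show "u \<in> R \<union> (\<lambda>u. t - u) ` R"
    proof (cases "2 * u < t")
      case False
      then have "t - u \<in> R"
        using u \<open>u \<noteq> t\<close> half[of u] cop[of u] by (auto simp: R_def)
      moreover have "u = t - (t - u)" using u by simp
      ultimately show ?thesis by blast
    qed (simp add: R_def)
  next
    fix u assume "u \<in> R \<union> (\<lambda>u. t - u) ` R"
    then show "u \<in> totatives t"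
      using cop by (auto simp: R_def in_totatives_iff)
  qed
  moreover have fin: "finite R"
    by (rule finite_subset[of _ "{..t}"]) (auto simp: R_def)
  moreover have "inj_on (\<lambda>u. t - u) R"
    by (rule inj_onI) (auto simp: R_def)
  moreover have "R \<inter> (\<lambda>u. t - u) ` R = {}"
    by (auto simp: R_def)
  ultimately have "totient t = card R + card R"
    unfolding totient_def by (simp add: card_Un_disjoint card_image)
  then show ?thesis by (simp add: R_def)
qed

subsection \<open>Field extensions of even degree\<close>

locale even_ext =
  fixes p r q t :: nat and ty :: "'a::finite_field itself"
  assumes p: "prime p" "odd p" and r: "r \<ge> 1" and q: "q = p ^ r" and t: "t \<ge> 5"
    and card: "CARD('a) = q ^ (2 * t)"
begin

text \<open>The Galois group is parametrised by the integers modulo \<open>2 * t\<close>, so that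
  inverses and exponents such as \<open>t - s\<close> can be written directly; the residue supplies
  a natural exponent.\<close>

definition \<Phi> :: "int \<Rightarrow> 'a \<Rightarrow> 'a" where
  "\<Phi> i x = x ^ (q ^ nat (i mod int (2 * t)))"

lemma char: "CHAR('a) = p"
proof -
  have "CHAR('a) dvd p ^ (r * (2 * t))"
    using CHAR_dvd_CARD[where ?'a = 'a] by (simp add: card q flip: power_mult)
  then have "CHAR('a) dvd p"
    using prime_dvd_power[of "CHAR('a)"] by simp
  then show ?thesis
    using p(1) by (simp add: primes_dvd_imp_eq)
qed

lemma q_char_power: "q = CHAR('a) ^ r"
  by (simp add: char q)

lemma q_gt_1: "q > 1"
  using one_less_power[OF prime_gt_1_nat[OF p(1)], of r] r q by simp

lemma t_pos [simp]: "t > 0" and t_neq_0 [simp]: "t \<noteq> 0" and two_t_pos: "int (2 * t) > 0"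
  using t by auto

lemma power_q_add: "(x + y :: 'a) ^ (q ^ m) = x ^ (q ^ m) + y ^ (q ^ m)"
  by (rule freshmans_dream'[where n = "r * m"]) (simp_all add: q char power_mult p(1))

lemma power_q_periodic: "(x :: 'a) ^ (q ^ (m + 2 * t * k)) = x ^ (q ^ m)"
proof (induction k)
  case (Suc k)
  have "x ^ (q ^ (m + 2 * t * Suc k)) = (x ^ (q ^ (m + 2 * t * k))) ^ (q ^ (2 * t))"
    by (simp add: power_add algebra_simps flip: power_mult)
  then show ?case
    using Suc finite_field_power_card_eq_same[where ?'a = 'a] by (simp add: card)
qed simp

lemma power_q_mod: "(x :: 'a) ^ (q ^ (m mod (2 * t))) = x ^ (q ^ m)"
  using power_q_periodic[of x "m mod (2 * t)" "m div (2 * t)"] by simp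

lemma Phi_of_nat: "\<Phi> (int m) x = x ^ (q ^ m)"
proof -
  have "nat (int m mod int (2 * t)) = m mod (2 * t)"
    by (metis nat_int of_nat_mod)
  then show ?thesis by (simp only: \<Phi>_def power_q_mod)
qed

lemma Phi_cong_mod: "i mod int (2 * t) = j mod int (2 * t) \<Longrightarrow> \<Phi> i = \<Phi> j"
  by (simp only: \<Phi>_def[abs_def])

lemma obtain_nat_exponent: obtains m where "\<Phi> i = \<Phi> (int m)" "m < 2 * t"
proof
  define m where "m = nat (i mod int (2 * t))"
  have m: "int m = i mod int (2 * t)"
    using two_t_pos by (simp add: m_def)
  show "\<Phi> i = \<Phi> (int m)"
    by (rule Phi_cong_mod) (simp only: m mod_mod_trivial)
  show "m < 2 * t"
    using m two_t_pos by (metis of_nat_less_iff pos_mod_bound)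
qed

lemma Phi_Phi [simp]: "\<Phi> i (\<Phi> j x) = \<Phi> (i + j) x"
proof -
  obtain k where k: "\<Phi> i = \<Phi> (int k)" "int k = i mod int (2 * t)"
    using two_t_pos by (metis Phi_cong_mod mod_mod_trivial nat_0_le pos_mod_sign)
  obtain l where l: "\<Phi> j = \<Phi> (int l)" "int l = j mod int (2 * t)"
    using two_t_pos by (metis Phi_cong_mod mod_mod_trivial nat_0_le pos_mod_sign)
  have "\<Phi> i (\<Phi> j x) = \<Phi> (int (k + l)) x"
    unfolding k(1) l(1) Phi_of_nat by (simp add: power_add mult.commute flip: power_mult)
  also have "\<Phi> (int (k + l)) = \<Phi> (i + j)"
    by (rule Phi_cong_mod) (simp only: of_nat_add k(2) l(2) mod_add_eq)
  finally show ?thesis .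
qed

lemma Phi_0 [simp]: "\<Phi> 0 x = x"
  using Phi_of_nat[of 0] by simp

lemma Phi_add [simp]: "\<Phi> i (x + y) = \<Phi> i x + \<Phi> i y"
  by (simp add: \<Phi>_def power_q_add)

lemma Phi_mult [simp]: "\<Phi> i (x * y) = \<Phi> i x * \<Phi> i y"
  by (simp add: \<Phi>_def power_mult_distrib)

lemma Phi_zero [simp]: "\<Phi> i 0 = 0" and Phi_one [simp]: "\<Phi> i 1 = 1"
  using q_gt_1 by (simp_all add: \<Phi>_def power_0_left)

sublocale Phi: field_hom "\<Phi> i" for i
  by unfold_locales simp_all

lemma Phi_isom: "field_isom (\<Phi> i)"
  by unfold_locales (metis Phi_Phi Phi_0 add.right_inverse surjI)

lemma Phi_eq_0_iff [simp]: "\<Phi> i x = 0 \<longleftrightarrow> x = 0"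
  using q_gt_1 by (simp add: \<Phi>_def)

lemma Phi_minus [simp]: "\<Phi> i (- x) = - \<Phi> i x"
  and Phi_diff [simp]: "\<Phi> i (x - y) = \<Phi> i x - \<Phi> i y"
  and Phi_inverse [simp]: "\<Phi> i (inverse x) = inverse (\<Phi> i x)"
  and Phi_divide [simp]: "\<Phi> i (x / y) = \<Phi> i x / \<Phi> i y"
  and Phi_sum: "\<Phi> i (sum f A) = (\<Sum>a\<in>A. \<Phi> i (f a))"
  and Phi_power: "\<Phi> i (x ^ m) = \<Phi> i x ^ m"
  by (simp_all add: Phi.hom_uminus Phi.hom_minus Phi.hom_inverse Phi.hom_div Phi.hom_sum
      Phi.hom_power)

lemma Phi_inj: "\<Phi> i x = \<Phi> i y \<longleftrightarrow> x = y"
  by (metis Phi_Phi Phi_0 add.left_inverse)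

lemma one_neq_minus_one: "(1 :: 'a) \<noteq> - 1"
proof
  assume "(1 :: 'a) = - 1"
  then have "of_nat 2 = (0 :: 'a)"
    by (metis add.left_inverse one_add_one of_nat_numeral)
  then have "p dvd 2"
    by (metis char of_nat_eq_0_iff_char_dvd)
  then show False
    using p by (metis dvd_refl primes_dvd_imp_eq two_is_prime_nat)
qed

lemma Phi_id_imp:
  assumes "\<And>x. \<Phi> (int m) x = x" "m < 2 * t"
  shows "m = 0"
proof (rule ccontr)
  assume "m \<noteq> 0"
  have "q ^ m > 1"
    using \<open>m \<noteq> 0\<close> q_gt_1 by (metis one_less_power zero_less_iff_neq_zero)
  then have "CARD('a) \<le> q ^ m"
    using card_power_fixed_le[of "q ^ m", where ?'a = 'a] assms(1) by (simp add: Phi_of_nat)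
  then have "q ^ (2 * t) \<le> q ^ m"
    by (simp add: card)
  with \<open>m < 2 * t\<close> q_gt_1 show False
    by (simp add: power_le_imp_le_exp leD)
qed

lemma Phi_eq_iff: "\<Phi> i = \<Phi> j \<longleftrightarrow> int (2 * t) dvd i - j"
proof
  assume eq: "\<Phi> i = \<Phi> j"
  define m where "m = nat ((i - j) mod int (2 * t))"
  have m: "int m = (i - j) mod int (2 * t)"
    using two_t_pos by (simp add: m_def)
  have "\<Phi> (int m) = \<Phi> (i - j)"
    by (rule Phi_cong_mod) (simp only: m mod_mod_trivial)
  moreover have "\<Phi> (i - j) x = x" for x
    using eq Phi_Phi[of "-j" i x] Phi_Phi[of "-j" j x] by simp
  moreover have "m < 2 * t"
    using m two_t_pos by (metis of_nat_less_iff pos_mod_bound)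
  ultimately have "m = 0"
    using Phi_id_imp by metis
  then show "int (2 * t) dvd i - j"
    using m by (simp add: dvd_eq_mod_eq_0)
next
  assume "int (2 * t) dvd i - j"
  then show "\<Phi> i = \<Phi> j"
    by (intro Phi_cong_mod) (simp add: mod_eq_dvd_iff)
qed

lemma Phi_cong: "int (2 * t) dvd i - j \<Longrightarrow> \<Phi> i x = \<Phi> j x"
  using Phi_eq_iff by metis

lemma Phi_fixed_multiple:
  assumes "\<Phi> i x = x"
  shows "\<Phi> (i * k) x = x"
proof -
  have nat: "\<Phi> (j * int m) x = x" if "\<Phi> j x = x" for j m
  proof (induction m)
    case (Suc m)
    have "\<Phi> (j * int (Suc m)) x = \<Phi> j (\<Phi> (j * int m) x)"
      by (simp add: algebra_simps)
    then show ?case using Suc that by simp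
  qed simp
  have "\<Phi> (- i) x = x"
    using Phi_Phi[of "- i" i x] assms by simp
  then show ?thesis
    using nat[OF assms, of "nat k"] nat[of "- i" "nat (- k)"] by (cases "k \<ge> 0") auto
qed

lemma Phi_fixed_gcd:
  assumes "\<Phi> i x = x"
  shows "\<Phi> (gcd i (int (2 * t))) x = x"
proof -
  obtain u v where uv: "u * i + v * int (2 * t) = gcd i (int (2 * t))"
    using bezout_int by blast
  have "\<Phi> (gcd i (int (2 * t))) x = \<Phi> (i * u) x"
  proof (rule Phi_cong)
    have "gcd i (int (2 * t)) - i * u = v * int (2 * t)"
      using uv by (simp only: mult.commute[of i] flip: uv)
    then show "int (2 * t) dvd gcd i (int (2 * t)) - i * u" by simp
  qed
  then show ?thesis using Phi_fixed_multiple[OF assms] by simp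
qed

lemma Phi_fixed_cong:
  assumes "\<Phi> d x = x" "d dvd i - j"
  shows "\<Phi> i x = \<Phi> j x"
proof -
  obtain k where "i - j = d * k" using assms(2) by blast
  then have "i = j + d * k" by simp
  then have "\<Phi> i x = \<Phi> j (\<Phi> (d * k) x)" by simp
  then show ?thesis using Phi_fixed_multiple[OF assms(1)] by simp
qed

text \<open>This form isolates one coefficient: the other exponents only have to differ from
  \<open>i\<^sub>0\<close> modulo \<open>2 * t\<close> and may coincide among themselves, which
  spares case distinctions later.\<close>

lemma Phi_independent:
  assumes rel: "\<And>u. y\<^sub>0 * \<Phi> i\<^sub>0 u + (\<Sum>(y, i)\<leftarrow>L. y * \<Phi> i u) = 0"
    and distinct: "\<And>y i. (y, i) \<in> set L \<Longrightarrow> \<not> int (2 * t) dvd i - i\<^sub>0"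
  shows "y\<^sub>0 = 0"
proof -
  have "y\<^sub>0 * \<Phi> i\<^sub>0 1 = 0"
  proof (rule character_independence[where \<chi>\<^sub>0 = "\<Phi> i\<^sub>0" and u = 1 and K = UNIV and L = "map (\<lambda>(y, i). (y, \<Phi> i)) L"])
    show "\<exists>u\<in>UNIV. \<chi> u \<noteq> \<Phi> i\<^sub>0 u" if mem: "(y, \<chi>) \<in> set (map (\<lambda>(y, i). (y, \<Phi> i)) L)" for y \<chi>
    proof -
      obtain i where "(y, i) \<in> set L" "\<chi> = \<Phi> i"
        using mem by auto
      then show ?thesis
        using distinct[of y i] Phi_eq_iff[of i i\<^sub>0] by blast
    qed
    show "y\<^sub>0 * \<Phi> i\<^sub>0 u + (\<Sum>(y, \<chi>)\<leftarrow>map (\<lambda>(y, i). (y, \<Phi> i)) L. y * \<chi> u) = 0" for u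
      using rel[of u] by (simp add: o_def case_prod_beta')
  qed auto
  then show ?thesis by simp
qed

text \<open>Every relative trace \<open>y + \<Phi> t y\<close> lies in the fixed field of \<open>\<Phi> t\<close>, so an automorphism that is
  trivial there gives a relation between four automorphisms of the whole field.\<close>

lemma Phi_eq_on_subfield:
  assumes eq: "\<And>u. \<Phi> (int t) u = u \<Longrightarrow> \<Phi> i u = \<Phi> j u"
  shows "int t dvd i - j"
proof (rule ccontr)
  assume nd: "\<not> int t dvd i - j"
  have "(1::'a) = 0"
  proof (rule Phi_independent[where i\<^sub>0 = 0
        and L = "[(1, int t), (- 1, i - j), (- 1, i - j + int t)]"])
    show "1 * \<Phi> 0 u + (\<Sum>(y, k)\<leftarrow>[(1, int t), (- 1, i - j), (- 1, i - j + int t)]. y * \<Phi> k u) = 0" for u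
    proof -
      have "\<Phi> (int t + int t) u = \<Phi> 0 u" by (rule Phi_cong) simp
      then have "\<Phi> (int t) (u + \<Phi> (int t) u) = u + \<Phi> (int t) u" by simp
      then have "\<Phi> (-j) (\<Phi> i (u + \<Phi> (int t) u)) = \<Phi> (-j) (\<Phi> j (u + \<Phi> (int t) u))"
        using eq by metis
      then show ?thesis by (simp add: algebra_simps)
    qed
  next
    fix y :: 'a and k assume "(y, k) \<in> set [(1, int t), (- 1, i - j), (- 1, i - j + int t)]"
    then consider "k = int t" | "k = i - j" | "k = i - j + int t" by auto
    then show "\<not> int (2 * t) dvd k - 0"
    proof cases
      case 1
      then show ?thesis using t by (auto dest: zdvd_imp_le)
    next
      case 2
      then show ?thesis using nd
        by (metis diff_zero dvd_mult_right of_nat_mult)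
    next
      case 3
      then show ?thesis using nd
        by (metis diff_zero dvd_add_triv_right_iff dvd_mult_right of_nat_mult)
    qed
  qed
  then show False by simp
qed

text \<open>On the fixed field of \<open>\<Phi> t\<close> automorphisms are distinguished by their
  exponents modulo \<open>t\<close>. This gives semilinear maps over that field a degree modulo
  \<open>t\<close>, by which compositions are split below.\<close>

lemma Phi_independent_subfield:
  assumes rel: "\<And>u. \<Phi> (int t) u = u \<Longrightarrow> y\<^sub>0 * \<Phi> i\<^sub>0 u + (\<Sum>(y, i)\<leftarrow>L. y * \<Phi> i u) = 0"
    and distinct: "\<And>y i. (y, i) \<in> set L \<Longrightarrow> \<not> int t dvd i - i\<^sub>0"
  shows "y\<^sub>0 = 0"
proof -
  have "y\<^sub>0 * \<Phi> i\<^sub>0 1 = 0"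
  proof (rule character_independence[where \<chi>\<^sub>0 = "\<Phi> i\<^sub>0" and u = 1 and K = "{u. \<Phi> (int t) u = u}"
        and L = "map (\<lambda>(y, i). (y, \<Phi> i)) L"])
    show "\<exists>u\<in>{u. \<Phi> (int t) u = u}. \<chi> u \<noteq> \<Phi> i\<^sub>0 u"
      if mem: "(y, \<chi>) \<in> set (map (\<lambda>(y, i). (y, \<Phi> i)) L)" for y \<chi>
    proof -
      obtain i where "(y, i) \<in> set L" "\<chi> = \<Phi> i"
        using mem by auto
      then show ?thesis
        using distinct[of y i] Phi_eq_on_subfield[of i i\<^sub>0] by blast
    qed
    show "y\<^sub>0 * \<Phi> i\<^sub>0 u + (\<Sum>(y, \<chi>)\<leftarrow>map (\<lambda>(y, i). (y, \<Phi> i)) L. y * \<chi> u) = 0"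
      if "u \<in> {u. \<Phi> (int t) u = u}" for u
      using rel[of u] that by (simp add: o_def case_prod_beta')
  qed auto
  then show ?thesis by simp
qed

section \<open>Generators and elements of norm -1\<close>

abbreviation coprime_exp :: "int \<Rightarrow> bool" where
  "coprime_exp s \<equiv> coprime s (int (2 * t))"

definition H :: "'a set" where
  "H = {h. h ^ (q ^ t + 1) = - 1}"

lemma H_iff: "h \<in> H \<longleftrightarrow> h * \<Phi> (int t) h = - 1"
  by (simp add: H_def Phi_of_nat)

lemma H_nonzero: "h \<in> H \<Longrightarrow> h \<noteq> 0"
  unfolding H_iff by auto

lemma Phi_t_H: "h \<in> H \<Longrightarrow> \<Phi> (int t) h = - 1 / h"
  using H_nonzero[of h] unfolding H_iff by (simp add: field_simps)

lemma H_Phi: "h \<in> H \<Longrightarrow> \<Phi> i h \<in> H"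
  unfolding H_iff by (metis Phi_Phi Phi_minus Phi_mult Phi_one add.commute)

lemma H_inverse: "h \<in> H \<Longrightarrow> 1 / h \<in> H"
  using H_nonzero[of h] Phi_t_H[of h] unfolding H_iff by (simp add: field_simps)

lemma odd_if_coprime_exp: "coprime_exp s \<Longrightarrow> odd s"
  by (metis coprime_common_divisor dvd_triv_left even_of_nat odd_one)

lemma coprime_exp_t: "coprime_exp s \<Longrightarrow> coprime s (int t)"
  by (simp add: coprime_mult_right_iff)

lemma coprime_exp_dvd_iff: "coprime_exp s \<Longrightarrow> int t dvd s * k \<longleftrightarrow> int t dvd k"
  using coprime_exp_t by (meson coprime_commute coprime_dvd_mult_right_iff)

text \<open>The bound on \<open>t\<close> matters here: compositions of two maps of degree
  \<open>s\<close> or \<open>- s\<close> have degrees between \<open>- 2 * s\<close> and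
  \<open>2 * s\<close>, so that degrees to be separated differ by at most four times
  \<open>s\<close>.\<close>

lemma not_t_dvd: "k \<noteq> 0 \<Longrightarrow> \<bar>k\<bar> < 5 \<Longrightarrow> \<not> int t dvd k"
  using t by (metis abs_of_nat dvd_imp_le_int le_less_trans not_less of_nat_le_iff of_nat_numeral)

text \<open>As \<open>s\<close> is a unit modulo \<open>2 * t\<close>, the exponent \<open>4\<close>
  is congruent to a multiple of \<open>4 * s\<close>.\<close>

lemma Phi_fixed_4s:
  assumes s: "coprime_exp s" and "\<Phi> (4 * s) x = x"
  shows "\<Phi> 4 x = x"
proof -
  obtain v w where "v * s + w * int (2 * t) = 1"
    using s bezout_int[of s "int (2 * t)"] by auto
  then have "4 - 4 * s * v = int (2 * t) * (4 * w)"
    by (simp add: algebra_simps)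
  then have "\<Phi> 4 x = \<Phi> (4 * s * v) x"
    by (intro Phi_cong) simp
  then show ?thesis
    using Phi_fixed_multiple[OF assms(2)] by simp
qed

lemma Phi_fixed_4_odd:
  assumes "\<Phi> 4 x = x" "odd t"
  shows "\<Phi> 2 x = x"
proof -
  have "gcd 4 (int (2 * t)) = 2"
  proof -
    have "gcd (2 * 2) (2 * int t) = 2 * gcd 2 (int t)"
      by (subst gcd_mult_distrib_int[symmetric]) simp
    moreover have "gcd 2 (int t) = 1"
      using assms(2) by (simp flip: coprime_iff_gcd_eq_1)
    ultimately show ?thesis by simp
  qed
  then show ?thesis
    using Phi_fixed_gcd[OF assms(1)] by simp
qed

text \<open>Applying \<open>\<Phi> (2 * s)\<close> twice inverts \<open>x\<close> twice, so
  \<open>x\<close> is fixed by \<open>\<Phi> 4\<close> and exponents count modulo 4 only. Then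
  \<open>2 * s\<close> may be replaced by \<open>2\<close> because \<open>s\<close> is odd, and the
  residue of \<open>t\<close> modulo 4 decides the rest; this is the origin of the cases in
  \<open>j_param\<close>.\<close>

lemma inverse_pair_cases:
  assumes s: "coprime_exp s" and inv: "x * \<Phi> (2 * s) x = 1"
  shows "\<Phi> 4 x = x" and "odd t \<Longrightarrow> x\<^sup>2 = 1"
    and "t mod 4 = 0 \<Longrightarrow> \<Phi> (int t) x = x"
    and "t mod 4 = 2 \<Longrightarrow> x * \<Phi> (int t) x = 1"
    and "x * \<Phi> 2 x = 1"
proof -
  have x: "x \<noteq> 0" using inv by auto
  have \<Phi>2: "\<Phi> (2 * s) x = 1 / x"
    using inv x by (simp add: field_simps)
  have "\<Phi> (4 * s) x = \<Phi> (2 * s) (\<Phi> (2 * s) x)" by simp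
  also have "\<dots> = x" unfolding \<Phi>2 Phi_divide by (simp add: \<Phi>2)
  finally show 4: "\<Phi> 4 x = x"
    using Phi_fixed_4s[OF s] by simp
  have "4 dvd 2 * s - 2"
    using odd_if_coprime_exp[OF s] by presburger
  then have "\<Phi> (2 * s) x = \<Phi> 2 x"
    using Phi_fixed_cong[OF 4] by simp
  with inv show 2: "x * \<Phi> 2 x = 1" by simp
  show "x\<^sup>2 = 1" if "odd t"
    using 2 Phi_fixed_4_odd[OF 4 that] by (simp add: power2_eq_square)
  show "\<Phi> (int t) x = x" if "t mod 4 = 0"
  proof -
    have "4 dvd int t - 0" using that by presburger
    then show ?thesis using Phi_fixed_cong[OF 4] by fastforce
  qed
  show "x * \<Phi> (int t) x = 1" if "t mod 4 = 2"
  proof -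
    have "4 dvd int t - 2" using that by presburger
    then show ?thesis using Phi_fixed_cong[OF 4, of "int t" 2] 2 by simp
  qed
qed

text \<open>Equality would contradict norm \<open>-1\<close> in each case. For odd \<open>t\<close>
  it gives \<open>h = 1\<close> or \<open>h = - 1\<close>, of norm 1. For \<open>t mod 4 = 2\<close>
  it gives norm 1 directly. If 4 divides \<open>t\<close>, then \<open>h\<^sup>2 = - 1\<close>, so
  \<open>\<Phi> 2 h = h\<close> and the product is \<open>-1\<close> instead of 1.\<close>

lemma H_not_inverse_pair:
  assumes h: "h \<in> H" and s: "coprime_exp s"
  shows "h * \<Phi> (2 * s) h \<noteq> 1"
proof
  assume inv: "h * \<Phi> (2 * s) h = 1"
  note cases = inverse_pair_cases[OF s inv]
  have h0: "h \<noteq> 0" and ht: "h * \<Phi> (int t) h = - 1"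
    using h H_nonzero by (auto simp: H_iff)
  have "odd t \<or> t mod 4 = 0 \<or> t mod 4 = 2" by presburger
  then show False
  proof (elim disjE)
    assume "odd t"
    then have "h = 1 \<or> h = - 1"
      using cases(2) by (simp add: power2_eq_1_iff)
    then show False
      using ht one_neq_minus_one by auto
  next
    assume "t mod 4 = 0"
    then have "h\<^sup>2 = - 1"
      using ht cases(3) by (simp add: power2_eq_square)
    then have "(\<Phi> 1 h)\<^sup>2 = h\<^sup>2"
      by (metis Phi_minus Phi_one Phi_power)
    then have "\<Phi> 1 h = h \<or> \<Phi> 1 h = - h"
      by (simp add: power2_eq_iff)
    then have "\<Phi> 1 (\<Phi> 1 h) = h" by (metis Phi_minus minus_minus)
    then have "\<Phi> 2 h = h" by simp
    then show False
      using cases(5) \<open>h\<^sup>2 = - 1\<close> one_neq_minus_one by (simp add: power2_eq_square)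
  next
    assume "t mod 4 = 2"
    then show False
      using ht cases(4) one_neq_minus_one by simp
  qed
qed

text \<open>This is Hilbert 90 by a Lagrange resolvent \<open>f\<close> along the powers of
  \<open>\<Phi> (2 * s)\<close>. The weights are partial products of conjugates of
  \<open>1 / u\<close>, which alternate between \<open>1\<close> and \<open>1 / u\<close> by the
  hypothesis on \<open>u\<close>; even \<open>t\<close> makes the sum close up. Independence shows
  that \<open>f\<close> is not zero.\<close>

lemma ex_eigenvector:
  assumes s: "coprime_exp s" and ev: "even t" and u: "u * \<Phi> (2 * s) u = 1"
  shows "\<exists>a. a \<noteq> 0 \<and> \<Phi> (2 * s) a = u * a"
proof -
  define c where "c i = (if even i then 1 else 1 / u)" for i :: nat
  define f where "f x = (\<Sum>i<t. c i * \<Phi> (2 * s * int i) x)" for x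
  have u0: "u \<noteq> 0" using u by auto
  have \<Phi>u: "\<Phi> (2 * s) u = 1 / u"
    using u u0 by (simp add: field_simps)
  have \<Phi>c: "\<Phi> (2 * s) (c i) = u * c (Suc i)" for i
    using u0 by (simp add: c_def \<Phi>u)
  have "\<Phi> (2 * s) (f x) = u * f x" for x
  proof -
    define g where "g i = c i * \<Phi> (2 * s * int i) x" for i
    have "\<Phi> (2 * s) (f x) = (\<Sum>i<t. u * g (Suc i))"
      unfolding f_def Phi_sum by (intro sum.cong refl) 
        (simp add: g_def \<Phi>c distrib_left)
    also have "\<dots> = u * ((\<Sum>i<Suc t. g i) - g 0)"
      by (subst sum.lessThan_Suc_shift) (simp add: sum_distrib_left)
    also have "g t = g 0"
    proof -
      have "\<Phi> (2 * s * int t) x = \<Phi> 0 x"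
        by (rule Phi_cong) simp
      then show ?thesis using ev by (simp add: g_def c_def)
    qed
    then have "(\<Sum>i<Suc t. g i) - g 0 = f x" by (simp add: f_def g_def)
    finally show ?thesis .
  qed
  moreover have "\<exists>x. f x \<noteq> 0"
  proof (rule ccontr)
    assume "\<not> ?thesis"
    then have f0: "f x = 0" for x by simp
    have "(1::'a) = 0"
    proof (rule Phi_independent[where i\<^sub>0 = 0 and L = "map (\<lambda>i. (c i, 2 * s * int i)) [1..<t]"])
      fix x
      have "f x = 1 * \<Phi> 0 x + (\<Sum>i\<in>{1..<t}. c i * \<Phi> (2 * s * int i) x)"
      proof -
        have "{..<t} = insert 0 {1..<t}" by auto
        then show ?thesis by (simp add: f_def c_def)
      qed
      also have "(\<Sum>i\<in>{1..<t}. c i * \<Phi> (2 * s * int i) x) =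
          (\<Sum>(y, i)\<leftarrow>map (\<lambda>i. (c i, 2 * s * int i)) [1..<t]. y * \<Phi> i x)"
        by (simp add: o_def interv_sum_list_conv_sum_set_nat)
      finally show "1 * \<Phi> 0 x + (\<Sum>(y, i)\<leftarrow>map (\<lambda>i. (c i, 2 * s * int i)) [1..<t]. y * \<Phi> i x) = 0"
        using f0[of x] by simp
    next
      fix y i assume "(y, i) \<in> set (map (\<lambda>i. (c i, 2 * s * int i)) [1..<t])"
      then obtain k where k: "1 \<le> k" "k < t" "i = 2 * s * int k" by auto
      have "\<not> int t dvd int k"
        using k by (auto dest: zdvd_imp_le)
      then have "\<not> int t dvd s * int k"
        using coprime_exp_dvd_iff[OF s] by simp
      then show "\<not> int (2 * t) dvd i - 0"
        by (simp add: k(3) mult.assoc)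
    qed
    then show False by simp
  qed
  ultimately show ?thesis by blast
qed

section \<open>The two semilinear halves of psi\<close>

definition P\<^sub>\<psi> :: "'a \<Rightarrow> int \<Rightarrow> 'a \<Rightarrow> 'a" where
  "P\<^sub>\<psi> h s x = \<Phi> s x + h * \<Phi> s h * \<Phi> (int t + s) x"

definition M\<^sub>\<psi> :: "'a \<Rightarrow> int \<Rightarrow> 'a \<Rightarrow> 'a" where
  "M\<^sub>\<psi> h s x = \<Phi> (int t - s) x + h / \<Phi> (- s) h * \<Phi> (- s) x"

definition \<Psi> :: "'a \<Rightarrow> int \<Rightarrow> 'a \<Rightarrow> 'a" where
  "\<Psi> h s x = P\<^sub>\<psi> h s x + M\<^sub>\<psi> h s x"

lemma P_add: "P\<^sub>\<psi> h s (x + y) = P\<^sub>\<psi> h s x + P\<^sub>\<psi> h s y"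
  and M_add: "M\<^sub>\<psi> h s (x + y) = M\<^sub>\<psi> h s x + M\<^sub>\<psi> h s y"
  by (simp_all add: P\<^sub>\<psi>_def M\<^sub>\<psi>_def algebra_simps)

lemma P_subfield:
  assumes "\<Phi> (int t) u = u"
  shows "P\<^sub>\<psi> h s (u * x) = \<Phi> s u * P\<^sub>\<psi> h s x"
proof -
  have "\<Phi> (int t + s) u = \<Phi> s u"
    by (rule Phi_fixed_cong[OF assms]) simp
  then show ?thesis by (simp add: P\<^sub>\<psi>_def algebra_simps)
qed

lemma M_subfield:
  assumes "\<Phi> (int t) u = u"
  shows "M\<^sub>\<psi> h s (u * x) = \<Phi> (- s) u * M\<^sub>\<psi> h s x"
proof -
  have "\<Phi> (int t - s) u = \<Phi> (- s) u"
    by (rule Phi_fixed_cong[OF assms]) simp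
  then show ?thesis by (simp add: M\<^sub>\<psi>_def algebra_simps)
qed


lemma subfield_Phi: "\<Phi> (int t) u = u \<Longrightarrow> \<Phi> (int t) (\<Phi> i u) = \<Phi> i u"
  by (metis Phi_Phi add.commute)

text \<open>The vector \<open>v x\<close> is projected onto the solutions of
  \<open>\<Phi> t v = - (\<Phi> s h / h) * v\<close>, the condition for
  \<open>M\<^sub>\<psi>\<close> to vanish. On such vectors \<open>P\<^sub>\<psi>\<close> is
  \<open>(1 - h * \<Phi> (2 * s) h) * \<Phi> s v\<close>, nonzero by
  \<open>H_not_inverse_pair\<close>.\<close>

lemma ex_kernel_M:
  assumes h: "h \<in> H" and s: "coprime_exp s"
  shows "\<exists>v. M\<^sub>\<psi> h s v = 0 \<and> P\<^sub>\<psi> h s v \<noteq> 0"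
proof -
  have h0: "h \<noteq> 0" using H_nonzero h by simp
  have tt: "\<Phi> (int t + i) h = - 1 / \<Phi> i h" for i
    using Phi_Phi[of i "int t" h] Phi_t_H[OF h] by (simp add: add.commute)
  define v where "v x = x - h / \<Phi> s h * \<Phi> (int t) x" for x
  have period: "\<Phi> (2 * int t + i) x = \<Phi> i x" for i x
    by (rule Phi_cong) simp
  have "\<exists>x. v x \<noteq> 0"
  proof (rule ccontr)
    assume "\<not> ?thesis"
    then have v0: "v x = 0" for x by simp
    have "(1::'a) = 0"
      by (rule Phi_independent[where i\<^sub>0 = 0 and L = "[(- h / \<Phi> s h, int t)]"])
        (use v0 t in \<open>auto simp: v_def dest: zdvd_imp_le\<close>)
    then show False by simp
  qed
  then obtain x where x: "v x \<noteq> 0" by blast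
  have tv: "\<Phi> (int t) (v x) = - (\<Phi> s h / h) * v x"
  proof -
    have "\<Phi> (int t) h = - 1 / h" "\<Phi> (int t + s) h = - 1 / \<Phi> s h" "\<Phi> (int t + int t) x = x"
      using tt[of 0] tt[of s] period[of 0 x] by simp_all
    then show ?thesis
      using h0 by (simp add: v_def) (simp add: field_simps)
  qed
  have tv': "\<Phi> (int t + i) (v x) = - (\<Phi> (i + s) h / \<Phi> i h) * \<Phi> i (v x)" for i
    using Phi_Phi[of i "int t" "v x"] unfolding tv by (simp add: add.commute)
  have "M\<^sub>\<psi> h s (v x) = 0"
    using tv'[of "- s"] by (simp add: M\<^sub>\<psi>_def)
  moreover have "P\<^sub>\<psi> h s (v x) = \<Phi> s (v x) * (1 - h * \<Phi> (2 * s) h)"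
    using tv'[of s] h0 by (simp add: P\<^sub>\<psi>_def field_simps)
  then have "P\<^sub>\<psi> h s (v x) \<noteq> 0"
    using x H_not_inverse_pair[OF h s] by simp
  ultimately show ?thesis by blast
qed

subsection \<open>Codes from different generators\<close>

text \<open>A vector in the kernel of the degree \<open>- s\<close> half of \<open>\<Psi> h s\<close> isolates the degree \<open>s\<close> half.\<close>

lemma Psi_comp_not_in_code:
  assumes h: "h \<in> H" and s: "coprime_exp s" and s': "coprime_exp s'"
    and ne: "\<not> int t dvd s' - s" "\<not> int t dvd s' + s"
    and eq: "\<And>x. \<Psi> k s' (a * x + b * \<Psi> h s x) = c\<^sub>0 * x + c * \<Psi> h s x"
    and surj: "surj (\<lambda>x. a * x + b * \<Psi> h s x)"
  shows False
proof -
  have ts: "\<not> int t dvd s * i" if "i \<noteq> 0" "\<bar>i\<bar> < 5" for i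
    using that not_t_dvd coprime_exp_dvd_iff[OF s] by blast
  have ts': "\<not> int t dvd s' * i" if "i \<noteq> 0" "\<bar>i\<bar> < 5" for i
    using that not_t_dvd coprime_exp_dvd_iff[OF s'] by blast
  obtain v where Mv: "M\<^sub>\<psi> h s v = 0" and Pv: "P\<^sub>\<psi> h s v \<noteq> 0"
    using ex_kernel_M[OF h s] by blast
  \<comment> \<open>Evaluate at \<open>u * v\<close> with \<open>u\<close> in the fixed field. The
    left side has only the degrees \<open>s'\<close>, \<open>- s'\<close>, \<open>s' + s\<close> and
    \<open>s - s'\<close>, none congruent to \<open>s\<close>, so the term of degree
    \<open>s\<close> on the right must vanish.\<close>
  have "- c * P\<^sub>\<psi> h s v = 0"
  proof (rule Phi_independent_subfield[where i\<^sub>0 = s and L =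
      "[(P\<^sub>\<psi> k s' (a * v), s'), (M\<^sub>\<psi> k s' (a * v), - s'),
        (P\<^sub>\<psi> k s' (b * P\<^sub>\<psi> h s v), s' + s), (M\<^sub>\<psi> k s' (b * P\<^sub>\<psi> h s v), s - s'), (- c\<^sub>0 * v, 0)]"])
    fix u assume u: "\<Phi> (int t) u = u"
    note sub = P_subfield[OF u] M_subfield[OF u] P_subfield[OF subfield_Phi[OF u]]
      M_subfield[OF subfield_Phi[OF u]]
    have shift: "a * (u * v) + b * \<Psi> h s (u * v) = u * (a * v) + \<Phi> s u * (b * P\<^sub>\<psi> h s v)"
      by (simp add: \<Psi>_def sub Mv algebra_simps)
    have "\<Psi> k s' (u * (a * v) + \<Phi> s u * (b * P\<^sub>\<psi> h s v)) = c\<^sub>0 * (u * v) + c * (\<Phi> s u * P\<^sub>\<psi> h s v)"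
      using eq[of "u * v"] unfolding shift by (simp add: \<Psi>_def[of h] sub Mv)
    then show "- c * P\<^sub>\<psi> h s v * \<Phi> s u + (\<Sum>(y, i)\<leftarrow>
        [(P\<^sub>\<psi> k s' (a * v), s'), (M\<^sub>\<psi> k s' (a * v), - s'),
         (P\<^sub>\<psi> k s' (b * P\<^sub>\<psi> h s v), s' + s), (M\<^sub>\<psi> k s' (b * P\<^sub>\<psi> h s v), s - s'), (- c\<^sub>0 * v, 0)].
        y * \<Phi> i u) = 0"
      by (simp add: \<Psi>_def[of k] P_add M_add sub) (simp add: algebra_simps)
  next
    fix y i
    assume "(y, i) \<in> set [(P\<^sub>\<psi> k s' (a * v), s'), (M\<^sub>\<psi> k s' (a * v), - s'),
        (P\<^sub>\<psi> k s' (b * P\<^sub>\<psi> h s v), s' + s), (M\<^sub>\<psi> k s' (b * P\<^sub>\<psi> h s v), s - s'), (- c\<^sub>0 * v, 0)]"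
    then have "i - s = s' - s \<or> i - s = - (s' + s) \<or> i - s = s' * 1 \<or> i - s = s' * - 1 \<or> i - s = s * - 1"
      by auto
    then show "\<not> int t dvd i - s"
      using ne ts[of "- 1"] ts'[of 1] ts'[of "- 1"] dvd_minus_iff[of "int t" "s' + s"] by force
  qed
  with Pv have c: "c = 0" by simp
  \<comment> \<open>Now the degree 0 term is isolated: every composite has degree \<open>s'\<close>,
    \<open>- s'\<close> or a sum or difference of \<open>s'\<close> and \<open>s\<close> up to sign,
    never 0 modulo \<open>t\<close>.\<close>
  have zero: "c\<^sub>0 * x = 0" for x
  proof -
    have "- (c\<^sub>0 * x) = 0"
    proof (rule Phi_independent_subfield[where i\<^sub>0 = 0 and L =
      "[(P\<^sub>\<psi> k s' (a * x), s'), (M\<^sub>\<psi> k s' (a * x), - s'),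
        (P\<^sub>\<psi> k s' (b * P\<^sub>\<psi> h s x), s' + s), (M\<^sub>\<psi> k s' (b * P\<^sub>\<psi> h s x), s - s'),
        (P\<^sub>\<psi> k s' (b * M\<^sub>\<psi> h s x), s' - s), (M\<^sub>\<psi> k s' (b * M\<^sub>\<psi> h s x), - s' - s)]"])
      fix u assume u: "\<Phi> (int t) u = u"
      note sub = P_subfield[OF u] M_subfield[OF u] P_subfield[OF subfield_Phi[OF u]]
        M_subfield[OF subfield_Phi[OF u]]
      have shift: "a * (u * x) + b * \<Psi> h s (u * x)
          = u * (a * x) + (\<Phi> s u * (b * P\<^sub>\<psi> h s x) + \<Phi> (- s) u * (b * M\<^sub>\<psi> h s x))"
        by (simp add: \<Psi>_def sub algebra_simps)
      have "\<Psi> k s' (u * (a * x) + (\<Phi> s u * (b * P\<^sub>\<psi> h s x) + \<Phi> (- s) u * (b * M\<^sub>\<psi> h s x))) = c\<^sub>0 * (u * x)"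
        using eq[of "u * x"] unfolding shift by (simp add: c)
      then show "- (c\<^sub>0 * x) * \<Phi> 0 u + (\<Sum>(y, i)\<leftarrow>
          [(P\<^sub>\<psi> k s' (a * x), s'), (M\<^sub>\<psi> k s' (a * x), - s'),
           (P\<^sub>\<psi> k s' (b * P\<^sub>\<psi> h s x), s' + s), (M\<^sub>\<psi> k s' (b * P\<^sub>\<psi> h s x), s - s'),
           (P\<^sub>\<psi> k s' (b * M\<^sub>\<psi> h s x), s' - s), (M\<^sub>\<psi> k s' (b * M\<^sub>\<psi> h s x), - s' - s)].
          y * \<Phi> i u) = 0"
        by (simp add: \<Psi>_def P_add M_add sub) (simp add: algebra_simps)
    next
      fix y i
      assume "(y, i) \<in> set [(P\<^sub>\<psi> k s' (a * x), s'), (M\<^sub>\<psi> k s' (a * x), - s'),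
        (P\<^sub>\<psi> k s' (b * P\<^sub>\<psi> h s x), s' + s), (M\<^sub>\<psi> k s' (b * P\<^sub>\<psi> h s x), s - s'),
        (P\<^sub>\<psi> k s' (b * M\<^sub>\<psi> h s x), s' - s), (M\<^sub>\<psi> k s' (b * M\<^sub>\<psi> h s x), - s' - s)]"
      then have "i - 0 = s' * 1 \<or> i - 0 = s' * - 1 \<or> i - 0 = s' + s \<or> i - 0 = - (s' + s) \<or> i - 0 = s' - s
          \<or> i - 0 = - (s' - s)"
        by auto
      then show "\<not> int t dvd i - 0"
        using ne ts'[of 1] ts'[of "- 1"] dvd_minus_iff[of "int t" "s' + s"]
          dvd_minus_iff[of "int t" "s' - s"] by force
    qed
    then show ?thesis by simp
  qed
  \<comment> \<open>By surjectivity of the inner map \<open>\<Psi> k s'\<close> would vanish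
    identically, although its coefficient at \<open>\<Phi> s'\<close> is 1.\<close>
  have 0: "\<Psi> k s' y = 0" for y
  proof -
    obtain x where "y = a * x + b * \<Psi> h s x"
      using surj by (rule surjE)
    then show ?thesis
      using eq[of x] zero[of x] c by simp
  qed
  have "(1::'a) = 0"
  proof (rule Phi_independent[where i\<^sub>0 = s' and L =
      "[(k * \<Phi> s' k, int t + s'), (1, int t - s'), (k / \<Phi> (- s') k, - s')]"])
    show "1 * \<Phi> s' u + (\<Sum>(y, i)\<leftarrow>[(k * \<Phi> s' k, int t + s'), (1, int t - s'), (k / \<Phi> (- s') k, - s')].
        y * \<Phi> i u) = 0" for u
      using 0[of u] by (simp add: \<Psi>_def P\<^sub>\<psi>_def M\<^sub>\<psi>_def algebra_simps)
  next
    fix y i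
    assume "(y, i) \<in> set [(k * \<Phi> s' k, int t + s'), (1, int t - s'), (k / \<Phi> (- s') k, - s')]"
    then have "i - s' = int t \<or> i - s' = int t + s' * - 2 \<or> i - s' = s' * - 2" by auto
    moreover have "\<not> int (2 * t) dvd int t"
      using t by (auto dest: zdvd_imp_le)
    moreover have "int t dvd d" if "int (2 * t) dvd d" for d
      using that by (simp add: dvd_mult_right)
    ultimately show "\<not> int (2 * t) dvd i - s'"
      using ts'[of "- 2"] dvd_add_triv_left_iff[of "int t" "s' * - 2"] by fastforce
  qed
  then show False by simp
qed

subsection \<open>Codes from the same generator\<close>

lemma not_dvd_multiple:
  assumes "coprime_exp s" "k \<noteq> 0" "\<bar>k\<bar> < 5"
  shows "\<not> int t dvd s * k"
  using assms not_t_dvd coprime_exp_dvd_iff by blast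

text \<open>These are the degrees occurring in \<open>\<Psi>\<close> and in its composition with
  another \<open>\<Psi>\<close> for the same \<open>s\<close>. They are pairwise incongruent modulo
  \<open>t\<close>, so coefficients can be read off one by one.\<close>

lemma subfield_degrees:
  assumes s: "coprime_exp s"
    and rel: "\<And>u. \<Phi> (int t) u = u \<Longrightarrow>
      y\<^sub>1 * \<Phi> s u + y\<^sub>2 * \<Phi> (- s) u + y\<^sub>3 * \<Phi> (2 * s) u + y\<^sub>4 * u + y\<^sub>5 * \<Phi> (- 2 * s) u = 0"
  shows "y\<^sub>1 = 0" "y\<^sub>2 = 0" "y\<^sub>3 = 0" "y\<^sub>5 = 0"
proof -
  note nd = not_dvd_multiple[OF s]
  have nds: "\<not> int t dvd s" "\<not> int t dvd - s" "\<not> int t dvd 2 * s" "\<not> int t dvd 3 * s" "\<not> int t dvd 4 * s"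
    "\<not> int t dvd - 2 * s" "\<not> int t dvd - 3 * s" "\<not> int t dvd - 4 * s"
    using nd[of 1] nd[of 2] nd[of 3] nd[of 4] by (simp_all add: mult.commute)
  show "y\<^sub>1 = 0"
    by (rule Phi_independent_subfield[where i\<^sub>0 = s
          and L = "[(y\<^sub>2, - s), (y\<^sub>3, 2 * s), (y\<^sub>4, 0), (y\<^sub>5, - 2 * s)]"])
      (use rel nds in \<open>auto simp: algebra_simps\<close>)
  show "y\<^sub>2 = 0"
    by (rule Phi_independent_subfield[where i\<^sub>0 = "- s"
          and L = "[(y\<^sub>1, s), (y\<^sub>3, 2 * s), (y\<^sub>4, 0), (y\<^sub>5, - 2 * s)]"])
      (use rel nds in \<open>auto simp: algebra_simps\<close>)
  show "y\<^sub>3 = 0"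
    by (rule Phi_independent_subfield[where i\<^sub>0 = "2 * s"
          and L = "[(y\<^sub>1, s), (y\<^sub>2, - s), (y\<^sub>4, 0), (y\<^sub>5, - 2 * s)]"])
      (use rel nds in \<open>auto simp: algebra_simps\<close>)
  show "y\<^sub>5 = 0"
    by (rule Phi_independent_subfield[where i\<^sub>0 = "- 2 * s"
          and L = "[(y\<^sub>1, s), (y\<^sub>2, - s), (y\<^sub>3, 2 * s), (y\<^sub>4, 0)]"])
      (use rel nds in \<open>auto simp: algebra_simps\<close>)
qed

lemma Phi_independent_pair:
  assumes "\<not> int (2 * t) dvd i - j" and rel: "\<And>x. y * \<Phi> i x + z * \<Phi> j x = 0"
  shows "y = 0" "z = 0"
proof -
  have nd: "\<not> int (2 * t) dvd j - i"
    using assms(1) by (metis dvd_minus_iff minus_diff_eq)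
  show "y = 0"
    by (rule Phi_independent[where i\<^sub>0 = i and L = "[(z, j)]"]) (use rel nd in auto)
  show "z = 0"
    by (rule Phi_independent[where i\<^sub>0 = j and L = "[(y, i)]"])
      (use rel assms(1) in \<open>auto simp: add.commute\<close>)
qed

lemma not_two_t_dvd_t: "\<not> int (2 * t) dvd int t" "\<not> int (2 * t) dvd - int t"
  using t by (auto dest: zdvd_imp_le)

lemma Phi_add_2t: "\<Phi> (2 * int t + i) x = \<Phi> i x" "\<Phi> (int t + (int t + i)) x = \<Phi> i x"
  "\<Phi> (int t * 2 + i) x = \<Phi> i x" "\<Phi> (i + int t * 2) x = \<Phi> i x"
  "\<Phi> (int t * 2 - i) x = \<Phi> (- i) x" "\<Phi> (2 * int t - i) x = \<Phi> (- i) x"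
  "\<Phi> (int t + (int t - i)) x = \<Phi> (- i) x" "\<Phi> (i + 2 * int t) x = \<Phi> i x"
  by (rule Phi_cong; simp)+

text \<open>Comparison of degrees separates the contributions of \<open>a\<close> and
  \<open>b\<close>. Whichever is nonzero satisfies two relations linking it to its conjugate under
  \<open>\<Phi> t\<close>; eliminating both leaves an equation between \<open>h\<close> and
  \<open>k\<close> alone.\<close>

lemma Psi_comp_same_generator:
  assumes h: "h \<in> H" and k: "k \<in> H" and s: "coprime_exp s"
    and eq: "\<And>x. \<Psi> k s (a * x + b * \<Psi> h s x) = c\<^sub>0 * x + c * \<Psi> h s x"
    and nz: "a \<noteq> 0 \<or> b \<noteq> 0"
  shows "k * \<Phi> (2 * s) k = h * \<Phi> (2 * s) h"
proof -
  have h0: "h \<noteq> 0" and k0: "k \<noteq> 0" using h k H_nonzero by auto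
  have deg: "P\<^sub>\<psi> k s (a * x) - c * P\<^sub>\<psi> h s x = 0" "M\<^sub>\<psi> k s (a * x) - c * M\<^sub>\<psi> h s x = 0"
    "P\<^sub>\<psi> k s (b * P\<^sub>\<psi> h s x) = 0" "M\<^sub>\<psi> k s (b * M\<^sub>\<psi> h s x) = 0" for x
  proof -
    have rel: "(P\<^sub>\<psi> k s (a * x) - c * P\<^sub>\<psi> h s x) * \<Phi> s u + (M\<^sub>\<psi> k s (a * x) - c * M\<^sub>\<psi> h s x) * \<Phi> (- s) u
        + P\<^sub>\<psi> k s (b * P\<^sub>\<psi> h s x) * \<Phi> (2 * s) u
        + (P\<^sub>\<psi> k s (b * M\<^sub>\<psi> h s x) + M\<^sub>\<psi> k s (b * P\<^sub>\<psi> h s x) - c\<^sub>0 * x) * u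
        + M\<^sub>\<psi> k s (b * M\<^sub>\<psi> h s x) * \<Phi> (- 2 * s) u = 0"
      if u: "\<Phi> (int t) u = u" for u
    proof -
      note sub = P_subfield[OF u] M_subfield[OF u] P_subfield[OF subfield_Phi[OF u]]
        M_subfield[OF subfield_Phi[OF u]]
      have shift: "a * (u * x) + b * \<Psi> h s (u * x)
          = u * (a * x) + (\<Phi> s u * (b * P\<^sub>\<psi> h s x) + \<Phi> (- s) u * (b * M\<^sub>\<psi> h s x))"
        by (simp add: \<Psi>_def sub algebra_simps)
      have "\<Psi> k s (u * (a * x) + (\<Phi> s u * (b * P\<^sub>\<psi> h s x) + \<Phi> (- s) u * (b * M\<^sub>\<psi> h s x)))
          = c\<^sub>0 * (u * x) + c * (\<Phi> s u * P\<^sub>\<psi> h s x + \<Phi> (- s) u * M\<^sub>\<psi> h s x)"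
        using eq[of "u * x"] unfolding shift by (simp add: \<Psi>_def[of h] sub)
      then show ?thesis
        by (simp add: \<Psi>_def[of k] P_add M_add sub) (simp add: algebra_simps)
    qed
    show "P\<^sub>\<psi> k s (a * x) - c * P\<^sub>\<psi> h s x = 0" "M\<^sub>\<psi> k s (a * x) - c * M\<^sub>\<psi> h s x = 0"
      "P\<^sub>\<psi> k s (b * P\<^sub>\<psi> h s x) = 0" "M\<^sub>\<psi> k s (b * M\<^sub>\<psi> h s x) = 0"
      using subfield_degrees[OF s rel] by blast+
  qed
  have key: "\<Phi> s k * \<Phi> (- s) k = \<Phi> s h * \<Phi> (- s) h"
  proof (cases "a = 0")
    case False
    have P: "(\<Phi> s a - c) * \<Phi> s x + (k * \<Phi> s k * \<Phi> (int t + s) a - c * (h * \<Phi> s h)) * \<Phi> (int t + s) x = 0" for x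
      using deg(1)[of x] by (simp add: P\<^sub>\<psi>_def algebra_simps)
    have M: "(\<Phi> (int t - s) a - c) * \<Phi> (int t - s) x
        + (k / \<Phi> (- s) k * \<Phi> (- s) a - c * (h / \<Phi> (- s) h)) * \<Phi> (- s) x = 0" for x
      using deg(2)[of x] by (simp add: M\<^sub>\<psi>_def algebra_simps)
    have "\<Phi> s a = c" "k * \<Phi> s k * \<Phi> (int t + s) a = c * (h * \<Phi> s h)"
      using Phi_independent_pair[OF _ P] not_two_t_dvd_t by simp_all
    then have "k * \<Phi> s k * \<Phi> (int t + s) a = \<Phi> s a * (h * \<Phi> s h)" by simp
    from arg_cong[OF this, of "\<Phi> (- s)"]
    have E1: "\<Phi> (- s) k * k * \<Phi> (int t) a = a * (\<Phi> (- s) h * h)" by simp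
    have "\<Phi> (int t - s) a = c" "k / \<Phi> (- s) k * \<Phi> (- s) a = c * (h / \<Phi> (- s) h)"
      using Phi_independent_pair[OF _ M] not_two_t_dvd_t by simp_all
    then have "k / \<Phi> (- s) k * \<Phi> (- s) a = \<Phi> (int t - s) a * (h / \<Phi> (- s) h)" by simp
    from arg_cong[OF this, of "\<Phi> s"]
    have E2: "\<Phi> s k / k * a = \<Phi> (int t) a * (\<Phi> s h / h)" by simp
    \<comment> \<open>The relation from the degree \<open>s\<close> half and the one from the degree
      \<open>- s\<close> half are multiplied, so that the common factor
      \<open>a * \<Phi> t a\<close> cancels.\<close>
    have "(\<Phi> s k / k * a) * (\<Phi> (- s) k * k * \<Phi> (int t) a)
        = (\<Phi> (int t) a * (\<Phi> s h / h)) * (a * (\<Phi> (- s) h * h))"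
      by (simp only: E1 E2)
    then have "(\<Phi> s k * \<Phi> (- s) k) * (a * \<Phi> (int t) a) = (\<Phi> s h * \<Phi> (- s) h) * (a * \<Phi> (int t) a)"
      using h0 k0 by (simp add: field_simps)
    then show ?thesis
      using False by simp
  next
    case True
    \<comment> \<open>With \<open>a = 0\<close> the degrees \<open>2 * s\<close> and
      \<open>- 2 * s\<close>, where the composition must vanish, provide the two relations for
      \<open>b\<close>.\<close>
    with nz have b: "b \<noteq> 0" by simp
    have P: "(\<Phi> s b + k * \<Phi> s k * \<Phi> (int t + s) b * \<Phi> (int t + s) h * \<Phi> (int t + 2 * s) h) * \<Phi> (2 * s) x
        + (\<Phi> s b * \<Phi> s h * \<Phi> (2 * s) h + k * \<Phi> s k * \<Phi> (int t + s) b) * \<Phi> (int t + 2 * s) x = 0" for x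
      using deg(3)[of x] by (simp add: P\<^sub>\<psi>_def Phi_add_2t algebra_simps)
    have M: "(\<Phi> (int t - s) b + k / \<Phi> (- s) k * \<Phi> (- s) b * (\<Phi> (- s) h / \<Phi> (- 2 * s) h)) * \<Phi> (- 2 * s) x
        + (\<Phi> (int t - s) b * (\<Phi> (int t - s) h / \<Phi> (int t - 2 * s) h) + k / \<Phi> (- s) k * \<Phi> (- s) b)
          * \<Phi> (int t - 2 * s) x = 0" for x
      using deg(4)[of x] by (simp add: M\<^sub>\<psi>_def Phi_add_2t algebra_simps)
    have "\<Phi> s b * \<Phi> s h * \<Phi> (2 * s) h + k * \<Phi> s k * \<Phi> (int t + s) b = 0"
      using Phi_independent_pair(2)[OF _ P] not_two_t_dvd_t by simp
    from arg_cong[OF this, of "\<Phi> (- s)"]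
    have F1: "b * h * \<Phi> s h + \<Phi> (- s) k * k * \<Phi> (int t) b = 0" by simp
    have "\<Phi> (int t - s) b + k / \<Phi> (- s) k * \<Phi> (- s) b * (\<Phi> (- s) h / \<Phi> (- 2 * s) h) = 0"
      using Phi_independent_pair(1)[OF _ M] not_two_t_dvd_t by simp
    from arg_cong[OF this, of "\<Phi> s"]
    have "\<Phi> (int t) b + \<Phi> s k / k * b * (h / \<Phi> (- s) h) = 0" by simp
    then have "\<Phi> (int t) b = - (\<Phi> s k / k * b * (h / \<Phi> (- s) h))"
      by (simp add: eq_neg_iff_add_eq_0)
    with F1 have "b * h * (\<Phi> s h * \<Phi> (- s) h) = b * h * (\<Phi> s k * \<Phi> (- s) k)"
      using h0 k0 by (simp add: field_simps)
    then show ?thesis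
      using b h0 by simp
  qed
  from arg_cong[OF this, of "\<Phi> s"] show ?thesis
    by (simp add: mult.commute)
qed

text \<open>An element of the left idealiser lies in the code, since the identity does, which
  explains its form. Composing with \<open>x \<mapsto> a * x\<close> and comparing the coefficients
  at \<open>\<Phi> s\<close> and \<open>\<Phi> (t - s)\<close> forces these automorphisms to
  coincide if \<open>e\<close> is nonzero, hence \<open>t\<close> to divide
  \<open>2 * s\<close>.\<close>

lemma left_idealiser:
  assumes s: "coprime_exp s"
    and closed: "\<And>a. \<exists>d' e'. \<forall>x. d * (a * x) + e * \<Psi> h s (a * x) = d' * x + e' * \<Psi> h s x"
  shows "e = 0"
proof (rule ccontr)
  assume e: "e \<noteq> 0"
  note nd = not_dvd_multiple[OF s]
  have t_dvd: "int t dvd i" if "int (2 * t) dvd i" for i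
    using that by (simp add: dvd_mult_right)
  have nds: "\<not> int t dvd s" "\<not> int t dvd 2 * s"
    using nd[of 1] nd[of 2] by (simp_all add: mult.commute)
  have "\<Phi> s a = \<Phi> (int t - s) a" for a
  proof -
    obtain d' e' where de: "\<And>x. d * (a * x) + e * \<Psi> h s (a * x) = d' * x + e' * \<Psi> h s x"
      using closed by blast
    have rel: "(e * \<Phi> s a - e') * \<Phi> s x + (e * \<Phi> (int t - s) a - e') * \<Phi> (int t - s) x
      + (e * \<Phi> (int t + s) a - e') * (h * \<Phi> s h) * \<Phi> (int t + s) x
      + (e * \<Phi> (- s) a - e') * (h / \<Phi> (- s) h) * \<Phi> (- s) x + (d * a - d') * x = 0" for x
      using de[of x] by (simp add: \<Psi>_def P\<^sub>\<psi>_def M\<^sub>\<psi>_def algebra_simps)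
    have "e * \<Phi> s a - e' = 0"
    proof (rule Phi_independent[where i\<^sub>0 = s and L = "[(e * \<Phi> (int t - s) a - e', int t - s),
        ((e * \<Phi> (int t + s) a - e') * (h * \<Phi> s h), int t + s),
        ((e * \<Phi> (- s) a - e') * (h / \<Phi> (- s) h), - s), (d * a - d', 0)]"])
      fix y i assume "(y, i) \<in> set [(e * \<Phi> (int t - s) a - e', int t - s),
        ((e * \<Phi> (int t + s) a - e') * (h * \<Phi> s h), int t + s),
        ((e * \<Phi> (- s) a - e') * (h / \<Phi> (- s) h), - s), (d * a - d', 0)]"
      then have "i - s = int t + - (2 * s) \<or> i - s = int t \<or> i - s = - (2 * s) \<or> i - s = - s" by auto
      then show "\<not> int (2 * t) dvd i - s"
        using nds not_two_t_dvd_t t_dvd[of "i - s"] dvd_add_triv_left_iff[of "int t" "- (2 * s)"]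
        by (metis dvd_minus_iff)
    qed (use rel in \<open>simp add: algebra_simps\<close>)
    moreover have "e * \<Phi> (int t - s) a - e' = 0"
    proof (rule Phi_independent[where i\<^sub>0 = "int t - s" and L = "[(e * \<Phi> s a - e', s),
        ((e * \<Phi> (int t + s) a - e') * (h * \<Phi> s h), int t + s),
        ((e * \<Phi> (- s) a - e') * (h / \<Phi> (- s) h), - s), (d * a - d', 0)]"])
      fix y i assume "(y, i) \<in> set [(e * \<Phi> s a - e', s),
        ((e * \<Phi> (int t + s) a - e') * (h * \<Phi> s h), int t + s),
        ((e * \<Phi> (- s) a - e') * (h / \<Phi> (- s) h), - s), (d * a - d', 0)]"
      then have "i - (int t - s) = 2 * s - int t \<or> i - (int t - s) = 2 * s \<or> i - (int t - s) = - int t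
          \<or> i - (int t - s) = s - int t" by auto
      then show "\<not> int (2 * t) dvd i - (int t - s)"
        using nds not_two_t_dvd_t t_dvd[of "i - (int t - s)"] dvd_diff[of "int t" "2 * s" "int t"]
        by (metis dvd_add_triv_right_iff dvd_refl diff_add_cancel)
    qed (use rel in \<open>simp add: algebra_simps\<close>)
    ultimately have "e * \<Phi> s a = e * \<Phi> (int t - s) a" by simp
    then show ?thesis using e by (simp only: mult_cancel_left) simp
  qed
  then have "\<Phi> s = \<Phi> (int t - s)" by blast
  then have "int t dvd s - (int t - s)"
    using t_dvd Phi_eq_iff by blast
  then have "int t dvd 2 * s"
    by (simp add: algebra_simps) (metis dvd_add_triv_right_iff diff_add_cancel mult.commute)
  with nds show False by simp
qed

subsection \<open>Explicit equivalences\<close>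

lemma Psi_uminus: "\<Psi> (- h) s = \<Psi> h s"
  by (rule ext) (simp add: \<Psi>_def P\<^sub>\<psi>_def M\<^sub>\<psi>_def)

lemma Phi_t_add_H:
  assumes "h \<in> H"
  shows "\<Phi> (int t + i) h = - 1 / \<Phi> i h" "\<Phi> (int t - i) h = - 1 / \<Phi> (- i) h" "\<Phi> (i - int t) h = - 1 / \<Phi> i h"
    "\<Phi> (- int t - i) h = - 1 / \<Phi> (- i) h" "\<Phi> (i + int t) h = - 1 / \<Phi> i h"
proof -
  show *: "\<Phi> (int t + i) h = - 1 / \<Phi> i h" for i
    using Phi_Phi[of i "int t" h] Phi_t_H[OF assms] by (simp add: add.commute)
  then show "\<Phi> (i + int t) h = - 1 / \<Phi> i h"
    by (simp add: add.commute)
  show "\<Phi> (int t - i) h = - 1 / \<Phi> (- i) h"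
    using *[of "- i"] by simp
  have "\<Phi> (i - int t) h = \<Phi> (int t + i) h"
    by (rule Phi_cong) simp
  then show "\<Phi> (i - int t) h = - 1 / \<Phi> i h"
    using *[of i] by simp
  show "\<Phi> (- int t - i) h = - 1 / \<Phi> (- i) h"
    using *[of "- i"] Phi_cong[of "- int t - i" "int t - i" h] by (simp add: algebra_simps)
qed

text \<open>Matching the four coefficients amounts to
  \<open>\<Phi> t a = \<Phi> (2 * s) a = u * a\<close> with \<open>u = \<Phi> s m / m\<close>. Such
  an \<open>a\<close> exists because \<open>u\<close> satisfies the same equation as
  \<open>m\<close>; the two conditions agree since \<open>a\<close> is fixed by
  \<open>\<Phi> 4\<close> and \<open>t\<close> is congruent to \<open>2 * s\<close> modulo
  4.\<close>

lemma Psi_scale_same: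
  assumes h: "h \<in> H" and s: "coprime_exp s" and t4: "t mod 4 = 2"
    and m: "m * \<Phi> (2 * s) m = 1"
  shows "\<exists>a e. a \<noteq> 0 \<and> e \<noteq> 0 \<and> (\<forall>x. \<Psi> (m * h) s (a * x) = e * \<Psi> h s x)"
proof -
  have m0: "m \<noteq> 0" using m by auto
  have m2: "\<Phi> (2 * s) m = 1 / m" using m m0 by (simp add: field_simps)
  have m3: "\<Phi> (3 * s) m = 1 / \<Phi> s m"
    using Phi_Phi[of s "2 * s" m] unfolding m2 by simp
  define u where "u = \<Phi> s m / m"
  have u: "u * \<Phi> (2 * s) u = 1"
    using m0 by (simp add: u_def m2 m3)
  have "even t" using t4 by presburger
  then obtain a where a: "a \<noteq> 0" "\<Phi> (2 * s) a = u * a"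
    using ex_eigenvector[OF s _ u] by blast
  have "\<Phi> (4 * s) a = \<Phi> (2 * s) (\<Phi> (2 * s) a)" by simp
  also have "\<dots> = (u * \<Phi> (2 * s) u) * a"
    unfolding a(2) Phi_mult by (simp add: a(2))
  finally have "\<Phi> 4 a = a"
    using Phi_fixed_4s[OF s, of a] u by simp
  moreover have "4 dvd int t - 2 * s"
    using t4 odd_if_coprime_exp[OF s] by presburger
  ultimately have ta: "\<Phi> (int t) a = u * a"
    using Phi_fixed_cong a(2) by metis
  have 1: "\<Phi> (int t - s) a = \<Phi> s a"
    using arg_cong[OF ta[folded a(2)], of "\<Phi> (- s)"] by simp
  have 2: "\<Phi> (int t + s) a = \<Phi> s a / (m * \<Phi> s m)"
    using arg_cong[OF ta, of "\<Phi> s"] m0 by (simp add: u_def m2 add.commute)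
  have 3: "\<Phi> s a = m / \<Phi> (- s) m * \<Phi> (- s) a"
    using arg_cong[OF a(2), of "\<Phi> (- s)"] by (simp add: u_def)
  have "\<Psi> (m * h) s (a * x) = \<Phi> s a * \<Psi> h s x" for x
  proof -
    have P: "P\<^sub>\<psi> (m * h) s (a * x) = \<Phi> s a * P\<^sub>\<psi> h s x"
      using m0 by (simp add: P\<^sub>\<psi>_def 2) (simp add: field_simps)
    have "M\<^sub>\<psi> (m * h) s (a * x) =
        \<Phi> s a * \<Phi> (int t - s) x + (m / \<Phi> (- s) m * \<Phi> (- s) a) * (h / \<Phi> (- s) h * \<Phi> (- s) x)"
      by (simp add: M\<^sub>\<psi>_def 1)
    also have "\<dots> = \<Phi> s a * M\<^sub>\<psi> h s x"
      unfolding 3[symmetric] by (simp add: M\<^sub>\<psi>_def algebra_simps)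
    finally show ?thesis
      using P by (simp only: \<Psi>_def distrib_left)
  qed
  then show ?thesis using a(1) by (intro exI[of _ a] exI[of _ "\<Phi> s a"]) simp
qed

text \<open>The eigenvector for \<open>u = - 1\<close>, used to absorb signs. It is fixed by
  \<open>\<Phi> 4\<close>, so the residue of \<open>t\<close> modulo 4 determines its image under
  \<open>\<Phi> t\<close>.\<close>

lemma ex_antifixed:
  assumes s: "coprime_exp s" and ev: "even t"
  shows "\<exists>a. a \<noteq> 0 \<and> \<Phi> (2 * s) a = - a \<and> \<Phi> s a = - \<Phi> (- s) a
    \<and> \<Phi> (int t) a = (if t mod 4 = 2 then - a else a)"
proof -
  obtain a where a: "a \<noteq> 0" "\<Phi> (2 * s) a = - a"
    using ex_eigenvector[OF s ev, of "- 1"] by auto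
  have "\<Phi> (4 * s) a = \<Phi> (2 * s) (\<Phi> (2 * s) a)" by simp
  then have 4: "\<Phi> 4 a = a"
    using Phi_fixed_4s[OF s, of a] unfolding a(2) by (simp add: a(2))
  have "\<Phi> s a = - \<Phi> (- s) a"
    using arg_cong[OF a(2), of "\<Phi> (- s)"] by simp
  moreover have "\<Phi> (int t) a = (if t mod 4 = 2 then - a else a)"
  proof (cases "t mod 4 = 2")
    case True
    then have "4 dvd int t - 2 * s"
      using odd_if_coprime_exp[OF s] by presburger
    then show ?thesis
      using Phi_fixed_cong[OF 4] a(2) True by metis
  next
    case False
    with ev have "4 dvd int t - 0" by presburger
    then show ?thesis
      using Phi_fixed_cong[OF 4] Phi_0 False by metis
  qed
  ultimately show ?thesis using a by blast
qed

text \<open>Replacing \<open>s\<close> by \<open>t - s\<close> exchanges the two halves. Since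
  \<open>\<Phi> t h = - 1 / h\<close>, only the signs of the two coefficients involving
  \<open>h\<close> change, and the factor \<open>a\<close> compensates for them.\<close>

lemma Psi_scale_t_minus:
  assumes h: "h \<in> H" and s: "coprime_exp s" and t4: "t mod 4 = 2"
  shows "\<exists>a e. a \<noteq> 0 \<and> e \<noteq> 0 \<and> (\<forall>x. \<Psi> h (int t - s) (a * x) = e * \<Psi> h s x)"
proof -
  have "even t" using t4 by presburger
  then obtain a where a: "a \<noteq> 0" "\<Phi> (int t) a = - a" "\<Phi> s a = - \<Phi> (- s) a"
    using ex_antifixed[OF s] t4 by auto
  have ta: "\<Phi> (int t + i) a = - \<Phi> i a" for i
    using Phi_Phi[of i "int t" a] a(2) by (simp add: add.commute)
  have wrap: "\<Phi> (s - int t) x = \<Phi> (int t + s) x" for x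
    by (rule Phi_cong; simp)+
  have "\<Psi> h (int t - s) (a * x) = \<Phi> s a * \<Psi> h s x" for x
    using a(3) ta[of s] ta[of "- s"]
    by (simp add: \<Psi>_def P\<^sub>\<psi>_def M\<^sub>\<psi>_def wrap Phi_add_2t Phi_t_add_H[OF h]) (simp add: algebra_simps)
  then show ?thesis using a(1) by (intro exI[of _ a] exI[of _ "\<Phi> s a"]) simp
qed

text \<open>Replacing \<open>s\<close> by \<open>t + s\<close> swaps the two terms inside each
  half.\<close>

lemma Psi_scale_t_plus:
  assumes h: "h \<in> H" and s: "coprime_exp s" and t4: "t mod 4 = 0"
  shows "\<exists>a e. a \<noteq> 0 \<and> e \<noteq> 0 \<and> (\<forall>x. \<Psi> (1 / h) (int t + s) (a * x) = e * \<Psi> h s x)"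
proof -
  have h0: "h \<noteq> 0" using h H_nonzero by auto
  have "even t" using t4 by presburger
  then obtain a where a: "a \<noteq> 0" "\<Phi> (int t) a = a" "\<Phi> s a = - \<Phi> (- s) a"
    using ex_antifixed[OF s] t4 by auto
  have ta: "\<Phi> (int t + i) a = \<Phi> i a" for i
    using Phi_Phi[of i "int t" a] a(2) by (simp add: add.commute)
  have wrap: "\<Phi> (- int t - s) x = \<Phi> (int t - s) x" for x
    by (rule Phi_cong; simp)+
  \<comment> \<open>Dividing the argument by \<open>h\<close> moves the coefficients back to their
    places; the eigenvector \<open>a\<close> takes care of the signs.\<close>
  have "\<Psi> (1 / h) (int t + s) (a / h * x) = (\<Phi> (- s) a / h) * \<Psi> h s x" for x
    using a(3) ta[of s] ta[of "- s"] h0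
    by (simp add: \<Psi>_def P\<^sub>\<psi>_def M\<^sub>\<psi>_def wrap Phi_add_2t Phi_t_add_H[OF h])
      (simp add: field_simps)
  then show ?thesis
    using a(1) h0 by (intro exI[of _ "a / h"] exI[of _ "\<Phi> (- s) a / h"]) simp
qed

text \<open>The codes for \<open>\<sigma>\<close> and \<open>\<sigma>\<^sup>-\<^sup>1\<close> are related by inverting \<open>\<psi>\<close> up to scalars.\<close>

lemma Psi_inverse:
  assumes h: "h \<in> H" and s: "coprime_exp s"
  shows "\<exists>b c. b \<noteq> 0 \<and> c \<noteq> 0 \<and> (\<forall>x. \<Psi> (1 / h) (- s) (b * \<Psi> h s x) = c * x)"
proof -
  define h1 h2 k1 k2 where "h1 = \<Phi> s h" and "h2 = \<Phi> (2 * s) h" and "k1 = \<Phi> (- s) h" and "k2 = \<Phi> (- 2 * s) h"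
  note hs = h1_def[symmetric] h2_def[symmetric] k1_def[symmetric] k2_def[symmetric]
  have h0: "h \<noteq> 0" using h H_nonzero by auto
  have nz: "h1 \<noteq> 0" "h2 \<noteq> 0" "k1 \<noteq> 0" "k2 \<noteq> 0"
    using h0 by (simp_all add: h1_def h2_def k1_def k2_def)
  have z: "h * h2 \<noteq> 1" "k1 * h1 \<noteq> 1" "k2 * h \<noteq> 1"
    using H_not_inverse_pair[OF h s] H_not_inverse_pair[OF H_Phi[OF h, of "- s"] s]
      H_not_inverse_pair[OF H_Phi[OF h, of "- 2 * s"] s]
    by (simp_all add: h1_def h2_def k1_def k2_def)
  have z': "1 - h * h2 \<noteq> 0" "k1 * h1 - 1 \<noteq> 0" "1 - k2 * h \<noteq> 0" "h * h2 - 1 \<noteq> 0" "k2 * h - 1 \<noteq> 0"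
    using z by auto
  note TH = Phi_t_add_H[OF h]
  \<comment> \<open>\<open>b\<close> is chosen so that in the composition the coefficients at all
    exponents except 0 vanish. Its denominator and those of its conjugates are nonzero by
    \<open>H_not_inverse_pair\<close> applied to conjugates of \<open>h\<close>.\<close>
  define b where "b = k1 / ((k1 * h1 - 1) * h)"
  have b1: "\<Phi> s b = h / ((h * h2 - 1) * h1)" and b3: "\<Phi> (- s) b = k2 / ((k2 * h - 1) * k1)"
    by (simp_all add: b_def h1_def h2_def k1_def k2_def)
  have T: "\<Phi> (int t + s) h = - 1 / h1" "\<Phi> (int t - s) h = - 1 / k1" "\<Phi> (int t + 2 * s) h = - 1 / h2"
    "\<Phi> (int t - 2 * s) h = - 1 / k2" "\<Phi> (int t) h = - 1 / h"
    using TH(1)[of s] TH(2)[of s] TH(1)[of "2 * s"] TH(2)[of "2 * s"] TH(1)[of 0]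
    by (simp_all add: h1_def h2_def k1_def k2_def)
  have b2: "\<Phi> (int t + s) b = h1 * h2 / (1 - h * h2)" and b4: "\<Phi> (int t - s) b = k1 * h / (1 - k2 * h)"
  proof -
    have "\<Phi> (int t + s) b = (- 1 / h) / (((- 1 / h) * (- 1 / h2) - 1) * (- 1 / h1))"
      by (simp add: b_def h1_def h2_def k1_def k2_def TH Phi_t_H[OF h])
    also have "\<dots> = h1 * h2 / (1 - h * h2)"
      using h0 nz z' by (simp add: divide_simps)
    finally show "\<Phi> (int t + s) b = h1 * h2 / (1 - h * h2)" .
    have "\<Phi> (int t - s) b = (- 1 / k2) / (((- 1 / k2) * (- 1 / h) - 1) * (- 1 / k1))"
      by (simp add: b_def h1_def h2_def k1_def k2_def TH Phi_t_H[OF h])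
    also have "\<dots> = k1 * h / (1 - k2 * h)"
      using h0 nz z' by (simp add: divide_simps)
    finally show "\<Phi> (int t - s) b = k1 * h / (1 - k2 * h)" .
  qed
  have wrap: "\<Phi> (int t + (int t + i)) x = \<Phi> i x" "\<Phi> (int t + (int t - i)) x = \<Phi> (- i) x" for i x
    by (rule Phi_cong; simp)+
  define c where "c = - (k1 * h1 - 1) / (h * k1)"
  have "\<Psi> (1 / h) (- s) (b * \<Psi> h s x) = c * x" for x
  proof -
    have y1: "\<Phi> s (\<Psi> h s x) = \<Phi> (2 * s) x + \<Phi> (int t) x + h1 * h2 * \<Phi> (int t + 2 * s) x + h1 / h * x"
      by (simp add: \<Psi>_def P\<^sub>\<psi>_def M\<^sub>\<psi>_def h1_def h2_def algebra_simps)
    have y2: "\<Phi> (int t + s) (\<Psi> h s x) =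
        \<Phi> (int t + 2 * s) x + x + 1 / (h1 * h2) * \<Phi> (2 * s) x + h / h1 * \<Phi> (int t) x"
      using arg_cong[OF y1, of "\<Phi> (int t)"] wrap[of 0 x] nz h0
      by (simp add: wrap Phi_add_2t TH T h1_def h2_def mult.commute)
    have y3: "\<Phi> (- s) (\<Psi> h s x) = x + \<Phi> (int t - 2 * s) x + k1 * h * \<Phi> (int t) x + k1 / k2 * \<Phi> (- 2 * s) x"
      by (simp add: \<Psi>_def P\<^sub>\<psi>_def M\<^sub>\<psi>_def k1_def k2_def algebra_simps)
    have y4: "\<Phi> (int t - s) (\<Psi> h s x) =
        \<Phi> (int t) x + \<Phi> (- 2 * s) x + 1 / (k1 * h) * x + k2 / k1 * \<Phi> (int t - 2 * s) x"
      using arg_cong[OF y3, of "\<Phi> (int t)"] wrap[of 0 x] nz h0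
      by (simp add: wrap Phi_add_2t TH T k1_def k2_def mult.commute)
    have "\<Psi> (1 / h) (- s) (b * \<Psi> h s x) =
      \<Phi> (- s) b * \<Phi> (- s) (\<Psi> h s x) + 1 / (h * k1) * (\<Phi> (int t - s) b * \<Phi> (int t - s) (\<Psi> h s x))
      + \<Phi> (int t + s) b * \<Phi> (int t + s) (\<Psi> h s x) + h1 / h * (\<Phi> s b * \<Phi> s (\<Psi> h s x))"
      by (simp add: \<Psi>_def[of "1 / h"] P\<^sub>\<psi>_def[of "1 / h"] M\<^sub>\<psi>_def[of "1 / h"] hs)
    also have "\<dots> =
        (\<Phi> (int t + s) b / (h1 * h2) + h1 / h * \<Phi> s b) * \<Phi> (2 * s) x
      + (\<Phi> (int t + s) b + h1 / h * \<Phi> s b * (h1 * h2)) * \<Phi> (int t + 2 * s) x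
      + (\<Phi> (- s) b * (k1 / k2) + 1 / (h * k1) * \<Phi> (int t - s) b) * \<Phi> (- 2 * s) x
      + (\<Phi> (- s) b + 1 / (h * k1) * \<Phi> (int t - s) b * (k2 / k1)) * \<Phi> (int t - 2 * s) x
      + ((\<Phi> (- s) b * (k1 * h) + 1 / (h * k1) * \<Phi> (int t - s) b)
          + (\<Phi> (int t + s) b * (h / h1) + h1 / h * \<Phi> s b)) * \<Phi> (int t) x
      + ((\<Phi> (- s) b + 1 / (h * k1) * \<Phi> (int t - s) b / (k1 * h))
          + (\<Phi> (int t + s) b + h1 / h * \<Phi> s b * (h1 / h))) * x"
      unfolding y1 y2 y3 y4 by (simp add: algebra_simps)
    \<comment> \<open>The coefficients are evaluated in turn: four vanish, the two contributions to
      \<open>\<Phi> t\<close> are 1 and -1, and the last two add up to \<open>c\<close>.\<close>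
    also have "\<Phi> (int t + s) b / (h1 * h2) + h1 / h * \<Phi> s b = 0"
      unfolding b1 b2 using h0 nz z' by (simp add: divide_simps, (simp add: algebra_simps)?) 
    also have "\<Phi> (int t + s) b + h1 / h * \<Phi> s b * (h1 * h2) = 0"
      unfolding b1 b2 using h0 nz z' by (simp add: divide_simps, (simp add: algebra_simps)?)
    also have "\<Phi> (- s) b * (k1 / k2) + 1 / (h * k1) * \<Phi> (int t - s) b = 0"
      unfolding b3 b4 using h0 nz z' by (simp add: divide_simps, (simp add: algebra_simps)?)
    also have "\<Phi> (- s) b + 1 / (h * k1) * \<Phi> (int t - s) b * (k2 / k1) = 0"
      unfolding b3 b4 using h0 nz z' by (simp add: divide_simps, (simp add: algebra_simps)?)
    also have "\<Phi> (- s) b * (k1 * h) + 1 / (h * k1) * \<Phi> (int t - s) b = 1"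
      unfolding b3 b4 using h0 nz z' by (simp add: divide_simps, (simp add: algebra_simps)?)
    also have "\<Phi> (int t + s) b * (h / h1) + h1 / h * \<Phi> s b = - 1"
      unfolding b1 b2 using h0 nz z' by (simp add: divide_simps, (simp add: algebra_simps)?)
    also have "\<Phi> (- s) b + 1 / (h * k1) * \<Phi> (int t - s) b / (k1 * h) = 1 / (h * k1)"
      unfolding b3 b4 using h0 nz z' by (simp add: divide_simps, (simp add: algebra_simps)?)
    also have "\<Phi> (int t + s) b + h1 / h * \<Phi> s b * (h1 / h) = - h1 / h"
      unfolding b1 b2 using h0 nz z' by (simp add: divide_simps, (simp add: algebra_simps)?)
    finally show ?thesis
      using h0 nz by (simp add: c_def field_simps)
  qed
  moreover have "b \<noteq> 0" "c \<noteq> 0"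
    using h0 nz z' by (simp_all add: b_def c_def)
  ultimately show ?thesis by blast
qed

subsection \<open>The group of equivalences\<close>

text \<open>The ambient ring written with the generator \<open>\<Phi> 1\<close>, a normal form free
  of the reference generator.\<close>

definition Lin :: "('a \<Rightarrow> 'a) set" where
  "Lin = range (\<lambda>c x. \<Sum>i<2 * t. c i * \<Phi> (int i) x)"

lemma Lin_add: "f \<in> Lin \<Longrightarrow> g \<in> Lin \<Longrightarrow> (\<lambda>x. f x + g x) \<in> Lin"
proof -
  assume "f \<in> Lin" "g \<in> Lin"
  then obtain c d where "f = (\<lambda>x. \<Sum>i<2 * t. c i * \<Phi> (int i) x)" "g = (\<lambda>x. \<Sum>i<2 * t. d i * \<Phi> (int i) x)"
    unfolding Lin_def by blast
  then have "(\<lambda>x. f x + g x) = (\<lambda>x. \<Sum>i<2 * t. (c i + d i) * \<Phi> (int i) x)"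
    by (simp add: sum.distrib distrib_right)
  then show ?thesis unfolding Lin_def by (intro image_eqI) auto
qed

lemma Lin_scaled_Phi: "(\<lambda>x. y * \<Phi> i x) \<in> Lin"
proof -
  obtain m where m: "\<Phi> i = \<Phi> (int m)" "m < 2 * t"
    by (rule obtain_nat_exponent)
  have "(\<lambda>x. y * \<Phi> i x) = (\<lambda>x. \<Sum>k<2 * t. (if k = m then y else 0) * \<Phi> (int k) x)"
    using m by (simp add: if_distrib[of "\<lambda>z. z * _"] cong: if_cong)
  then show ?thesis unfolding Lin_def by (intro image_eqI) auto
qed

lemma Lin_zero: "(\<lambda>x. 0) \<in> Lin"
  using Lin_scaled_Phi[of 0] by simp

lemma Lin_id: "id \<in> Lin"
  using Lin_scaled_Phi[of 1 0] by (simp add: id_def)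

lemma Lin_scale: "(\<lambda>x. y * x) \<in> Lin"
  using Lin_scaled_Phi[of y 0] by simp

lemma Lin_sum: "(\<And>i. i \<in> A \<Longrightarrow> f i \<in> Lin) \<Longrightarrow> (\<lambda>x. \<Sum>i\<in>A. f i x) \<in> Lin"
proof (induction A rule: infinite_finite_induct)
  case (insert i A)
  then show ?case using Lin_add[of "f i"] by simp
qed (simp_all add: Lin_zero)

lemma Lin_comp: "f \<in> Lin \<Longrightarrow> g \<in> Lin \<Longrightarrow> f \<circ> g \<in> Lin"
proof -
  assume "f \<in> Lin" "g \<in> Lin"
  then obtain c d where "f = (\<lambda>x. \<Sum>i<2 * t. c i * \<Phi> (int i) x)" "g = (\<lambda>x. \<Sum>i<2 * t. d i * \<Phi> (int i) x)"
    unfolding Lin_def by blast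
  then have "f \<circ> g = (\<lambda>x. \<Sum>i<2 * t. \<Sum>j<2 * t. (c i * \<Phi> (int i) (d j)) * \<Phi> (int i + int j) x)"
    by (auto simp: Phi_sum sum_distrib_left algebra_simps)
  then show ?thesis by (simp only:) (intro Lin_sum Lin_scaled_Phi)
qed

lemma field_isom_Phi:
  assumes "field_isom \<rho>"
  shows "\<rho> (\<Phi> i x) = \<Phi> i (\<rho> x)"
proof -
  interpret field_isom \<rho> by fact
  show ?thesis by (simp add: \<Phi>_def hom_power)
qed

lemma Lin_conj:
  assumes \<rho>: "field_isom \<rho>" and "f \<in> Lin"
  shows "\<rho> \<circ> f \<circ> inv_into UNIV \<rho> \<in> Lin"
proof -
  interpret \<rho>: field_isom \<rho> by fact
  obtain c where f: "f = (\<lambda>x. \<Sum>i<2 * t. c i * \<Phi> (int i) x)"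
    using assms(2) unfolding Lin_def by blast
  have "\<rho> (f (inv_into UNIV \<rho> x)) = (\<Sum>i<2 * t. \<rho> (c i) * \<Phi> (int i) x)" for x
    using surj_f_inv_f[OF \<rho>.surj]
    by (simp add: f \<rho>.hom_sum \<rho>.hom_mult field_isom_Phi[OF \<rho>])
  then have "\<rho> \<circ> f \<circ> inv_into UNIV \<rho> = (\<lambda>x. \<Sum>i<2 * t. \<rho> (c i) * \<Phi> (int i) x)" by auto
  then show ?thesis unfolding Lin_def by (intro image_eqI) auto
qed

lemma Phi_funpow: "(\<Phi> s ^^ i) x = \<Phi> (s * int i) x"
  by (induction i) (simp_all add: algebra_simps)

lemma card_char: "CARD('a) = CHAR('a) ^ (r * (2 * t))"
  by (simp add: card q_char_power power_mult)

lemma gal_eq: "gal q = range \<Phi>"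
proof (intro equalityI subsetI)
  fix \<sigma> :: "'a \<Rightarrow> 'a" assume "\<sigma> \<in> gal q"
  then have "\<exists>i<2 * t. \<sigma> = (\<lambda>x. x ^ (q ^ i))"
    by (intro automorphism_eq_power[OF _ q_char_power card]) (auto simp: gal_def base_field_def)
  then obtain i where "\<sigma> = (\<lambda>x. x ^ (q ^ i))" by blast
  then have "\<sigma> = \<Phi> (int i)"
    by (auto simp: Phi_of_nat)
  then show "\<sigma> \<in> range \<Phi>" by blast
next
  fix \<sigma> :: "'a \<Rightarrow> 'a" assume "\<sigma> \<in> range \<Phi>"
  then obtain i where i: "\<sigma> = \<Phi> i" by blast
  have "\<Phi> i x = x" if "x ^ q = x" for x
    using Phi_fixed_multiple[of 1 x i] Phi_of_nat[of 1 x] that by simp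
  then show "\<sigma> \<in> gal q"
    by (auto simp: i gal_def base_field_def Phi_isom)
qed

lemma gal_generator_iff: "gal_generator q \<sigma> \<longleftrightarrow> (\<exists>s. coprime_exp s \<and> \<sigma> = \<Phi> s)"
proof
  assume gen: "gal_generator q \<sigma>"
  then obtain s where s: "\<sigma> = \<Phi> s"
    unfolding gal_generator_def gal_eq by blast
  have "\<Phi> 1 \<in> {\<sigma> ^^ i | i::nat. True}"
    using gen unfolding gal_generator_def gal_eq by blast
  then obtain i :: nat where "\<Phi> 1 = \<Phi> (s * int i)"
    unfolding s by (auto simp: Phi_funpow fun_eq_iff)
  then have "int (2 * t) dvd 1 - s * int i"
    by (simp only: Phi_eq_iff)
  then have "coprime_exp s"
  proof (intro coprimeI)
    fix c assume c: "c dvd s" "c dvd int (2 * t)"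
    then have "c dvd (1 - s * int i) + s * int i"
      using \<open>int (2 * t) dvd 1 - s * int i\<close> by (intro dvd_add) (auto intro: dvd_trans)
    then show "is_unit c" by simp
  qed
  with s show "\<exists>s. coprime_exp s \<and> \<sigma> = \<Phi> s" by blast
next
  assume "\<exists>s. coprime_exp s \<and> \<sigma> = \<Phi> s"
  then obtain s where s: "coprime_exp s" "\<sigma> = \<Phi> s" by blast
  have "\<Phi> i \<in> {\<sigma> ^^ k | k::nat. True}" for i
  proof -
    obtain v w where "v * s + w * int (2 * t) = 1"
      using s(1) bezout_int[of s "int (2 * t)"] by auto
    then have vw: "s * v + w * int (2 * t) = 1"
      by (simp only: mult.commute)
    define k where "k = nat ((v * i) mod int (2 * t))"
    have k: "int k = (v * i) mod int (2 * t)"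
      using two_t_pos by (simp add: k_def)
    have "int (2 * t) dvd v * i - int k"
      unfolding k by (simp add: minus_mod_eq_mult_div)
    then have "int (2 * t) dvd s * (v * i - int k) + w * int (2 * t) * i"
      by (intro dvd_add) simp_all
    also have "s * (v * i - int k) + w * int (2 * t) * i = (s * v + w * int (2 * t)) * i - s * int k"
      by (simp add: algebra_simps)
    also have "\<dots> = i - s * int k"
      by (simp only: vw mult_1)
    finally have "\<Phi> i x = (\<sigma> ^^ k) x" for x
      using Phi_cong[of i "s * int k" x] by (simp add: s(2) Phi_funpow)
    then have "\<Phi> i = \<sigma> ^^ k" by blast
    then show ?thesis by blast
  qed
  moreover have "\<sigma> ^^ k \<in> range \<Phi>" for k
    using Phi_funpow[where s = s and i = k] by (auto simp: s(2) fun_eq_iff)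
  ultimately show "gal_generator q \<sigma>"
    unfolding gal_generator_def gal_eq using s(2) by auto
qed

text \<open>Multiplication by the unit \<open>s\<close> permutes the residues modulo
  \<open>2 * t\<close>, so changing the generator only permutes the coefficients.\<close>

lemma sigma_polys_eq:
  assumes "gal_generator q \<tau>"
  shows "sigma_polys (2 * t) \<tau> = Lin"
proof -
  obtain s where s: "coprime_exp s" "\<tau> = \<Phi> s"
    using assms gal_generator_iff by blast
  define \<pi> where "\<pi> i = nat ((s * int i) mod int (2 * t))" for i :: nat
  have \<pi>: "int (\<pi> i) = (s * int i) mod int (2 * t)" for i
    using two_t_pos by (simp add: \<pi>_def)
  have \<pi>_less: "\<pi> i < 2 * t" for i
    using \<pi>[of i] two_t_pos by (metis of_nat_less_iff pos_mod_bound)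
  have \<Phi>\<pi>: "\<Phi> (int (\<pi> i)) = \<Phi> (s * int i)" for i
    by (rule Phi_cong_mod) (simp only: \<pi> mod_mod_trivial)
  have "inj_on \<pi> {..<2 * t}"
  proof
    fix i j assume ij: "i \<in> {..<2 * t}" "j \<in> {..<2 * t}" "\<pi> i = \<pi> j"
    then have "(s * int i) mod int (2 * t) = (s * int j) mod int (2 * t)"
      by (metis \<pi>)
    then have "int (2 * t) dvd s * (int i - int j)"
      by (simp add: mod_eq_dvd_iff right_diff_distrib)
    then have "int (2 * t) dvd int i - int j"
      using s(1) by (metis coprime_commute coprime_dvd_mult_right_iff)
    then have "int i mod int (2 * t) = int j mod int (2 * t)"
      by (simp only: mod_eq_dvd_iff)
    with ij show "i = j"
      by (metis lessThan_iff mod_less of_nat_eq_iff of_nat_mod)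
  qed
  moreover have "\<pi> ` {..<2 * t} \<subseteq> {..<2 * t}"
    using \<pi>_less by auto
  ultimately have bij: "bij_betw \<pi> {..<2 * t} {..<2 * t}"
    by (simp add: bij_betw_def endo_inj_surj)
  have poly: "sigma_poly (2 * t) \<tau> c x = (\<Sum>i<2 * t. c i * \<Phi> (int (\<pi> i)) x)" for c x
    by (simp add: sigma_poly_def s(2) Phi_funpow \<Phi>\<pi>)
  show ?thesis
  proof (intro equalityI subsetI)
    fix f assume "f \<in> sigma_polys (2 * t) \<tau>"
    then obtain c where "f = sigma_poly (2 * t) \<tau> c"
      unfolding sigma_polys_def by blast
    then have "f = (\<lambda>x. \<Sum>i<2 * t. c i * \<Phi> (int (\<pi> i)) x)"
      by (auto simp: poly)
    then show "f \<in> Lin" by (simp only:) (intro Lin_sum Lin_scaled_Phi)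
  next
    fix f assume "f \<in> Lin"
    then obtain c where f: "f = (\<lambda>x. \<Sum>i<2 * t. c i * \<Phi> (int i) x)"
      unfolding Lin_def by blast
    have "f = sigma_poly (2 * t) \<tau> (c \<circ> \<pi>)"
      using sum.reindex_bij_betw[OF bij, of "\<lambda>i. c i * \<Phi> (int i) _"] by (auto simp: f poly)
    then show "f \<in> sigma_polys (2 * t) \<tau>" unfolding sigma_polys_def by blast
  qed
qed

definition Lin_units :: "('a \<Rightarrow> 'a) set" where
  "Lin_units = {f \<in> Lin. \<exists>g\<in>Lin. f \<circ> g = id \<and> g \<circ> f = id}"

definition equivalent :: "('a \<Rightarrow> 'a) set \<Rightarrow> ('a \<Rightarrow> 'a) set \<Rightarrow> bool" where
  "equivalent C1 C2 \<longleftrightarrow> (\<exists>f1\<in>Lin_units. \<exists>f2\<in>Lin_units. \<exists>\<rho>. field_isom \<rho> \<and>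
     C1 = (\<lambda>g. f1 \<circ> (\<rho> \<circ> g \<circ> inv_into UNIV \<rho>) \<circ> f2) ` C2)"

text \<open>Automorphisms of a finite field commute with the Galois group, so applying
  \<open>\<rho>\<close> to the coefficients is conjugation by \<open>\<rho>\<close>. The reference
  generator thereby disappears from the relation.\<close>

lemma code_equiv_iff:
  assumes \<tau>: "gal_generator q \<tau>"
  shows "code_equiv (2 * t) \<tau> C1 C2 \<longleftrightarrow> C1 \<subseteq> Lin \<and> C2 \<subseteq> Lin \<and> equivalent C1 C2"
proof -
  obtain s where s: "\<tau> = \<Phi> s"
    using \<tau> gal_generator_iff by blast
  have inv: "invertible_sigma_poly (2 * t) \<tau> f \<longleftrightarrow> f \<in> Lin_units" for f
    unfolding invertible_sigma_poly_def Lin_units_def sigma_polys_eq[OF \<tau>] by simp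
  have conj: "sigma_poly (2 * t) \<tau> (\<rho> \<circ> c) = \<rho> \<circ> sigma_poly (2 * t) \<tau> c \<circ> inv_into UNIV \<rho>"
    if "field_isom \<rho>" for \<rho> c
  proof -
    interpret \<rho>: field_isom \<rho> by fact
    show ?thesis
      using surj_f_inv_f[OF \<rho>.surj]
      by (auto simp: sigma_poly_def s Phi_funpow \<rho>.hom_sum \<rho>.hom_mult field_isom_Phi[OF that])
  qed
  have img: "{f1 \<circ> sigma_poly (2 * t) \<tau> (\<rho> \<circ> c) \<circ> f2 | c. sigma_poly (2 * t) \<tau> c \<in> C2}
      = (\<lambda>g. f1 \<circ> (\<rho> \<circ> g \<circ> inv_into UNIV \<rho>) \<circ> f2) ` C2"
    if "C2 \<subseteq> Lin" "field_isom \<rho>" for f1 f2 \<rho>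
  proof -
    have "C2 \<subseteq> range (sigma_poly (2 * t) \<tau>)"
      using that(1) sigma_polys_eq[OF \<tau>] unfolding sigma_polys_def by simp
    then show ?thesis
      using conj[OF that(2)] by auto
  qed
  show ?thesis
    unfolding code_equiv_def equivalent_def sigma_polys_eq[OF \<tau>] inv
    by (intro conj_cong refl) (simp add: img Bex_def cong: conj_cong)
qed

section \<open>Equivalence of codes as an equivalence relation\<close>

lemma Lin_units_comp: "f \<in> Lin_units \<Longrightarrow> g \<in> Lin_units \<Longrightarrow> f \<circ> g \<in> Lin_units"
proof -
  assume "f \<in> Lin_units" "g \<in> Lin_units"
  then obtain f' g' where fg: "f \<in> Lin" "g \<in> Lin" "f' \<in> Lin" "g' \<in> Lin"
    "f \<circ> f' = id" "f' \<circ> f = id" "g \<circ> g' = id" "g' \<circ> g = id"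
    unfolding Lin_units_def by blast
  have "(f \<circ> g) \<circ> (g' \<circ> f') = id" "(g' \<circ> f') \<circ> (f \<circ> g) = id"
    using fg(5-8) by (auto simp: fun_eq_iff)
  then show ?thesis
    unfolding Lin_units_def using Lin_comp fg(1-4) by blast
qed

lemma Lin_units_id: "id \<in> Lin_units"
  unfolding Lin_units_def using Lin_id by force

lemma Lin_units_bij: "f \<in> Lin_units \<Longrightarrow> bij f"
  unfolding Lin_units_def using o_bij by blast

lemma Lin_units_inv:
  assumes "f \<in> Lin_units"
  shows "inv_into UNIV f \<in> Lin_units"
proof -
  obtain g where g: "f \<in> Lin" "g \<in> Lin" "f \<circ> g = id" "g \<circ> f = id"
    using assms unfolding Lin_units_def by blast
  then have "inv_into UNIV f = g"
    by (intro inv_unique_comp)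
  with g show ?thesis unfolding Lin_units_def by blast
qed

lemma Lin_units_conj:
  assumes \<rho>: "field_isom \<rho>" and "f \<in> Lin_units"
  shows "\<rho> \<circ> f \<circ> inv_into UNIV \<rho> \<in> Lin_units"
proof -
  interpret \<rho>: field_isom \<rho> by fact
  obtain g where g: "f \<in> Lin" "g \<in> Lin" "f \<circ> g = id" "g \<circ> f = id"
    using assms(2) unfolding Lin_units_def by blast
  have "(\<rho> \<circ> f \<circ> inv_into UNIV \<rho>) \<circ> (\<rho> \<circ> g \<circ> inv_into UNIV \<rho>) = id"
    "(\<rho> \<circ> g \<circ> inv_into UNIV \<rho>) \<circ> (\<rho> \<circ> f \<circ> inv_into UNIV \<rho>) = id"
    using g(3,4) surj_f_inv_f[OF \<rho>.surj] inv_f_f[OF \<rho>.inj_f] by (simp_all add: fun_eq_iff)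
  then show ?thesis
    unfolding Lin_units_def using Lin_conj[OF \<rho>] g(1,2) by blast
qed

lemma Lin_units_scale: "a \<noteq> 0 \<Longrightarrow> (\<lambda>x. a * x) \<in> Lin_units"
  unfolding Lin_units_def using Lin_scale[of a] Lin_scale[of "1 / a"]
  by (auto simp: fun_eq_iff intro!: bexI[of _ "\<lambda>x. 1 / a * x"])

lemma field_isom_id: "field_isom (id :: 'a \<Rightarrow> 'a)"
  by unfold_locales auto

lemma field_isom_comp: "field_isom f \<Longrightarrow> field_isom g \<Longrightarrow> field_isom (f \<circ> (g :: 'a \<Rightarrow> 'a) :: 'a \<Rightarrow> 'a)"
proof -
  assume "field_isom f" "field_isom g"
  then interpret f: field_isom f + g: field_isom g .
  have "surj (f \<circ> g)"
    using g.surj f.surj by (rule comp_surj)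
  then show ?thesis
    by unfold_locales (simp_all add: f.hom_add f.hom_mult g.hom_add g.hom_mult)
qed

lemma field_isom_inv:
  assumes "field_isom (f :: 'a \<Rightarrow> 'a)"
  shows "field_isom (inv_into UNIV f)"
proof -
  interpret f: field_isom f by fact
  show ?thesis
    by unfold_locales (use f.inj_f inj_imp_surj_inv in blast)
qed

lemma equivalent_refl: "equivalent C C"
  unfolding equivalent_def
  by (intro bexI[OF _ Lin_units_id] exI[of _ id]) (simp add: field_isom_id)

lemma equivalent_sym:
  assumes "equivalent C1 C2"
  shows "equivalent C2 C1"
proof -
  obtain f1 f2 \<rho> where f: "f1 \<in> Lin_units" "f2 \<in> Lin_units" and \<rho>: "field_isom \<rho>"
    and C1: "C1 = (\<lambda>g. f1 \<circ> (\<rho> \<circ> g \<circ> inv_into UNIV \<rho>) \<circ> f2) ` C2"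
    using assms unfolding equivalent_def by blast
  interpret \<rho>: field_isom \<rho> by fact
  let ?i = "inv_into UNIV"
  have inv: "f1 (?i f1 x) = x" "?i f1 (f1 x) = x" "f2 (?i f2 x) = x" "?i f2 (f2 x) = x"
    "\<rho> (?i \<rho> x) = x" "?i \<rho> (\<rho> x) = x" for x
    using Lin_units_bij[OF f(1)] Lin_units_bij[OF f(2)] \<rho>.surj \<rho>.inj_f
    by (simp_all add: bij_is_inj bij_is_surj surj_f_inv_f)
  have ii: "?i (?i \<rho>) = \<rho>"
    using \<rho>.surj \<rho>.inj_f by (simp add: inv_inv_eq bij_def)
  define g1 g2 where "g1 = ?i \<rho> \<circ> ?i f1 \<circ> ?i (?i \<rho>)" and "g2 = ?i \<rho> \<circ> ?i f2 \<circ> ?i (?i \<rho>)"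
  have "g1 \<circ> (?i \<rho> \<circ> (f1 \<circ> (\<rho> \<circ> g \<circ> ?i \<rho>) \<circ> f2) \<circ> ?i (?i \<rho>)) \<circ> g2 = g" for g
    unfolding g1_def g2_def ii by (auto simp: fun_eq_iff inv)
  then have "C2 = (\<lambda>g. g1 \<circ> (?i \<rho> \<circ> g \<circ> ?i (?i \<rho>)) \<circ> g2) ` C1"
    unfolding C1 image_image by simp
  moreover have "g1 \<in> Lin_units" "g2 \<in> Lin_units"
    unfolding g1_def g2_def using Lin_units_conj field_isom_inv \<rho> Lin_units_inv f by blast+
  ultimately show ?thesis
    unfolding equivalent_def using field_isom_inv[OF \<rho>] by blast
qed

lemma equivalent_trans:
  assumes "equivalent C1 C2" "equivalent C2 C3"
  shows "equivalent C1 C3"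
proof -
  let ?i = "inv_into UNIV"
  obtain f1 f2 \<rho> where f: "f1 \<in> Lin_units" "f2 \<in> Lin_units" and \<rho>: "field_isom \<rho>"
    and C1: "C1 = (\<lambda>g. f1 \<circ> (\<rho> \<circ> g \<circ> ?i \<rho>) \<circ> f2) ` C2"
    using assms(1) unfolding equivalent_def by blast
  obtain g1 g2 \<rho>' where g: "g1 \<in> Lin_units" "g2 \<in> Lin_units" and \<rho>': "field_isom \<rho>'"
    and C2: "C2 = (\<lambda>g. g1 \<circ> (\<rho>' \<circ> g \<circ> ?i \<rho>') \<circ> g2) ` C3"
    using assms(2) unfolding equivalent_def by blast
  interpret \<rho>: field_isom \<rho> by fact
  interpret \<rho>': field_isom \<rho>' by fact
  have inv: "\<rho> (?i \<rho> x) = x" "?i \<rho> (\<rho> x) = x" for x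
    using \<rho>.surj \<rho>.inj_f by (simp_all add: surj_f_inv_f)
  have ii: "?i (\<rho> \<circ> \<rho>') = ?i \<rho>' \<circ> ?i \<rho>"
    using \<rho>.surj \<rho>.inj_f \<rho>'.surj \<rho>'.inj_f by (simp add: o_inv_distrib bij_def)
  define e1 e2 where "e1 = f1 \<circ> (\<rho> \<circ> g1 \<circ> ?i \<rho>)" and "e2 = (\<rho> \<circ> g2 \<circ> ?i \<rho>) \<circ> f2"
  have "f1 \<circ> (\<rho> \<circ> (g1 \<circ> (\<rho>' \<circ> g \<circ> ?i \<rho>') \<circ> g2) \<circ> ?i \<rho>) \<circ> f2
      = e1 \<circ> ((\<rho> \<circ> \<rho>') \<circ> g \<circ> ?i (\<rho> \<circ> \<rho>')) \<circ> e2" for g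
    unfolding e1_def e2_def ii by (auto simp: fun_eq_iff inv)
  then have "C1 = (\<lambda>g. e1 \<circ> ((\<rho> \<circ> \<rho>') \<circ> g \<circ> ?i (\<rho> \<circ> \<rho>')) \<circ> e2) ` C3"
    unfolding C1 C2 image_image by simp
  moreover have "e1 \<in> Lin_units" "e2 \<in> Lin_units"
    unfolding e1_def e2_def using Lin_units_conj \<rho> f g Lin_units_comp by blast+
  ultimately show ?thesis
    unfolding equivalent_def using field_isom_comp[OF \<rho> \<rho>'] by blast
qed

section \<open>The codes in terms of exponents\<close>

definition Cd :: "'a \<Rightarrow> int \<Rightarrow> ('a \<Rightarrow> 'a) set" where
  "Cd h s = {\<lambda>x. a * x + b * \<Psi> h s x | a b. True}"

lemma CdI: "(\<lambda>x. a * x + b * \<Psi> h s x) \<in> Cd h s"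
  unfolding Cd_def by blast

lemma CdE:
  assumes "f \<in> Cd h s"
  obtains a b where "\<And>x. f x = a * x + b * \<Psi> h s x"
  using assms unfolding Cd_def by auto

lemma Psi_cong: "int (2 * t) dvd s' - s \<Longrightarrow> \<Psi> h s' = \<Psi> h s"
proof -
  assume d: "int (2 * t) dvd s' - s"
  then have "int (2 * t) dvd - (s' - s)" by (simp only: dvd_minus_iff)
  then have "\<Phi> s' = \<Phi> s" "\<Phi> (int t + s') = \<Phi> (int t + s)" "\<Phi> (int t - s') = \<Phi> (int t - s)" "\<Phi> (- s') = \<Phi> (- s)"
    unfolding Phi_eq_iff using d by simp_all
  then show ?thesis
    by (simp add: \<Psi>_def[abs_def] P\<^sub>\<psi>_def M\<^sub>\<psi>_def)
qed

lemma Cd_cong: "int (2 * t) dvd s' - s \<Longrightarrow> Cd h s' = Cd h s"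
  using Psi_cong[of s' s h] by (simp add: Cd_def)

text \<open>Because \<open>s\<close> is odd, \<open>t * (s - 1)\<close> is a multiple of
  \<open>2 * t\<close>; hence \<open>s * (t - 1)\<close> and \<open>s * (t + 1)\<close> reduce to
  \<open>t - s\<close> and \<open>t + s\<close>.\<close>

lemma psi_eq:
  assumes s: "coprime_exp s"
  shows "psi h t (\<Phi> s) = \<Psi> h s"
proof -
  have inv: "inv_into UNIV (\<Phi> s) y = \<Phi> (- s) y" for y
    by (rule inv_f_eq) (auto intro: injI simp: Phi_inj)
  obtain m where m: "s - 1 = 2 * m"
    using odd_if_coprime_exp[OF s] by (metis odd_two_times_div_two_succ add_diff_cancel_right')
  have t1: "int (t - 1) = int t - 1" "int (t + 1) = int t + 1" "int (2 * t - 1) = 2 * int t - 1"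
    using t by auto
  have "s * int (t - 1) - (int t - s) = int (2 * t) * m"
  proof -
    have "s * int (t - 1) - (int t - s) = int t * (s - 1)"
      unfolding t1 by (simp add: algebra_simps)
    then show ?thesis unfolding m by simp
  qed
  then have e1: "\<Phi> (s * int (t - 1)) x = \<Phi> (int t - s) x" for x
    by (intro Phi_cong) simp
  have "s * int (t + 1) - (int t + s) = int (2 * t) * m"
  proof -
    have "s * int (t + 1) - (int t + s) = int t * (s - 1)"
      unfolding t1 by (simp add: algebra_simps)
    then show ?thesis unfolding m by simp
  qed
  then have e2: "\<Phi> (s * int (t + 1)) x = \<Phi> (int t + s) x" for x
    by (intro Phi_cong) simp
  have "s * int (2 * t - 1) - (- s) = int (2 * t) * s"
    unfolding t1 by (simp add: algebra_simps)
  then have e3: "\<Phi> (s * int (2 * t - 1)) x = \<Phi> (- s) x" for x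
    by (intro Phi_cong) simp
  show ?thesis
    by (rule ext, unfold psi_def Phi_funpow e1 e2 e3 inv)
      (simp add: \<Psi>_def P\<^sub>\<psi>_def M\<^sub>\<psi>_def inverse_eq_divide)
qed

lemma codes_eq: "codes q t = {Cd h s | h s. h \<in> H \<and> coprime_exp s}"
proof -
  have code: "code h t (\<Phi> s) = Cd h s" if "coprime_exp s" for h s
    using psi_eq[OF that] by (simp add: code_def Cd_def)
  have "field_norm q t h = - 1 \<longleftrightarrow> h \<in> H" for h :: 'a
    by (simp add: field_norm_def H_def)
  then have "codes q t = {code h t \<sigma> | h \<sigma>. (\<exists>s. coprime_exp s \<and> \<sigma> = \<Phi> s) \<and> h \<in> H}"
    unfolding codes_def gal_generator_iff by simp
  also have "\<dots> = {code h t (\<Phi> s) | h s. h \<in> H \<and> coprime_exp s}"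
    by blast
  also have "\<dots> = {Cd h s | h s. h \<in> H \<and> coprime_exp s}"
    using code by metis
  finally show ?thesis .
qed

lemma Psi_Lin: "\<Psi> h s \<in> Lin"
  unfolding \<Psi>_def[abs_def] P\<^sub>\<psi>_def M\<^sub>\<psi>_def
  using Lin_scaled_Phi[of 1] by (intro Lin_add Lin_scaled_Phi) simp_all

lemma Lin_scale_left: "f \<in> Lin \<Longrightarrow> (\<lambda>x. y * f x) \<in> Lin"
  using Lin_comp[OF Lin_scale] by (simp add: o_def)

lemma Cd_subset_Lin: "Cd h s \<subseteq> Lin"
  unfolding Cd_def using Lin_add[OF Lin_scale Lin_scale_left[OF Psi_Lin]] by blast

lemma Lin_additive: "f \<in> Lin \<Longrightarrow> f (x + y) = f x + f y"
  unfolding Lin_def by (auto simp: sum.distrib distrib_left)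

lemma field_isom_Psi:
  assumes \<rho>: "field_isom \<rho>"
  shows "\<rho> (\<Psi> h s x) = \<Psi> (\<rho> h) s (\<rho> x)"
proof -
  interpret field_isom \<rho> by fact
  show ?thesis
    by (simp add: \<Psi>_def P\<^sub>\<psi>_def M\<^sub>\<psi>_def hom_add hom_mult hom_div field_isom_Phi[OF \<rho>])
qed

lemma field_isom_H:
  assumes \<rho>: "field_isom \<rho>" and "h \<in> H"
  shows "\<rho> h \<in> H"
proof -
  interpret field_isom \<rho> by fact
  show ?thesis
    using arg_cong[of _ _ \<rho>, OF assms(2)[unfolded H_iff]]
    by (simp add: H_iff hom_mult hom_uminus field_isom_Phi[OF \<rho>])
qed

lemma equivalent_conj:
  assumes \<rho>: "field_isom \<rho>"
  shows "equivalent (Cd (\<rho> h) s) (Cd h s)"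
proof -
  interpret \<rho>: field_isom \<rho> by fact
  have inv: "\<rho> (inv_into UNIV \<rho> x) = x" for x
    using surj_f_inv_f[OF \<rho>.surj] .
  have conj: "\<rho> \<circ> (\<lambda>x. a * x + b * \<Psi> h s x) \<circ> inv_into UNIV \<rho> = (\<lambda>x. \<rho> a * x + \<rho> b * \<Psi> (\<rho> h) s x)" for a b
    by (auto simp: \<rho>.hom_add \<rho>.hom_mult field_isom_Psi[OF \<rho>] inv)
  have "Cd (\<rho> h) s = (\<lambda>g. \<rho> \<circ> g \<circ> inv_into UNIV \<rho>) ` Cd h s"
  proof (intro equalityI subsetI)
    fix f assume "f \<in> Cd (\<rho> h) s"
    then obtain a b where "f = (\<lambda>x. a * x + b * \<Psi> (\<rho> h) s x)"
      unfolding Cd_def by blast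
    then have "f = \<rho> \<circ> (\<lambda>x. inv_into UNIV \<rho> a * x + inv_into UNIV \<rho> b * \<Psi> h s x) \<circ> inv_into UNIV \<rho>"
      unfolding conj inv .
    then show "f \<in> (\<lambda>g. \<rho> \<circ> g \<circ> inv_into UNIV \<rho>) ` Cd h s"
      using CdI by blast
  next
    fix f assume "f \<in> (\<lambda>g. \<rho> \<circ> g \<circ> inv_into UNIV \<rho>) ` Cd h s"
    then obtain a b where "f = \<rho> \<circ> (\<lambda>x. a * x + b * \<Psi> h s x) \<circ> inv_into UNIV \<rho>"
      unfolding Cd_def by blast
    then show "f \<in> Cd (\<rho> h) s"
      unfolding conj using CdI by blast
  qed
  then show ?thesis
    unfolding equivalent_def using Lin_units_id \<rho> by (intro bexI[of _ id] exI[of _ \<rho>]) simp_all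
qed

lemma equivalent_comp_right:
  assumes "f \<in> Lin_units" and "C1 = (\<lambda>g. g \<circ> f) ` C2"
  shows "equivalent C1 C2"
  unfolding equivalent_def
  using assms Lin_units_id field_isom_id
  by (intro bexI[of _ id] bexI[of _ f] exI[of _ id]) simp_all

lemma equivalent_scale:
  assumes a: "a \<noteq> 0" and e: "e \<noteq> 0" and eq: "\<And>x. \<Psi> k s' (a * x) = e * \<Psi> h s x"
  shows "equivalent (Cd h s) (Cd k s')"
proof (rule equivalent_comp_right[OF Lin_units_scale[OF a]])
  have comp: "(\<lambda>x. u * x + v * \<Psi> k s' x) \<circ> (\<lambda>x. a * x) = (\<lambda>x. (u * a) * x + (v * e) * \<Psi> h s x)" for u v
    by (rule ext) (simp only: o_apply eq, simp add: algebra_simps)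
  show "Cd h s = (\<lambda>g. g \<circ> (\<lambda>x. a * x)) ` Cd k s'"
  proof (intro equalityI subsetI)
    fix f assume "f \<in> Cd h s"
    then obtain u v where "f = (\<lambda>x. u * x + v * \<Psi> h s x)"
      unfolding Cd_def by blast
    then have "f = (\<lambda>x. u / a * x + v / e * \<Psi> k s' x) \<circ> (\<lambda>x. a * x)"
      unfolding comp using a e by simp
    then show "f \<in> (\<lambda>g. g \<circ> (\<lambda>x. a * x)) ` Cd k s'"
      using CdI by blast
  next
    fix f assume "f \<in> (\<lambda>g. g \<circ> (\<lambda>x. a * x)) ` Cd k s'"
    then obtain u v where "f = (\<lambda>x. u * x + v * \<Psi> k s' x) \<circ> (\<lambda>x. a * x)"
      unfolding Cd_def by blast
    then show "f \<in> Cd h s"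
      unfolding comp using CdI by blast
  qed
qed

text \<open>Composition with \<open>b * \<Psi> h s\<close> exchanges the two generators of the codes
  up to scalars. The hypothesis gives a left inverse, which is two-sided because the field is
  finite.\<close>

lemma equivalent_inverse:
  assumes b: "b \<noteq> 0" and c: "c \<noteq> 0" and eq: "\<And>x. \<Psi> k s' (b * \<Psi> h s x) = c * x"
  shows "equivalent (Cd h s) (Cd k s')"
proof (rule equivalent_comp_right)
  define f g where "f = (\<lambda>x. b * \<Psi> h s x)" and "g = (\<lambda>x. 1 / c * \<Psi> k s' x)"
  have gf: "g \<circ> f = id"
    using eq c by (auto simp: f_def g_def)
  then have "inj f"
    by (metis inj_on_id inj_on_imageI2)
  then have "surj f"
    by (simp add: finite_UNIV_inj_surj)
  then have "f \<circ> g = id"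
    using gf by (metis comp_apply ext id_apply surjD)
  with gf show "f \<in> Lin_units"
    unfolding Lin_units_def f_def g_def using Lin_scale_left[OF Psi_Lin] by blast
  have comp: "(\<lambda>x. u * x + v * \<Psi> k s' x) \<circ> f = (\<lambda>x. (v * c) * x + (u * b) * \<Psi> h s x)" for u v
    by (auto simp: f_def eq algebra_simps)
  show "Cd h s = (\<lambda>g. g \<circ> f) ` Cd k s'"
  proof (intro equalityI subsetI)
    fix f' assume "f' \<in> Cd h s"
    then obtain u v where "f' = (\<lambda>x. u * x + v * \<Psi> h s x)"
      unfolding Cd_def by blast
    then have "f' = (\<lambda>x. v / b * x + u / c * \<Psi> k s' x) \<circ> f"
      unfolding comp using b c by simp
    then show "f' \<in> (\<lambda>g. g \<circ> f) ` Cd k s'"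
      using CdI by blast
  next
    fix f' assume "f' \<in> (\<lambda>g. g \<circ> f) ` Cd k s'"
    then obtain u v where "f' = (\<lambda>x. u * x + v * \<Psi> k s' x) \<circ> f"
      unfolding Cd_def by blast
    then show "f' \<in> Cd h s"
      unfolding comp using CdI by blast
  qed
qed

text \<open>The left factor of an equivalence normalises the left idealiser, which consists of the scalars,
  and is therefore a semilinear monomial.\<close>

lemma equivalent_imp_comp:
  assumes s: "coprime_exp s" and "equivalent (Cd h s) (Cd k s')"
  shows "\<exists>\<kappa> a b c\<^sub>0 c. field_isom \<kappa> \<and> (\<forall>x. \<Psi> (\<kappa> k) s' (a * x + b * \<Psi> h s x) = c\<^sub>0 * x + c * \<Psi> h s x)
    \<and> bij (\<lambda>x. a * x + b * \<Psi> h s x)"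
proof -
  let ?i = "inv_into UNIV"
  obtain f1 f2 \<rho> where f: "f1 \<in> Lin_units" "f2 \<in> Lin_units" and \<rho>: "field_isom \<rho>"
    and C: "Cd h s = (\<lambda>g. f1 \<circ> (\<rho> \<circ> g \<circ> ?i \<rho>) \<circ> f2) ` Cd k s'"
    using assms(2) unfolding equivalent_def by blast
  interpret \<rho>: field_isom \<rho> by fact
  have \<rho>i: "\<rho> (?i \<rho> x) = x" for x
    using surj_f_inv_f[OF \<rho>.surj] .
  have bij: "bij f1" "bij f2"
    using f Lin_units_bij by blast+
  have f1i: "f1 (?i f1 x) = x" "?i f1 (f1 x) = x" for x
    using bij(1) by (simp_all add: bij_is_inj bij_is_surj surj_f_inv_f)
  have f1_add: "f1 (x + y) = f1 x + f1 y" for x y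
    using f(1) Lin_additive unfolding Lin_units_def by blast
  have f1_0: "f1 0 = 0"
    using f1_add[of 0 0] by (metis add.right_neutral add_left_cancel)
  have f1_1: "f1 1 \<noteq> 0"
    by (metis f1_0 f1i(2) zero_neq_one)
  \<comment> \<open>The scalar \<open>a\<close> is the image of some \<open>g\<close> of the other
    code, which is closed under left multiplication by \<open>\<rho>\<inverse>(l)\<close>. So the
    conjugate of \<open>l\<close> by \<open>f1\<close> maps scalars into the code, as
    \<open>left_idealiser\<close> requires.\<close>
  have in_code: "(\<lambda>x. f1 (l * ?i f1 (a * x))) \<in> Cd h s" for l a
  proof -
    have "(\<lambda>x. a * x + 0 * \<Psi> h s x) \<in> Cd h s"
      by (rule CdI)
    then obtain g where g: "g \<in> Cd k s'" "(\<lambda>x. a * x + 0 * \<Psi> h s x) = f1 \<circ> (\<rho> \<circ> g \<circ> ?i \<rho>) \<circ> f2"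
      unfolding C by blast
    obtain u v where uv: "\<And>x. g x = u * x + v * \<Psi> k s' x"
      using CdE[OF g(1)] by blast
    define g' where "g' = (\<lambda>x. (?i \<rho> l * u) * x + (?i \<rho> l * v) * \<Psi> k s' x)"
    have g': "g' \<in> Cd k s'"
      unfolding g'_def by (rule CdI)
    have g'g: "\<rho> (g' x) = l * \<rho> (g x)" for x
      by (simp add: g'_def uv \<rho>.hom_add \<rho>.hom_mult \<rho>i algebra_simps)
    have "?i f1 (a * x) = \<rho> (g (?i \<rho> (f2 x)))" for x
      using fun_cong[OF g(2), of x] f1i(2) by simp
    then have "(\<lambda>x. f1 (l * ?i f1 (a * x))) = f1 \<circ> (\<rho> \<circ> g' \<circ> ?i \<rho>) \<circ> f2"
      by (auto simp: g'g)
    then show "(\<lambda>x. f1 (l * ?i f1 (a * x))) \<in> Cd h s"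
      unfolding C using g' by blast
  qed
  \<comment> \<open>Normalised to \<open>\<theta> 1 = 1\<close>, the additive map \<open>f1\<close>
    becomes multiplicative once conjugates of scalars are known to be scalars.\<close>
  define \<theta> where "\<theta> x = f1 x / f1 1" for x
  have semilinear: "f1 (l * y) = \<theta> l * f1 y" for l y
  proof -
    obtain d e where de: "\<And>x. f1 (l * ?i f1 (1 * x)) = d * x + e * \<Psi> h s x"
      using CdE[OF in_code[of l 1]] by blast
    have "e = 0"
    proof (rule left_idealiser[OF s])
      show "\<exists>d' e'. \<forall>x. d * (a * x) + e * \<Psi> h s (a * x) = d' * x + e' * \<Psi> h s x" for a
      proof -
        obtain d' e' where "\<And>x. f1 (l * ?i f1 (a * x)) = d' * x + e' * \<Psi> h s x"
          using CdE[OF in_code[of l a]] by blast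
        then have "\<forall>x. d * (a * x) + e * \<Psi> h s (a * x) = d' * x + e' * \<Psi> h s x"
          using de by (metis mult_1)
        then show ?thesis by blast
      qed
    qed
    then have "f1 (l * ?i f1 x) = d * x" for x
      using de[of x] by simp
    then have "f1 (l * y) = d * f1 y" for y
      by (metis f1i(2))
    from this[of y] this[of 1] show ?thesis
      using f1_1 by (simp add: \<theta>_def)
  qed
  have f1_eq: "f1 x = f1 1 * \<theta> x" for x
    using f1_1 by (simp add: \<theta>_def)
  have "surj \<theta>"
  proof (rule surjI)
    show "\<theta> (?i f1 (f1 1 * x)) = x" for x
      using f1_1 by (simp add: \<theta>_def f1i)
  qed
  moreover have "\<theta> (x * y) = \<theta> x * \<theta> y" for x y
    by (simp add: \<theta>_def[of "x * y"] semilinear) (simp add: \<theta>_def)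
  ultimately have \<theta>: "field_isom \<theta>"
    by unfold_locales (simp_all add: \<theta>_def f1_add f1_0 f1_1 add_divide_distrib)
  then interpret \<theta>: field_isom \<theta> .
  \<comment> \<open>Both automorphisms are moved past \<open>\<Psi>\<close>, which turns
    \<open>k\<close> into \<open>\<kappa> k\<close>. The images of the identity and of
    \<open>\<Psi> k s'\<close> then give the inner map and the equation for the composition, up to
    division by \<open>f1 1\<close>.\<close>
  define \<kappa> where "\<kappa> = \<theta> \<circ> \<rho>"
  have \<kappa>: "field_isom \<kappa>"
    unfolding \<kappa>_def by (rule field_isom_comp[OF \<theta> \<rho>])
  have "(\<lambda>x. 1 * x + 0 * \<Psi> k s' x) \<in> Cd k s'" "(\<lambda>x. 0 * x + 1 * \<Psi> k s' x) \<in> Cd k s'"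
    by (rule CdI)+
  then have "f1 \<circ> (\<rho> \<circ> (\<lambda>x. 1 * x + 0 * \<Psi> k s' x) \<circ> ?i \<rho>) \<circ> f2 \<in> Cd h s"
    "f1 \<circ> (\<rho> \<circ> (\<lambda>x. 0 * x + 1 * \<Psi> k s' x) \<circ> ?i \<rho>) \<circ> f2 \<in> Cd h s"
    unfolding C by blast+
  moreover have "f1 \<circ> (\<rho> \<circ> (\<lambda>x. 1 * x + 0 * \<Psi> k s' x) \<circ> ?i \<rho>) \<circ> f2 = (\<lambda>x. f1 1 * \<theta> (f2 x))"
    by (auto simp: \<rho>i f1_eq[of "f2 _"])
  moreover have "f1 \<circ> (\<rho> \<circ> (\<lambda>x. 0 * x + 1 * \<Psi> k s' x) \<circ> ?i \<rho>) \<circ> f2 = (\<lambda>x. f1 1 * \<Psi> (\<kappa> k) s' (\<theta> (f2 x)))"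
    by (auto simp: \<rho>i f1_eq[of "\<Psi> _ _ _"] field_isom_Psi[OF \<rho>] field_isom_Psi[OF \<theta>] \<kappa>_def)
  ultimately have "(\<lambda>x. f1 1 * \<theta> (f2 x)) \<in> Cd h s" "(\<lambda>x. f1 1 * \<Psi> (\<kappa> k) s' (\<theta> (f2 x))) \<in> Cd h s"
    by simp_all
  then obtain a b c\<^sub>0 c where ab: "\<And>x. f1 1 * \<theta> (f2 x) = a * x + b * \<Psi> h s x"
    and cc: "\<And>x. f1 1 * \<Psi> (\<kappa> k) s' (\<theta> (f2 x)) = c\<^sub>0 * x + c * \<Psi> h s x"
    by (metis CdE)
  have ab': "\<theta> (f2 x) = a / f1 1 * x + b / f1 1 * \<Psi> h s x" for x
  proof -
    have "\<theta> (f2 x) = (a * x + b * \<Psi> h s x) / f1 1"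
      using f1_1 by (metis ab nonzero_eq_divide_eq mult.commute)
    then show ?thesis
      by (simp only: add_divide_distrib times_divide_eq_left)
  qed
  have "\<Psi> (\<kappa> k) s' (\<theta> (f2 x)) = c\<^sub>0 / f1 1 * x + c / f1 1 * \<Psi> h s x" for x
  proof -
    have "\<Psi> (\<kappa> k) s' (\<theta> (f2 x)) = (c\<^sub>0 * x + c * \<Psi> h s x) / f1 1"
      using f1_1 by (metis cc nonzero_eq_divide_eq mult.commute)
    then show ?thesis
      by (simp only: add_divide_distrib times_divide_eq_left)
  qed
  then have "\<Psi> (\<kappa> k) s' (a / f1 1 * x + b / f1 1 * \<Psi> h s x) = c\<^sub>0 / f1 1 * x + c / f1 1 * \<Psi> h s x" for x
    unfolding ab' .
  moreover have "bij (\<theta> \<circ> f2)"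
    using bij(2) \<theta>.inj_f \<open>surj \<theta>\<close> by (intro bij_comp) (auto simp: bij_def)
  then have "bij (\<lambda>x. a / f1 1 * x + b / f1 1 * \<Psi> h s x)"
    unfolding o_def ab' .
  ultimately show ?thesis
    using \<kappa> by blast
qed

subsection \<open>Classification of the codes\<close>

abbreviation j :: nat where
  "j \<equiv> j_param p r t"

lemma q_squared: "q ^ 2 = p ^ (2 * r)"
  by (simp add: q mult.commute flip: power_mult)

text \<open>The left side is \<open>m ^ (q\<^sup>2 + 1)\<close>, the source of the value
  \<open>p ^ (2 * r) + 1\<close> of \<open>j\<close>.\<close>

lemma inverse_pair_iff_root_of_unity:
  assumes "t mod 4 = 2"
  shows "m * \<Phi> 2 m = 1 \<longleftrightarrow> m ^ j = 1"
  using Phi_of_nat[of 2 m] by (simp add: assms j_param_def q_squared)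

lemma equivalent_imp_dvd:
  assumes "h \<in> H" "coprime_exp s" "coprime_exp s'" "equivalent (Cd h s) (Cd k s')"
  shows "int t dvd s' - s \<or> int t dvd s' + s"
proof -
  obtain \<kappa> a b c\<^sub>0 c where "\<And>x. \<Psi> (\<kappa> k) s' (a * x + b * \<Psi> h s x) = c\<^sub>0 * x + c * \<Psi> h s x"
    and "bij (\<lambda>x. a * x + b * \<Psi> h s x)"
    using equivalent_imp_comp[OF assms(2,4)] by blast
  then show ?thesis
    using Psi_comp_not_in_code[OF assms(1-3) _ _ _ bij_is_surj] by blast
qed

text \<open>An equivalence makes \<open>m = \<kappa> k / h\<close> satisfy
  \<open>m * \<Phi> (2 * s) m = 1\<close>, whence \<open>m ^ j = 1\<close>. Conversely such an
  \<open>m\<close> is realised by \<open>Psi_scale_same\<close> if \<open>t mod 4 = 2\<close>;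
  otherwise it is a sign, which does not change \<open>\<Psi>\<close>.\<close>

lemma equivalent_same_generator_iff:
  assumes h: "h \<in> H" and k: "k \<in> H" and s: "coprime_exp s"
  shows "equivalent (Cd h s) (Cd k s) \<longleftrightarrow> (\<exists>\<kappa> m. field_isom \<kappa> \<and> m ^ j = 1 \<and> \<kappa> k = m * h)"
proof
  assume "equivalent (Cd h s) (Cd k s)"
  then obtain \<kappa> a b c\<^sub>0 c where \<kappa>: "field_isom \<kappa>"
    and eq: "\<And>x. \<Psi> (\<kappa> k) s (a * x + b * \<Psi> h s x) = c\<^sub>0 * x + c * \<Psi> h s x"
    and bij: "bij (\<lambda>x. a * x + b * \<Psi> h s x)"
    using equivalent_imp_comp[OF s] by blast
  have \<kappa>k: "\<kappa> k \<in> H"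
    by (rule field_isom_H[OF \<kappa> k])
  have "a \<noteq> 0 \<or> b \<noteq> 0"
  proof (rule ccontr)
    assume "\<not> ?thesis"
    then have "inj (\<lambda>x::'a. 0::'a)"
      using bij by (simp add: bij_is_inj)
    then show False
      by (metis injD zero_neq_one)
  qed
  then have prod: "\<kappa> k * \<Phi> (2 * s) (\<kappa> k) = h * \<Phi> (2 * s) h"
    using Psi_comp_same_generator[OF h \<kappa>k s eq] by blast
  have nz: "h \<noteq> 0" "\<kappa> k \<noteq> 0"
    using h \<kappa>k H_nonzero by auto
  define m where "m = \<kappa> k / h"
  have m: "\<kappa> k = m * h" and m0: "m \<noteq> 0"
    using nz by (simp_all add: m_def)
  have "m * \<Phi> (2 * s) m = 1"
    using prod nz by (simp add: m_def)
  note cases = inverse_pair_cases[OF s this]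
  \<comment> \<open>Both elements have norm \<open>-1\<close>, so \<open>m\<close> has norm 1; when
    4 divides \<open>t\<close> this reads \<open>m\<^sup>2 = 1\<close>.\<close>
  have mt: "m * \<Phi> (int t) m = 1"
    using h \<kappa>k nz by (simp add: m_def H_iff)
  have "m ^ j = 1"
  proof (cases "t mod 4 = 2")
    case True
    then show ?thesis
      using cases(5) inverse_pair_iff_root_of_unity by blast
  next
    case False
    then have "odd t \<or> t mod 4 = 0" by presburger
    then have "m\<^sup>2 = 1"
      using cases(2,3) mt by (auto simp: power2_eq_square)
    with False show ?thesis by (simp add: j_param_def)
  qed
  with \<kappa> m show "\<exists>\<kappa> m. field_isom \<kappa> \<and> m ^ j = 1 \<and> \<kappa> k = m * h"
    by blast
next
  assume "\<exists>\<kappa> m. field_isom \<kappa> \<and> m ^ j = 1 \<and> \<kappa> k = m * h"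
  then obtain \<kappa> m where \<kappa>: "field_isom \<kappa>" and m: "m ^ j = 1" "\<kappa> k = m * h" by blast
  have "equivalent (Cd h s) (Cd (m * h) s)"
  proof (cases "t mod 4 = 2")
    case True
    then have m2: "m * \<Phi> 2 m = 1"
      using m(1) inverse_pair_iff_root_of_unity by blast
    have m0: "m \<noteq> 0" using m2 by auto
    then have "\<Phi> 2 m = 1 / m"
      using m2 by (simp add: field_simps)
    then have "\<Phi> 2 (\<Phi> 2 m) = m"
      by (metis Phi_divide Phi_one divide_divide_eq_right div_by_1 mult_1)
    then have "\<Phi> 4 m = m" by simp
    moreover have "4 dvd 2 * s - 2"
      using odd_if_coprime_exp[OF s] by presburger
    ultimately have "m * \<Phi> (2 * s) m = 1"
      using Phi_fixed_cong[of 4 m "2 * s" 2] m2 by simp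
    then show ?thesis
      using Psi_scale_same[OF h s True] equivalent_scale by blast
  next
    case False
    then have "m = 1 \<or> m = - 1"
      using m(1) by (simp add: j_param_def power2_eq_1_iff)
    then have "Cd (m * h) s = Cd h s"
      by (elim disjE) (simp_all add: Cd_def Psi_uminus)
    then show ?thesis
      by (simp add: equivalent_refl)
  qed
  moreover have "equivalent (Cd (m * h) s) (Cd k s)"
    using equivalent_conj[OF \<kappa>, of k s] m(2) by simp
  ultimately show "equivalent (Cd h s) (Cd k s)"
    by (rule equivalent_trans)
qed

lemma equivalent_uminus: "h \<in> H \<Longrightarrow> coprime_exp s \<Longrightarrow> equivalent (Cd h s) (Cd (1 / h) (- s))"
  using Psi_inverse equivalent_inverse by meson

lemma coprime_exp_t_minus:
  assumes "coprime_exp s" "even t"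
  shows "coprime_exp (int t - s)"
proof -
  have "odd (int t - s)"
    using odd_if_coprime_exp[OF assms(1)] assms(2) by simp
  moreover have "coprime (int t - s) (int t)"
    using coprime_exp_t[OF assms(1)]
    by (metis add_diff_cancel_left' coprime_commute coprime_iff_gcd_eq_1 diff_add_cancel gcd_diff2)
  ultimately show ?thesis
    by (simp add: coprime_mult_right_iff)
qed

text \<open>For \<open>t mod 4 = 2\<close> one passes to \<open>t - s\<close> and then inverts, as
  \<open>- (t - s)\<close> and \<open>t + s\<close> agree modulo \<open>2 * t\<close>. If 4 divides
  \<open>t\<close>, a single scaling does it.\<close>

lemma ex_equivalent_t_plus:
  assumes h: "h \<in> H" and s: "coprime_exp s" and ev: "even t"
  shows "\<exists>k\<in>H. equivalent (Cd h s) (Cd k (int t + s))"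
proof (cases "t mod 4 = 2")
  case True
  have "equivalent (Cd h s) (Cd h (int t - s))"
    using Psi_scale_t_minus[OF h s True] equivalent_scale by blast
  moreover have "equivalent (Cd h (int t - s)) (Cd (1 / h) (- (int t - s)))"
    by (rule equivalent_uminus[OF h coprime_exp_t_minus[OF s ev]])
  moreover have "Cd (1 / h) (- (int t - s)) = Cd (1 / h) (int t + s)"
    by (rule Cd_cong) simp
  ultimately show ?thesis
    using equivalent_trans H_inverse[OF h] by metis
next
  case False
  with ev have t4: "t mod 4 = 0" by presburger
  obtain a e where "a \<noteq> 0" "e \<noteq> 0" "\<And>x. \<Psi> (1 / h) (int t + s) (a * x) = e * \<Psi> h s x"
    using Psi_scale_t_plus[OF h s t4] by blast
  then have "equivalent (Cd h s) (Cd (1 / h) (int t + s))"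
    by (rule equivalent_scale)
  then show ?thesis
    using H_inverse[OF h] by blast
qed

text \<open>Exponents congruent modulo \<open>t\<close> agree or differ by \<open>t\<close> modulo
  \<open>2 * t\<close>. Since both are odd, the latter needs even \<open>t\<close> and is covered by
  \<open>ex_equivalent_t_plus\<close>; inversion handles the opposite sign.\<close>

lemma ex_equivalent:
  assumes k: "k \<in> H" and s: "coprime_exp s" and s': "coprime_exp s'"
    and dvd: "int t dvd s' - s \<or> int t dvd s' + s"
  shows "\<exists>h\<in>H. equivalent (Cd k s') (Cd h s)"
proof -
  have same: "\<exists>h\<in>H. equivalent (Cd k s') (Cd h s)"
    if k: "k \<in> H" and s': "coprime_exp s'" and dvd: "int t dvd s' - s" for k s'
  proof -
    obtain m where m: "s' - s = int t * m" using dvd by blast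
    show ?thesis
    proof (cases "even m")
      case True
      then have "int (2 * t) dvd s' - s" by (auto simp: m)
      then show ?thesis
        using Cd_cong equivalent_refl k by metis
    next
      case False
      have "even (s' - s)"
        using odd_if_coprime_exp s s' by auto
      then have "even t" using False by (simp add: m)
      then obtain h where h: "h \<in> H" "equivalent (Cd k s') (Cd h (int t + s'))"
        using ex_equivalent_t_plus[OF k s'] by blast
      have "int t + s' - s = int t * (1 + m)"
        using m by (simp add: algebra_simps)
      then have "int (2 * t) dvd int t + s' - s"
        using False by auto
      then show ?thesis
        using Cd_cong h by metis
    qed
  qed
  show ?thesis
  proof (cases "int t dvd s' - s")
    case True
    then show ?thesis using same k s' by blast
  next
    case False
    then have "int t dvd - s' - s"
      using dvd dvd_minus_iff[of "int t" "s' + s"] by simp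
    then obtain h where "h \<in> H" "equivalent (Cd (1 / k) (- s')) (Cd h s)"
      using same[OF H_inverse[OF k], of "- s'"] s' by (auto simp del: coprime_mult_right_iff)
    then show ?thesis
      using equivalent_uminus[OF k s'] equivalent_trans by blast
  qed
qed

text \<open>The orbits of the group generated by field automorphisms and multiplication by
  \<open>j\<close>-th roots of unity, written without a group action.\<close>

definition orbit_rel :: "('a \<times> 'a) set" where
  "orbit_rel = {(h, k). h \<in> H \<and> k \<in> H \<and> (\<exists>\<kappa> m. field_isom \<kappa> \<and> m ^ j = 1 \<and> \<kappa> k = m * h)}"

definition code_rel :: "(('a \<Rightarrow> 'a) set \<times> ('a \<Rightarrow> 'a) set) set" where
  "code_rel = {(C1, C2). C1 \<in> codes q t \<and> C2 \<in> codes q t \<and> equivalent C1 C2}"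

lemma equiv_code_rel: "equiv (codes q t) code_rel"
proof (rule equivI)
  show "code_rel \<subseteq> codes q t \<times> codes q t" "refl_on (codes q t) code_rel"
    by (auto simp: refl_on_def code_rel_def equivalent_refl)
  show "sym code_rel"
    by (auto simp: sym_def code_rel_def equivalent_sym)
  show "trans code_rel"
    unfolding trans_def code_rel_def using equivalent_trans by blast
qed

text \<open>One representative from each pair \<open>{u, - u}\<close> of units modulo
  \<open>t\<close>.\<close>

definition reps :: "nat set" where
  "reps = {u. 0 < u \<and> 2 * u < t \<and> coprime u t}"

text \<open>Residues modulo \<open>t\<close> are lifted to odd numbers, so that they become units modulo \<open>2 * t\<close>.\<close>

definition lift :: "nat \<Rightarrow> int" where
  "lift u = (if odd u then int u else int (t + u))"

lemma coprime_exp_lift: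
  assumes "coprime u t"
  shows "coprime_exp (lift u)"
proof -
  have "odd u \<or> odd t"
    using assms coprime_common_divisor[of u t 2] by fastforce
  then have "odd (lift u)" by (auto simp: lift_def)
  moreover have "coprime (lift u) (int t)"
  proof -
    have "gcd (u + t) t = gcd u t" by simp
    then have "coprime (t + u) t"
      using assms by (simp only: coprime_iff_gcd_eq_1 add.commute)
    then have "coprime (int (t + u)) (int t)" "coprime (int u) (int t)"
      using assms by (simp_all only: coprime_int_iff)
    then show ?thesis
      unfolding lift_def by (cases "odd u") (simp_all del: of_nat_add)
  qed
  ultimately show ?thesis
    by (simp add: coprime_mult_right_iff)
qed

lemma lift_mod: "int t dvd lift u - int u"
  by (simp add: lift_def)

lemma reps_distinct:
  assumes "u \<in> reps" "v \<in> reps" "int t dvd lift v - lift u \<or> int t dvd lift v + lift u"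
  shows "u = v"
proof -
  have uv: "0 < u" "2 * u < t" "0 < v" "2 * v < t"
    using assms(1,2) by (auto simp: reps_def)
  from assms(3) have "int t dvd int v - int u \<or> int t dvd int v + int u"
  proof
    assume "int t dvd lift v - lift u"
    from dvd_add[OF dvd_diff[OF this lift_mod] lift_mod]
    have "int t dvd (lift v - lift u) - (lift v - int v) + (lift u - int u)" .
    then show ?thesis by (simp add: algebra_simps)
  next
    assume "int t dvd lift v + lift u"
    from dvd_diff[OF dvd_diff[OF this lift_mod] lift_mod]
    have "int t dvd (lift v + lift u) - (lift v - int v) - (lift u - int u)" .
    then show ?thesis by (simp add: algebra_simps)
  qed
  then show ?thesis
  proof
    assume "int t dvd int v - int u"
    moreover have "\<bar>int v - int u\<bar> < \<bar>int t\<bar>"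
      using uv by simp
    ultimately have "int v - int u = 0"
      using dvd_imp_le_int[of "int v - int u" "int t"] by linarith
    then show ?thesis by simp
  next
    assume "int t dvd int v + int u"
    then show ?thesis
      using uv by (auto dest!: zdvd_imp_le)
  qed
qed

lemma ex_rep:
  assumes s: "coprime_exp s"
  shows "\<exists>u\<in>reps. int t dvd s - lift u \<or> int t dvd s + lift u"
proof -
  define v where "v = nat (s mod int t)"
  have v: "int v = s mod int t" by (simp add: v_def)
  have vt: "v < t"
    using v by (metis of_nat_less_iff pos_mod_bound of_nat_0_less_iff t_pos)
  have cop: "coprime v t"
  proof -
    have "coprime (s mod int t) (int t)"
      using coprime_exp_t[OF s] by simp
    then show ?thesis unfolding v[symmetric] by simp
  qed
  have sv: "int t dvd s - int v"
    unfolding v by (simp add: minus_mod_eq_mult_div)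
  have v0: "v \<noteq> 0"
    using cop t by (intro notI) auto
  have v2: "2 * v \<noteq> t"
  proof
    assume "2 * v = t"
    then have "v dvd t" by (metis dvd_triv_right)
    then have "v = 1" using cop by (metis coprime_absorb_left nat_dvd_1_iff_1)
    then show False using t \<open>2 * v = t\<close> by simp
  qed
  show ?thesis
  proof (cases "2 * v < t")
    case True
    then have "v \<in> reps" using cop v0 by (simp add: reps_def)
    moreover have "int t dvd (s - int v) - (lift v - int v)"
      by (intro dvd_diff sv lift_mod)
    ultimately show ?thesis by (intro bexI[of _ v]) auto
  next
    case False
    have "coprime (t - v) t"
    proof (rule coprimeI)
      fix c assume c: "c dvd t - v" "c dvd t"
      from dvd_diff_nat[OF c(2,1)] have "c dvd v"
        using vt by simp
      then show "is_unit c"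
        using cop c(2) coprime_common_divisor by blast
    qed
    then have "t - v \<in> reps" using False v2 vt by (simp add: reps_def)
    moreover have "int t dvd (s - int v) + (lift (t - v) - int (t - v)) + int t"
      by (intro dvd_add sv lift_mod) simp
    then have "int t dvd s + lift (t - v)"
      using vt by (simp add: of_nat_diff algebra_simps)
    ultimately show ?thesis by blast
  qed
qed

subsection \<open>Counting the classes\<close>

lemma odd_q_power: "odd (q ^ m)"
  using p q by simp

lemma j_pos: "j > 0"
  by (simp add: j_param_def)

text \<open>\<open>q ^ (2 * t) - 1\<close> is \<open>q ^ t + 1\<close> times an even number. The
  factor 2 lets \<open>X ^ (q ^ t + 1) + 1\<close> split with distinct roots in the large
  field.\<close>

lemma twice_norm_exponent_dvd: "2 * (q ^ t + 1) dvd CARD('a) - 1"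
proof -
  obtain c where c: "q ^ t = 2 * c + 1"
    using odd_q_power[of t] by (rule oddE)
  have "CARD('a) = q ^ t * q ^ t"
    by (simp add: card mult_2 power_add)
  then have "CARD('a) - 1 = 2 * (q ^ t + 1) * c"
    unfolding c by (simp add: algebra_simps)
  then show ?thesis by (simp only: dvd_triv_left)
qed

text \<open>Needed for multiplication by these roots of unity to preserve \<open>H\<close>.\<close>

lemma root_of_unity_norm:
  assumes "m ^ j = 1"
  shows "m * \<Phi> (int t) m = 1"
proof (cases "t mod 4 = 2")
  case True
  have "coprime_exp 1" "m * \<Phi> (2 * 1) m = 1"
    using inverse_pair_iff_root_of_unity[OF True] assms by simp_all
  then show ?thesis
    using inverse_pair_cases(4) True by blast
next
  case False
  then have "m = 1 \<or> m = - 1"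
    using assms by (simp add: j_param_def power2_eq_1_iff)
  then show ?thesis by auto
qed

lemma root_of_unity_H:
  assumes "m ^ j = 1" "h \<in> H"
  shows "m * h \<in> H"
proof -
  have "m * h * \<Phi> (int t) (m * h) = (m * \<Phi> (int t) m) * (h * \<Phi> (int t) h)"
    by (simp add: algebra_simps)
  also have "\<dots> = - 1"
    by (simp only: root_of_unity_norm[OF assms(1)] assms(2)[unfolded H_iff] mult_1)
  finally show ?thesis by (simp only: H_iff)
qed

text \<open>This ensures that the field contains all \<open>j\<close>-th roots of unity. In the case
  \<open>j = q\<^sup>2 + 1\<close>, the congruence of \<open>q\<^sup>2\<close> and \<open>-1\<close>
  is raised to the even power \<open>t\<close>; otherwise only parity is at stake.\<close>

lemma j_dvd: "j dvd CARD('a) - 1"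
proof (cases "t mod 4 = 2")
  case True
  then have "even t" by presburger
  then obtain b where b: "t = 2 * b" by blast
  have "[int q ^ 2 = - 1] (mod int (q ^ 2 + 1))"
    by (simp add: cong_iff_dvd_diff add.commute)
  from cong_pow[OF this, of "2 * b"]
  have "[int q ^ (2 * t) = 1] (mod int (q ^ 2 + 1))"
    by (simp add: b flip: power_mult)
  then have "int (q ^ 2 + 1) dvd int (q ^ (2 * t)) - 1"
    by (simp add: cong_iff_dvd_diff)
  also have "int (q ^ (2 * t)) - 1 = int (q ^ (2 * t) - 1)"
    using q_gt_1 by (simp add: of_nat_diff)
  finally have "q ^ 2 + 1 dvd q ^ (2 * t) - 1"
    by (simp only: of_nat_dvd_iff)
  then show ?thesis
    using True by (simp add: j_param_def card q_squared)
next
  case False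
  then show ?thesis
    using odd_q_power[of "2 * t"] by (simp add: j_param_def card)
qed

lemma card_roots_j: "card {m::'a. m ^ j = 1} = j"
  by (rule card_roots_of_unity[OF j_dvd j_pos])

section \<open>Burnside's lemma for the orbits\<close>

definition automorphisms :: "('a \<Rightarrow> 'a) set" where
  "automorphisms = {\<kappa>. field_isom \<kappa>}"

text \<open>The automorphisms that carry \<open>k\<close> to \<open>h\<close> up to a root of unity;
  the root is recovered as \<open>\<kappa> k / h\<close>, so it need not be recorded.\<close>

definition transporter :: "'a \<Rightarrow> 'a \<Rightarrow> ('a \<Rightarrow> 'a) set" where
  "transporter h k = {\<kappa> \<in> automorphisms. (\<kappa> k / h) ^ j = 1}"

lemma orbit_rel_iff: "(h, k) \<in> orbit_rel \<longleftrightarrow> h \<in> H \<and> k \<in> H \<and> transporter h k \<noteq> {}"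
proof -
  have "(\<exists>m. m ^ j = 1 \<and> \<kappa> k = m * h) \<longleftrightarrow> (\<kappa> k / h) ^ j = 1" if "h \<in> H" for \<kappa> :: "'a \<Rightarrow> 'a"
    using H_nonzero[OF that] by (auto intro!: exI[of _ "\<kappa> k / h"])
  then show ?thesis
    unfolding orbit_rel_def transporter_def automorphisms_def by auto
qed

text \<open>The properties are inherited from equivalence of codes at the exponent 1.\<close>

lemma equiv_orbit_rel: "equiv H orbit_rel"
proof -
  have "orbit_rel = {(h, k). h \<in> H \<and> k \<in> H \<and> equivalent (Cd h 1) (Cd k 1)}"
    unfolding orbit_rel_def using equivalent_same_generator_iff[of _ _ 1] by auto
  then show ?thesis
    by (intro equivI) (auto simp: refl_on_def sym_def trans_def
      intro: equivalent_refl equivalent_sym elim: equivalent_trans)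
qed

text \<open>Composition with a fixed \<open>\<kappa>\<^sub>0\<close> in
  \<open>transporter h k\<close> identifies the stabiliser of \<open>k\<close> with
  \<open>transporter h k\<close>.\<close>

lemma card_transporter:
  assumes hk: "(h, k) \<in> orbit_rel"
  shows "card (transporter h k) = card (transporter k k)"
proof -
  obtain \<kappa>\<^sub>0 where \<kappa>\<^sub>0: "\<kappa>\<^sub>0 \<in> transporter h k" and H: "h \<in> H" "k \<in> H"
    using hk orbit_rel_iff by auto
  then have isom: "field_isom \<kappa>\<^sub>0" and root: "(\<kappa>\<^sub>0 k / h) ^ j = 1"
    by (auto simp: transporter_def automorphisms_def)
  interpret \<kappa>\<^sub>0: field_isom \<kappa>\<^sub>0 by fact
  have nz: "h \<noteq> 0" "k \<noteq> 0" "\<kappa>\<^sub>0 k \<noteq> 0"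
    using H H_nonzero field_isom_H[OF isom] by auto
  have inv: "\<kappa>\<^sub>0 (inv_into UNIV \<kappa>\<^sub>0 x) = x" "inv_into UNIV \<kappa>\<^sub>0 (\<kappa>\<^sub>0 x) = x" for x
    using \<kappa>\<^sub>0.surj \<kappa>\<^sub>0.inj_f by (simp_all add: surj_f_inv_f)
  have key: "(\<kappa>\<^sub>0 x / h) ^ j = 1 \<longleftrightarrow> (x / k) ^ j = 1" for x
  proof -
    have split: "\<kappa>\<^sub>0 x / h = \<kappa>\<^sub>0 (x / k) * (\<kappa>\<^sub>0 k / h)"
      using nz by (simp add: \<kappa>\<^sub>0.hom_div)
    have "(\<kappa>\<^sub>0 x / h) ^ j = \<kappa>\<^sub>0 ((x / k) ^ j)"
      unfolding split power_mult_distrib root by (simp only: mult_1_right \<kappa>\<^sub>0.hom_power)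
    also have "\<dots> = 1 \<longleftrightarrow> (x / k) ^ j = 1"
      by (metis \<kappa>\<^sub>0.hom_one inv(2))
    finally show ?thesis .
  qed
  have "bij_betw (\<lambda>\<kappa>. \<kappa>\<^sub>0 \<circ> \<kappa>) (transporter k k) (transporter h k)"
  proof (rule bij_betw_byWitness[where f' = "\<lambda>\<kappa>. inv_into UNIV \<kappa>\<^sub>0 \<circ> \<kappa>"])
    show "(\<lambda>\<kappa>. \<kappa>\<^sub>0 \<circ> \<kappa>) ` transporter k k \<subseteq> transporter h k"
      using key field_isom_comp[OF isom] by (auto simp: transporter_def automorphisms_def)
    show "(\<lambda>\<kappa>. inv_into UNIV \<kappa>\<^sub>0 \<circ> \<kappa>) ` transporter h k \<subseteq> transporter k k"
      using key[of "inv_into UNIV \<kappa>\<^sub>0 _"] field_isom_comp[OF field_isom_inv[OF isom]]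
      by (auto simp: transporter_def automorphisms_def inv)
  qed (auto simp: fun_eq_iff inv)
  then show ?thesis
    by (metis bij_betw_same_card)
qed

text \<open>Each automorphism \<open>\<kappa>\<close> and root of unity \<open>m\<close> belong to
  exactly one \<open>k\<close> with \<open>\<kappa> k = m * h\<close>, so the triples are counted by
  the pairs.\<close>

lemma sum_card_transporter_orbit:
  assumes h: "h \<in> H"
  shows "(\<Sum>k\<in>orbit_rel `` {h}. card (transporter h k)) = card automorphisms * j"
proof -
  have h0: "h \<noteq> 0" using H_nonzero[OF h] .
  have inv: "\<kappa> (inv_into UNIV \<kappa> x) = x" "inv_into UNIV \<kappa> (\<kappa> x) = x" if "\<kappa> \<in> automorphisms" for \<kappa> :: "'a \<Rightarrow> 'a" and x
  proof -
    interpret field_isom \<kappa> using that by (simp add: automorphisms_def)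
    show "\<kappa> (inv_into UNIV \<kappa> x) = x" "inv_into UNIV \<kappa> (\<kappa> x) = x"
      using surj inj_f by (simp_all add: surj_f_inv_f)
  qed
  define g where "g = (\<lambda>(\<kappa> :: 'a \<Rightarrow> 'a, m). (inv_into UNIV \<kappa> (m * h), \<kappa>))"
  have "bij_betw g (automorphisms \<times> {m::'a. m ^ j = 1}) (SIGMA k:orbit_rel `` {h}. transporter h k)"
  proof (rule bij_betw_byWitness[where f' = "\<lambda>(k, \<kappa>). (\<kappa>, \<kappa> k / h)"])
    show "g ` (automorphisms \<times> {m::'a. m ^ j = 1}) \<subseteq> (SIGMA k:orbit_rel `` {h}. transporter h k)"
    proof
      fix y assume "y \<in> g ` (automorphisms \<times> {m::'a. m ^ j = 1})"
      then obtain \<kappa> m where y: "y = (inv_into UNIV \<kappa> (m * h), \<kappa>)" and \<kappa>: "\<kappa> \<in> automorphisms" and m: "m ^ j = 1"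
        by (auto simp: g_def)
      have "inv_into UNIV \<kappa> (m * h) \<in> H"
        using field_isom_H[OF field_isom_inv root_of_unity_H[OF m h]] \<kappa> by (simp add: automorphisms_def)
      moreover have "\<kappa> \<in> transporter h (inv_into UNIV \<kappa> (m * h))"
        using \<kappa> m h0 by (simp add: transporter_def inv)
      ultimately show "y \<in> (SIGMA k:orbit_rel `` {h}. transporter h k)"
        using h by (auto simp: y orbit_rel_iff)
    qed
    show "(\<lambda>(k, \<kappa>). (\<kappa>, \<kappa> k / h)) ` (SIGMA k:orbit_rel `` {h}. transporter h k) \<subseteq> automorphisms \<times> {m::'a. m ^ j = 1}"
      by (auto simp: transporter_def)
  qed (auto simp: g_def transporter_def inv h0)
  then have "card (SIGMA k:orbit_rel `` {h}. transporter h k) = card (automorphisms \<times> {m::'a. m ^ j = 1})"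
    by (metis bij_betw_same_card)
  then show ?thesis
    by (simp add: card_cartesian_product card_roots_j)
qed

text \<open>Within an orbit, stabilisers may be replaced by transporters to one fixed element, so
  every orbit contributes the same amount.\<close>

lemma burnside:
  "card (H // orbit_rel) * (card automorphisms * j) = (\<Sum>k\<in>H. card (transporter k k))"
proof -
  have "(\<Sum>k\<in>H. card (transporter k k)) = (\<Sum>Y\<in>H // orbit_rel. \<Sum>k\<in>Y. card (transporter k k))"
  proof -
    have "sum (\<lambda>k. card (transporter k k)) (\<Union>(H // orbit_rel))
        = (sum \<circ> sum) (\<lambda>k. card (transporter k k)) (H // orbit_rel)"
      using quotient_disj[OF equiv_orbit_rel] by (intro sum.Union_disjoint) auto
    then show ?thesis
      by (simp add: Union_quotient[OF equiv_orbit_rel])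
  qed
  also have "\<dots> = (\<Sum>Y\<in>H // orbit_rel. card automorphisms * j)"
  proof (rule sum.cong[OF refl])
    fix Y assume "Y \<in> H // orbit_rel"
    then obtain h where h: "h \<in> H" "Y = orbit_rel `` {h}"
      by (rule quotientE)
    then have "(\<Sum>k\<in>Y. card (transporter k k)) = (\<Sum>k\<in>Y. card (transporter h k))"
      using card_transporter by (intro sum.cong) auto
    then show "(\<Sum>k\<in>Y. card (transporter k k)) = card automorphisms * j"
      using sum_card_transporter_orbit[OF h(1)] h(2) by simp
  qed
  finally show ?thesis by simp
qed

lemma card_automorphisms: "card automorphisms = 2 * r * t"
  and sum_card_transporter: "(\<Sum>k\<in>H. card (transporter k k))
    = (\<Sum>i<2 * r * t. card {k \<in> H. k ^ (j * (p ^ i - 1)) = 1})"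
proof -
  have N: "CARD('a) = CHAR('a) ^ (2 * r * t)" "2 * r * t > 0"
    using r by (simp_all add: card_char algebra_simps)
  note aut = automorphisms_eq[OF N, folded automorphisms_def, unfolded char]
  show "card automorphisms = 2 * r * t"
    unfolding aut(1) using card_image[OF aut(2)] by simp
  \<comment> \<open>Pairs of an element and a stabilising automorphism are counted the other way
    round, by the fixed points of each automorphism.\<close>
  have "(\<Sum>k\<in>H. card (transporter k k)) = (\<Sum>\<kappa>\<in>automorphisms. card {k \<in> H. (\<kappa> k / k) ^ j = 1})"
    unfolding transporter_def card_eq_sum by (rule sum.swap_restrict) simp_all
  also have "\<dots> = (\<Sum>i<2 * r * t. card {k \<in> H. (k ^ (p ^ i) / k) ^ j = 1})"
    unfolding aut(1) by (simp add: sum.reindex[OF aut(2)])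
  also have "\<dots> = (\<Sum>i<2 * r * t. card {k \<in> H. k ^ (j * (p ^ i - 1)) = 1})"
  proof (rule sum.cong[OF refl])
    fix i
    \<comment> \<open>For \<open>i = 0\<close> the exponent on the right is 0 and the condition is
      empty, in accordance with the second polynomial being 0.\<close>
    have "(k ^ (p ^ i) / k) ^ j = k ^ (j * (p ^ i - 1))" if "k \<in> H" for k
    proof -
      have "p ^ i > 0" using p(1) prime_gt_0_nat by simp
      then have "k ^ (p ^ i) = k ^ (p ^ i - 1) * k"
        by (metis Suc_diff_1 power_Suc2)
      then have "k ^ (p ^ i) / k = k ^ (p ^ i - 1)"
        using H_nonzero[OF that] by simp
      then show ?thesis by (simp add: mult.commute flip: power_mult)
    qed
    then have "{k \<in> H. (k ^ (p ^ i) / k) ^ j = 1} = {k \<in> H. k ^ (j * (p ^ i - 1)) = 1}"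
      by auto
    then show "card {k \<in> H. (k ^ (p ^ i) / k) ^ j = 1} = card {k \<in> H. k ^ (j * (p ^ i - 1)) = 1}"
      by simp
  qed
  finally show "(\<Sum>k\<in>H. card (transporter k k)) = (\<Sum>i<2 * r * t. card {k \<in> H. k ^ (j * (p ^ i - 1)) = 1})" .
qed

section \<open>From orbits to equivalence classes of codes\<close>

lemma code_rel_iff:
  assumes "h \<in> H" "k \<in> H" "u \<in> reps" "v \<in> reps"
  shows "(Cd h (lift u), Cd k (lift v)) \<in> code_rel \<longleftrightarrow> u = v \<and> (h, k) \<in> orbit_rel"
proof -
  have lift: "coprime_exp (lift u)" "coprime_exp (lift v)"
    using assms(3,4) coprime_exp_lift by (auto simp: reps_def)
  have "(Cd h (lift u), Cd k (lift v)) \<in> code_rel \<longleftrightarrow> equivalent (Cd h (lift u)) (Cd k (lift v))"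
  proof -
    have "Cd h (lift u) \<in> codes q t" "Cd k (lift v) \<in> codes q t"
      unfolding codes_eq using assms(1,2) lift by blast+
    then show ?thesis by (simp add: code_rel_def)
  qed
  also have "\<dots> \<longleftrightarrow> u = v \<and> equivalent (Cd h (lift u)) (Cd k (lift u))"
    using equivalent_imp_dvd[OF assms(1) lift] reps_distinct[OF assms(3,4)] by blast
  also have "\<dots> \<longleftrightarrow> u = v \<and> (h, k) \<in> orbit_rel"
    using equivalent_same_generator_iff[OF assms(1,2) lift(1)] assms(1,2) by (simp add: orbit_rel_def)
  finally show ?thesis .
qed

text \<open>A class is given by a representative \<open>u\<close> of the generators together with an
  orbit of parameters \<open>h\<close>.\<close>

lemma card_quotient_codes: "card (codes q t // code_rel) = card reps * card (H // orbit_rel)"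
proof -
  \<comment> \<open>The image of the whole orbit is taken so that no element has to be chosen; it is
    a single class.\<close>
  define F where "F = (\<lambda>(u, Y). code_rel `` ((\<lambda>h. Cd h (lift u)) ` Y))"
  have Cd_codes: "Cd h (lift u) \<in> codes q t" if "h \<in> H" "u \<in> reps" for h u
    using that coprime_exp_lift unfolding codes_eq reps_def by blast
  have F: "F (u, orbit_rel `` {h}) = code_rel `` {Cd h (lift u)}" if hu: "h \<in> H" "u \<in> reps" for h u
  proof -
    have "code_rel `` {Cd k (lift u)} = code_rel `` {Cd h (lift u)}" if "k \<in> orbit_rel `` {h}" for k
    proof -
      have hk: "(h, k) \<in> orbit_rel" using that by simp
      then have "k \<in> H" by (simp add: orbit_rel_iff)
      then have "(Cd h (lift u), Cd k (lift u)) \<in> code_rel"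
        using code_rel_iff hu hk by simp
      then show ?thesis
        using equiv_class_eq[OF equiv_code_rel] by metis
    qed
    moreover have "h \<in> orbit_rel `` {h}"
      using equiv_class_self[OF equiv_orbit_rel hu(1)] .
    moreover have "F (u, orbit_rel `` {h}) = (\<Union>k\<in>orbit_rel `` {h}. code_rel `` {Cd k (lift u)})"
      by (auto simp: F_def)
    ultimately show ?thesis by blast
  qed
  have "bij_betw F (reps \<times> (H // orbit_rel)) (codes q t // code_rel)"
  proof (rule bij_betw_imageI)
    show "inj_on F (reps \<times> (H // orbit_rel))"
    proof (rule inj_onI, clarify)
      fix u Y v Z
      assume u: "u \<in> reps" and v: "v \<in> reps" and Y: "Y \<in> H // orbit_rel" and Z: "Z \<in> H // orbit_rel"
        and eq: "F (u, Y) = F (v, Z)"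
      obtain h where h: "h \<in> H" "Y = orbit_rel `` {h}" using Y by (rule quotientE)
      obtain k where k: "k \<in> H" "Z = orbit_rel `` {k}" using Z by (rule quotientE)
      have "code_rel `` {Cd h (lift u)} = code_rel `` {Cd k (lift v)}"
        using eq F h k u v by simp
      then have "(Cd h (lift u), Cd k (lift v)) \<in> code_rel"
        using eq_equiv_class_iff[OF equiv_code_rel] Cd_codes h k u v by blast
      then have "u = v" "(h, k) \<in> orbit_rel"
        using code_rel_iff h k u v by blast+
      then show "u = v \<and> Y = Z"
        using equiv_class_eq[OF equiv_orbit_rel] h k by blast
    qed
    show "F ` (reps \<times> (H // orbit_rel)) = codes q t // code_rel"
    proof (intro equalityI subsetI)
      fix X assume "X \<in> F ` (reps \<times> (H // orbit_rel))"
      then obtain u Y where u: "u \<in> reps" and Y: "Y \<in> H // orbit_rel" and X: "X = F (u, Y)" by blast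
      obtain h where h: "h \<in> H" "Y = orbit_rel `` {h}" using Y by (rule quotientE)
      show "X \<in> codes q t // code_rel"
        unfolding X h(2) F[OF h(1) u] by (rule quotientI[OF Cd_codes[OF h(1) u]])
    next
      fix X assume "X \<in> codes q t // code_rel"
      then obtain C where C: "C \<in> codes q t" "X = code_rel `` {C}" by (rule quotientE)
      obtain k s where k: "k \<in> H" "coprime_exp s" "C = Cd k s"
        using C(1) unfolding codes_eq by blast
      obtain u where u: "u \<in> reps" "int t dvd s - lift u \<or> int t dvd s + lift u"
        using ex_rep[OF k(2)] by blast
      have "coprime_exp (lift u)"
        using u(1) coprime_exp_lift by (simp only: reps_def mem_Collect_eq)
      then obtain h where h: "h \<in> H" "equivalent (Cd k s) (Cd h (lift u))"
        using ex_equivalent[OF k(1) _ k(2) u(2)] by blast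
      have "(C, Cd h (lift u)) \<in> code_rel"
        using C(1) Cd_codes[OF h(1) u(1)] h(2) k(3) unfolding code_rel_def by simp
      then have "X = F (u, orbit_rel `` {h})"
        unfolding C(2) F[OF h(1) u(1)] by (rule equiv_class_eq[OF equiv_code_rel])
      then show "X \<in> F ` (reps \<times> (H // orbit_rel))"
        using u(1) quotientI[OF h(1)] by blast
    qed
  qed
  then show ?thesis
    by (metis bij_betw_same_card card_cartesian_product)
qed

lemma code_classes_eq:
  assumes "gal_generator q \<tau>"
  shows "code_classes q t \<tau> = codes q t // code_rel"
proof -
  have "C \<subseteq> Lin" if "C \<in> codes q t" for C
    using that Cd_subset_Lin unfolding codes_eq by blast
  then have "{(C1, C2). C1 \<in> codes q t \<and> C2 \<in> codes q t \<and> code_equiv (2 * t) \<tau> C1 C2} = code_rel"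
    unfolding code_rel_def code_equiv_iff[OF assms] by auto
  then show ?thesis by (simp add: code_classes_def)
qed

text \<open>The factor 4 combines the 2 in \<open>totient t = 2 * card reps\<close> with the 2 in
  the number \<open>2 * r * t\<close> of automorphisms. Denominators are cleared to remain in the
  natural numbers.\<close>

lemma card_code_classes:
  fixes \<tau> :: "'a \<Rightarrow> 'a"
  assumes "gal_generator q \<tau>"
  shows "card (code_classes q t \<tau>) * (4 * r * t * j)
    = totient t * (\<Sum>i<2 * r * t. card {k \<in> H. k ^ (j * (p ^ i - 1)) = 1})"
proof -
  have "totient t = 2 * card reps"
    using two_card_coprime_below_half[of t] t by (simp add: reps_def)
  moreover have orbits: "card (H // orbit_rel) * (2 * r * t * j)
      = (\<Sum>i<2 * r * t. card {k \<in> H. k ^ (j * (p ^ i - 1)) = 1})"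
    using burnside unfolding card_automorphisms sum_card_transporter .
  moreover have "card reps * card (H // orbit_rel) * (4 * r * t * j)
      = 2 * card reps * (card (H // orbit_rel) * (2 * r * t * j))"
    by (simp add: algebra_simps)
  ultimately show ?thesis
    unfolding code_classes_eq[OF assms] card_quotient_codes by (simp only:)
qed

end

theorem theorem4p10:
  fixes p q r n t :: nat and \<tau> :: "'a::finite_field \<Rightarrow> 'a"
  assumes "prime p" and "odd p" and "r \<ge> 1" and "q = p ^ r"
    and "t \<ge> 5" and "n = 2 * t"
    and "CARD('p::prime_card) = p"
    and "CARD('a) = q ^ n"
    and "gal_generator q \<tau>"
  shows "real (card (code_classes q t \<tau>)) =
    real (totient t) / real (4 * r * t * j_param p r t) *
    (\<Sum>i = 0..2 * r * t - 1.
      real (degree (gcd (monom 1 (p ^ (r * t) + 1) + 1 :: 'p mod_ring poly)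
                        (monom 1 (j_param p r t * (p ^ i - 1)) - 1))))"
proof -
  interpret even_ext p r q t "TYPE('a)"
    using assms by unfold_locales simp_all
  have "p ^ (r * t) = q ^ t"
    by (simp add: \<open>q = p ^ r\<close> power_mult)
  \<comment> \<open>The common roots in the large field are exactly the elements of \<open>H\<close>
    counted by Burnside's lemma.\<close>
  then have deg: "degree (gcd (monom 1 (p ^ (r * t) + 1) + 1 :: 'p mod_ring poly) (monom 1 m - 1))
      = card {k \<in> H. k ^ m = 1}" for m
    using degree_gcd_eq_card_common_roots[where ?'p = 'p, OF _ twice_norm_exponent_dvd] char assms(7)
    by (simp add: H_def)
  \<comment> \<open>The subtraction is truncated, so positivity of \<open>2 * r * t\<close> is
    needed.\<close>
  have "{0..2 * r * t - 1} = {..<2 * r * t}"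
  proof -
    have "2 * r * t > 0" using \<open>r \<ge> 1\<close> by simp
    then show ?thesis
      by (metis Suc_pred' atLeast0AtMost lessThan_Suc_atMost)
  qed
  moreover have "real (card (code_classes q t \<tau>)) * real (4 * r * t * j)
      = real (totient t) * (\<Sum>i<2 * r * t. real (card {k \<in> H. k ^ (j * (p ^ i - 1)) = 1}))"
    using arg_cong[OF card_code_classes[OF assms(9)], of real] by simp
  moreover have "real (4 * r * t * j) \<noteq> 0"
    using \<open>r \<ge> 1\<close> j_pos by simp
  ultimately show ?thesis
    unfolding deg by (simp only: nonzero_eq_divide_eq not_False_eq_True times_divide_eq_left)
qed

end
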